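(* In the setting described in the context, there exists a unique strong solution $Z=(X_t,Y_t,N_t)_{t\ge0}$ of the coupled system $$X_t=X_0+\int_{0+}^t\int_{\mathbb{R}}h_\Lambda(X_{u-},Y_{u-},N_{u-},v)\,\wp(du,dv),$$ $$Y_t=Y_0+t-\int_{0+}^t (Y_{u-})\int_{\mathbb{R}}g_\Lambda(X_{u-},Y_{u-},N_{u-},v)\,\wp(du,dv),$$ $$N_t=\int_{0+}^t\int_{\mathbb{R}}g_\Lambda(X_{u-},Y_{u-},N_{u-},v)\,\wp(du,dv),\qquad t\ge0.$$
   Context: $(\Omega,\mathcal{F},\{\mathcal{F}_t\}_{t\ge0},P)$ is a filtered probability space satisfying the usual hypothesis; $\mathcal{X}=\{1,2,\dots\}$ is the state space, embedded in $\mathbb{R}$; $\mathbb{N}_0=\{0,1,2,\dots\}$, $\mathbb{R}_+=[0,\infty)$; $m_d$ is Lebesgue measure on $\mathbb{R}^d$. $\mathcal{X}$ is endowed with a total order $\prec_1$, which induces a total order $\prec_2$ on $\mathcal{X}_2:=\{(i,j)\in\mathcal{X}^2: i\ne j\}$ by the lexicographic order. For each $(i,j)\in\mathcal{X}_2$, $\lambda_{ij}:\mathbb{R}_+\times\mathbb{N}_0\to\mathbb{R}_+$ is a bounded measurable function; $\lambda_i(y,n):=\sum_{j\in\mathcal{X}\setminus\{i\}}\lambda_{ij}(y,n)$. These satisfy: (A1) with $c_i:=\sum_{j\in\mathcal{X}\setminus\{i\}}\|\lambda_{ij}\|_{L^\infty(\mathbb{R}_+\times\mathbb{N}_0)}$,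 one has $c:=\sup_i c_i<\infty$; (A2) for each $n\in\mathbb{N}_0$ and $i\in\mathcal{X}$, $\lim_{y\to\infty}\gamma_i(y,n)=\infty$, where $\gamma_i(y,n):=\int_0^y\lambda_i(y',n)\,dy'$. For each $(i,j)\in\mathcal{X}_2$, $\tilde\lambda_{ij}:\mathbb{R}_+\times\mathbb{N}_0\to\mathbb{R}_+$ is a measurable function such that $\lambda_{ij}(y,n)\le\tilde\lambda_{ij}(y,n)$ for each $y\in\mathbb{R}_+$, $n\in\mathbb{N}_0$, and $\tilde\lambda_{ij}(y,n)\le\|\lambda_{ij}\|_{L^\infty(\mathbb{R}_+\times\mathbb{N}_0)}$ for almost every $y\in\mathbb{R}_+$ and $n\in\mathbb{N}_0$. For each $y,n$ a disjoint collection of intervals is defined by $$\Lambda_{ij}(y,n)=\Big(\sum_{(i',j')\prec_2(i,j)}\tilde\lambda_{i'j'}(y,n)\Big)+[0,\lambda_{ij}(y,n)),\qquad (i,j)\in\mathcal{X}_2,$$ where $a+B=\{a+b: b\in B\}$. The functions $h_\Lambda,g_\Lambda:\mathcal{X}\times\mathbb{R}_+\times\mathbb{N}_0\times\mathbb{R}\to\mathbb{R}$ are $$h_\Lambda(i,y,n,v):=\sum_{j\in\mathcal{X}\setminus\{i\}}(j-i)\mathbf{1}_{\Lambda_{ij}(y,n)}(v),\qquad g_\Lambda(i,y,n,v):=\sum_{j\in\mathcal{X}\setminus\{i\}}\mathbf{1}_{\Lambda_{ij}(y,n)}(v).$$ $\wp(du,dv)$ is a Poisson random measure on $\mathbb{R}_+\times\mathbb{R}$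 with intensity $m_2(du,dv)$, defined on $(\Omega,\mathcal{F},P)$, and $\{\wp((0,t]\times dv)\}_{t\ge0}$ is adapted to $\{\mathcal{F}_t\}_{t\ge0}$. The initial values are $X_0\in\mathcal{X}$, $Y_0\in\mathbb{R}_+$, $N_0=0$. $\int_{0+}^t$ denotes integration over $(0,t]$. *)

theory Defs
  imports "HOL-Probability.Probability"
begin

text \<open>The process lives on the states 1, 2, 3, ...; state-valued quantities have type \<^typ>\<open>nat\<close> and
  are required to lie in this set.\<close>

definition states :: "nat set" where
  "states = {1..}"

definition state_pairs :: "(nat \<times> nat) set" where
  "state_pairs = {(i, j). i \<in> states \<and> j \<in> states \<and> i \<noteq> j}"


section \<open>Filtrations and Poisson random measures\<close>

text \<open>Only the times \<open>t \<ge> 0\<close> matter; the values of \<open>F\<close> at negative times are irrelevant.\<close>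

definition filtration_on :: "'w measure \<Rightarrow> (real \<Rightarrow> 'w measure) \<Rightarrow> bool" where
  "filtration_on M F \<longleftrightarrow>
     (\<forall>t\<ge>0. space (F t) = space M \<and> sets (F t) \<subseteq> sets M) \<and>
     (\<forall>s\<ge>0. \<forall>t\<ge>s. sets (F s) \<subseteq> sets (F t))"

definition usual_hypothesis :: "'w measure \<Rightarrow> (real \<Rightarrow> 'w measure) \<Rightarrow> bool" where
  "usual_hypothesis M F \<longleftrightarrow>
     filtration_on M F \<and> complete_measure M \<and> null_sets M \<subseteq> sets (F 0) \<and>
     (\<forall>t\<ge>0. sets (F t) = (\<Inter>s\<in>{t<..}. sets (F s)))"

definition poisson_random_measure :: "'w measure \<Rightarrow> 'e measure \<Rightarrow> ('w \<Rightarrow> 'e measure) \<Rightarrow> bool" where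
  "poisson_random_measure M \<mu> \<pi> \<longleftrightarrow>
     (\<forall>\<omega>\<in>space M. sets (\<pi> \<omega>) = sets \<mu>) \<and>
     (\<forall>\<omega>\<in>space M. \<forall>A\<in>sets \<mu>. emeasure (\<pi> \<omega>) A \<in> range ennreal_of_enat) \<and>
     (\<forall>A\<in>sets \<mu>. (\<lambda>\<omega>. emeasure (\<pi> \<omega>) A) \<in> borel_measurable M) \<and>
     (\<forall>A\<in>sets \<mu>. emeasure \<mu> A < \<infinity> \<longrightarrow>
        (\<forall>k::nat. measure M {\<omega>\<in>space M. emeasure (\<pi> \<omega>) A = of_nat k} =
                  measure \<mu> A ^ k / fact k * exp (- measure \<mu> A))) \<and>
     (\<forall>A\<in>sets \<mu>. emeasure \<mu> A = \<infinity> \<longrightarrow> (AE \<omega> in M. emeasure (\<pi> \<omega>) A = \<infinity>)) \<and>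
     (\<forall>(n::nat) A. (\<forall>k<n. A k \<in> sets \<mu>) \<longrightarrow> disjoint_family_on A {..<n} \<longrightarrow>
        prob_space.indep_vars M (\<lambda>_. borel) (\<lambda>k \<omega>. emeasure (\<pi> \<omega>) (A k)) {..<n})"

text \<open>Planar Lebesgue measure on \<open>[0,\<infinity>) \<times> \<real>\<close>: time coordinate first, mark second.\<close>

definition strip_measure :: "(real \<times> real) measure" where
  "strip_measure = restrict_space lborel ({0..} \<times> UNIV)"

definition adapted_random_measure ::
    "(real \<Rightarrow> 'w measure) \<Rightarrow> ('w \<Rightarrow> (real \<times> real) measure) \<Rightarrow> bool" where
  "adapted_random_measure F \<pi> \<longleftrightarrow>
     (\<forall>t\<ge>0. \<forall>B\<in>sets borel. (\<lambda>\<omega>. emeasure (\<pi> \<omega>) ({0<..t} \<times> B)) \<in> borel_measurable (F t))"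


section \<open>Transition rates\<close>

type_synonym rates = "nat \<Rightarrow> nat \<Rightarrow> real \<Rightarrow> nat \<Rightarrow> real"

text \<open>Lebesgue measure times counting measure on \<open>[0,\<infinity>) \<times> \<nat>\<close>, for the arguments \<open>(y, n)\<close> of a rate.\<close>

definition age_count_measure :: "(real \<times> nat) measure" where
  "age_count_measure = restrict_space lborel {0..} \<Otimes>\<^sub>M count_space UNIV"

definition measurable_rates :: "rates \<Rightarrow> bool" where
  "measurable_rates lam \<longleftrightarrow>
     (\<forall>(i, j)\<in>state_pairs. (\<lambda>(y, n). lam i j y n) \<in> borel_measurable age_count_measure \<and>
        (\<forall>y\<ge>0. \<forall>n. 0 \<le> lam i j y n))"

definition bounded_rates :: "rates \<Rightarrow> bool" where
  "bounded_rates lam \<longleftrightarrow> (\<forall>(i, j)\<in>state_pairs. \<exists>K. \<forall>y\<ge>0. \<forall>n. lam i j y n \<le> K)"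

definition rate_norm :: "rates \<Rightarrow> nat \<Rightarrow> nat \<Rightarrow> ennreal" where
  "rate_norm lam i j = esssup age_count_measure (\<lambda>(y, n). ennreal \<bar>lam i j y n\<bar>)"

definition rate_bound :: "rates \<Rightarrow> nat \<Rightarrow> ennreal" where
  "rate_bound lam i = (\<Sum>\<^sub>\<infinity>j\<in>states - {i}. rate_norm lam i j)"

text \<open>Extended-valued, because for \<open>y\<close> in a null set the essential bounds on the individual rates do
  not prevent the sum from being infinite.\<close>

definition total_rate :: "rates \<Rightarrow> nat \<Rightarrow> real \<Rightarrow> nat \<Rightarrow> ennreal" where
  "total_rate lam i y n = (\<Sum>\<^sub>\<infinity>j\<in>states - {i}. ennreal (lam i j y n))"

definition cumulative_rate :: "rates \<Rightarrow> nat \<Rightarrow> real \<Rightarrow> nat \<Rightarrow> ennreal" where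
  "cumulative_rate lam i y n = (\<integral>\<^sup>+ y' \<in> {0..y}. total_rate lam i y' n \<partial>lborel)"


section \<open>The intervals and the coefficients of the equation\<close>

text \<open>Here \<open>R\<close> is the strict total order on the states. The total length of the intervals preceding
  \<open>(i, j)\<close> can be infinite, depending on \<open>R\<close> and, on a null set of \<open>y\<close>, on the rates. Then the
  interval \<open>\<infinity> + [0, lam)\<close> contains no real number.\<close>

definition interval_start :: "nat rel \<Rightarrow> rates \<Rightarrow> nat \<Rightarrow> nat \<Rightarrow> real \<Rightarrow> nat \<Rightarrow> ennreal" where
  "interval_start R lam_up i j y n =
     (\<Sum>\<^sub>\<infinity>(i', j') \<in> {p \<in> state_pairs. (p, (i, j)) \<in> R <*lex*> R}. ennreal (lam_up i' j' y n))"

definition jump_interval ::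
    "nat rel \<Rightarrow> rates \<Rightarrow> rates \<Rightarrow> nat \<Rightarrow> nat \<Rightarrow> real \<Rightarrow> nat \<Rightarrow> real set" where
  "jump_interval R lam lam_up i j y n =
     (if interval_start R lam_up i j y n = \<infinity> then {}
      else (\<lambda>b. enn2real (interval_start R lam_up i j y n) + b) ` {0..<lam i j y n})"

text \<open>The intervals are disjoint, so for each \<open>v\<close> the following sums have at most one nonzero term.\<close>

definition h_coeff ::
    "nat rel \<Rightarrow> rates \<Rightarrow> rates \<Rightarrow> nat \<Rightarrow> real \<Rightarrow> nat \<Rightarrow> real \<Rightarrow> real" where
  "h_coeff R lam lam_up i y n v =
     (\<Sum>\<^sub>\<infinity>j\<in>states - {i}. (real j - real i) * indicator (jump_interval R lam lam_up i j y n) v)"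

definition g_coeff ::
    "nat rel \<Rightarrow> rates \<Rightarrow> rates \<Rightarrow> nat \<Rightarrow> real \<Rightarrow> nat \<Rightarrow> real \<Rightarrow> real" where
  "g_coeff R lam lam_up i y n v = (\<Sum>\<^sub>\<infinity>j\<in>states - {i}. indicator (jump_interval R lam lam_up i j y n) v)"


section \<open>Strong solutions\<close>

definition left_lim :: "(real \<Rightarrow> 'a::t2_space) \<Rightarrow> real \<Rightarrow> 'a" where
  "left_lim f u = Lim (at_left u) f"

definition cadlag :: "(real \<Rightarrow> 'a::topological_space) \<Rightarrow> bool" where
  "cadlag f \<longleftrightarrow>
     (\<forall>t\<ge>0. (f \<longlongrightarrow> f t) (at_right t)) \<and> (\<forall>t>0. \<exists>l. (f \<longlongrightarrow> l) (at_left t))"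

text \<open>\<open>has_jump_integral \<rho> f t I\<close>: the integral of \<open>f u v\<close> against \<open>\<rho>\<close> over \<open>(0, t] \<times> \<real>\<close> exists
  and equals \<open>I\<close>.\<close>

definition has_jump_integral ::
    "(real \<times> real) measure \<Rightarrow> (real \<Rightarrow> real \<Rightarrow> real) \<Rightarrow> real \<Rightarrow> real \<Rightarrow> bool" where
  "has_jump_integral \<rho> f t I \<longleftrightarrow>
     set_integrable \<rho> ({0<..t} \<times> UNIV) (\<lambda>(u, v). f u v) \<and>
     set_lebesgue_integral \<rho> ({0<..t} \<times> UNIV) (\<lambda>(u, v). f u v) = I"

text \<open>The coupled system, for a single path \<open>(x, y, n)\<close> and a single realisation \<open>\<rho>\<close> of the random
  measure.\<close>

definition solves_system ::
    "nat rel \<Rightarrow> rates \<Rightarrow> rates \<Rightarrow> (real \<times> real) measure \<Rightarrow> nat \<Rightarrow> real \<Rightarrow>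
     (real \<Rightarrow> nat) \<Rightarrow> (real \<Rightarrow> real) \<Rightarrow> (real \<Rightarrow> nat) \<Rightarrow> bool" where
  "solves_system R lam lam_up \<rho> x0 y0 x y n \<longleftrightarrow>
     (\<forall>t\<ge>0.
        has_jump_integral \<rho>
          (\<lambda>u v. h_coeff R lam lam_up (left_lim x u) (left_lim y u) (left_lim n u) v)
          t (real (x t) - real x0) \<and>
        has_jump_integral \<rho>
          (\<lambda>u v. left_lim y u * g_coeff R lam lam_up (left_lim x u) (left_lim y u) (left_lim n u) v)
          t (y0 + t - y t) \<and>
        has_jump_integral \<rho>
          (\<lambda>u v. g_coeff R lam lam_up (left_lim x u) (left_lim y u) (left_lim n u) v)
          t (real (n t)))"

text \<open>A strong solution lives on the given filtered space, is driven by the given random measure and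
  is adapted to the given filtration.\<close>

definition strong_solution ::
    "'w measure \<Rightarrow> (real \<Rightarrow> 'w measure) \<Rightarrow> ('w \<Rightarrow> (real \<times> real) measure) \<Rightarrow>
     nat rel \<Rightarrow> rates \<Rightarrow> rates \<Rightarrow> ('w \<Rightarrow> nat) \<Rightarrow> ('w \<Rightarrow> real) \<Rightarrow>
     (real \<Rightarrow> 'w \<Rightarrow> nat) \<Rightarrow> (real \<Rightarrow> 'w \<Rightarrow> real) \<Rightarrow> (real \<Rightarrow> 'w \<Rightarrow> nat) \<Rightarrow> bool" where
  "strong_solution M F \<pi> R lam lam_up X0 Y0 X Y N \<longleftrightarrow>
     (\<forall>t\<ge>0. X t \<in> measurable (F t) (count_space UNIV) \<and>
             Y t \<in> borel_measurable (F t) \<and>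
             N t \<in> measurable (F t) (count_space UNIV)) \<and>
     (\<forall>t\<ge>0. \<forall>\<omega>\<in>space M. X t \<omega> \<in> states \<and> 0 \<le> Y t \<omega>) \<and>
     (AE \<omega> in M. cadlag (\<lambda>t. X t \<omega>) \<and> cadlag (\<lambda>t. Y t \<omega>) \<and> cadlag (\<lambda>t. N t \<omega>) \<and>
        solves_system R lam lam_up (\<pi> \<omega>) (X0 \<omega>) (Y0 \<omega>)
          (\<lambda>t. X t \<omega>) (\<lambda>t. Y t \<omega>) (\<lambda>t. N t \<omega>))"


section \<open>Initial values\<close>

text \<open>Random initial values known at time 0 and independent of the driving random measure. Constants
  always qualify. Since the filtration is only required to make the random measure adapted, the
  independence has to be requested separately.\<close>

definition initial_values ::
    "'w measure \<Rightarrow> (real \<Rightarrow> 'w measure) \<Rightarrow> ('w \<Rightarrow> (real \<times> real) measure) \<Rightarrow>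
     ('w \<Rightarrow> nat) \<Rightarrow> ('w \<Rightarrow> real) \<Rightarrow> bool" where
  "initial_values M F \<pi> X0 Y0 \<longleftrightarrow>
     X0 \<in> measurable (F 0) (count_space UNIV) \<and> Y0 \<in> borel_measurable (F 0) \<and>
     (\<forall>\<omega>\<in>space M. X0 \<omega> \<in> states \<and> 0 \<le> Y0 \<omega>) \<and>
     prob_space.indep_set M
       (sets (vimage_algebra (space M) (\<lambda>\<omega>. (X0 \<omega>, Y0 \<omega>)) (count_space UNIV \<Otimes>\<^sub>M borel)))
       (sigma_sets (space M)
          {(\<lambda>\<omega>. emeasure (\<pi> \<omega>) A) -` B \<inter> space M | A B. A \<in> sets strip_measure \<and> B \<in> sets borel})"

lemma initial_values_const:
  assumes M: "prob_space M"
    and \<pi>: "poisson_random_measure M strip_measure \<pi>"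
    and x: "x \<in> states" and y: "0 \<le> y"
  shows "initial_values M F \<pi> (\<lambda>_. x) (\<lambda>_. y)"
proof -
  interpret prob_space M by fact
  let ?G = "sets (vimage_algebra (space M) (\<lambda>_. (x, y)) (count_space UNIV \<Otimes>\<^sub>M borel))"
  let ?H = "sigma_sets (space M)
    {(\<lambda>\<omega>. emeasure (\<pi> \<omega>) A) -` B \<inter> space M | A B. A \<in> sets strip_measure \<and> B \<in> sets borel}"
  have G: "a = {} \<or> a = space M" if "a \<in> ?G" for a
    using that by (auto simp: sets_vimage_algebra2 space_pair_measure split: if_splits)
  have H: "?H \<subseteq> events"
    using \<pi> by (intro sets.sigma_sets_subset)
      (auto simp: poisson_random_measure_def intro: measurable_sets)
  have "indep_set ?G ?H"
    unfolding indep_sets2_eq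
  proof (intro conjI ballI)
    show "?G \<subseteq> events" using G by auto
    show "?H \<subseteq> events" by (fact H)
    fix a b assume ab: "a \<in> ?G" "b \<in> ?H"
    then have "b \<subseteq> space M" using H sets.sets_into_space by blast
    with G[OF ab(1)] show "prob (a \<inter> b) = prob a * prob b"
      by (auto simp: prob_space Int_absorb1)
  qed
  then show ?thesis
    using x y by (simp add: initial_values_def)
qed

end

theory Submission
  imports Defs
begin

text \<open>Given the realisation of the random measure, two solutions that agree before some time agree at
  that time, because the equations only involve left limits, and slightly beyond it, because \<open>N\<close> is
  constant there and so no jump occurs. For existence, let the next jump after the \<open>k\<close>-th one happen at
  the first point of the random measure whose mark is accepted. The accepted marks of different states
  may be spread over an unbounded set, and the initial segments of the intervals may depend wildly
  on the age, so that the accepted points need not lie in a strip of finite width; but the age is a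
  translate of time, so their conditional intensity is at most \<open>c\<close>. By the compensation formula for
  predictable sets, this makes the first accepted point well defined and the expected number of jumps
  up to time \<open>t\<close> at most \<open>c * t\<close>.\<close>

section \<open>Rates and jump intervals\<close>

text \<open>The filtration \<open>F\<close> is only known to make the random measure adapted. It may
  reveal later points (it may even be the full sigma-algebra at every time), and then no
  compensation formula holds for \<open>F\<close>-predictable sets. The estimates therefore run over
  a smaller filtration \<open>G\<close>, generated by the initial values and the past counts; since
  the initial values are independent of the random measure, \<open>G s\<close> is independent of the
  points after \<open>s\<close>. In general \<open>G\<close> is not right continuous, so jump times
  are controlled through the events \<open>T k < r\<close>, and the right continuity of
  \<open>F\<close> recovers \<open>T k \<le> t\<close>. A realisation is a measure, not a list of
  points, so the first accepted point is an infimum of times with nonzero accepted mass; that it is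
  attained rests on integer masses, finite in bounded time. The constant \<open>c\<close> is the
  supremum in (A1): the accepted marks have length at most the total rate, which is at most
  \<open>c\<close> for almost every age.\<close>

abbreviation plane :: "(real \<times> real) measure" where
  "plane \<equiv> borel \<Otimes>\<^sub>M borel"

text \<open>Turns unordered sums into series, to which countable subadditivity and the measurability
  of countable sums apply.\<close>

lemma infsum_ennreal_eq_suminf:
  fixes f :: "nat \<Rightarrow> ennreal"
  shows "infsum f A = (\<Sum>n. if n \<in> A then f n else 0)"
proof -
  have "infsum f A = infsum (\<lambda>n. if n \<in> A then f n else 0) UNIV"
    by (intro infsum_cong_neutral) auto
  also have "(\<lambda>n. if n \<in> A then f n else 0) sums \<dots>"
    by (intro has_sum_imp_sums has_sum_infsum nonneg_summable_on_complete) simp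
  then have "infsum (\<lambda>n. if n \<in> A then f n else 0) UNIV = (\<Sum>n. if n \<in> A then f n else 0)"
    by (rule sums_unique)
  finally show ?thesis .
qed

lemma borel_measurable_infsum_ennreal:
  fixes f :: "'i::countable \<Rightarrow> 'a \<Rightarrow> ennreal"
  assumes [measurable]: "\<And>i. i \<in> A \<Longrightarrow> f i \<in> borel_measurable M"
  shows "(\<lambda>x. \<Sum>\<^sub>\<infinity>i\<in>A. f i x) \<in> borel_measurable M"
proof -
  have inj: "inj_on (from_nat :: nat \<Rightarrow> 'i) (to_nat ` A)"
    by (auto simp: inj_on_def)
  have im: "from_nat ` to_nat ` A = A"
    by (auto simp: image_image)
  have "(\<Sum>\<^sub>\<infinity>i\<in>A. f i x) = (\<Sum>n. if n \<in> to_nat ` A then f (from_nat n) x else 0)" for x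
    using infsum_reindex[OF inj, of "\<lambda>i. f i x"]
    by (simp add: im infsum_ennreal_eq_suminf comp_def)
  moreover have "(\<lambda>x. if n \<in> to_nat ` A then f (from_nat n) x else 0) \<in> borel_measurable M" for n
    by (cases "n \<in> to_nat ` A") auto
  ultimately show ?thesis
    by (simp cong: measurable_cong)
qed

text \<open>Rate bounds hold off a null set of ages. The age at time \<open>u\<close> is
  \<open>u - a\<close>, so the exceptional times are a translate of that set and again null.\<close>

lemma lborel_AE_shift:
  assumes "AE y in lborel. P (y::real)"
  shows "AE u in lborel. P (u - a)"
proof -
  have "AE y in distr lborel borel ((+) (- a)). P y"
    using assms by (subst lborel_distr_plus)
  then have "AE u in lborel. P (- a + u)"
    by (rule AE_distrD[rotated]) simp
  then show ?thesis by (simp add: add.commute)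
qed

text \<open>Rates are controlled only for nonnegative ages. Composing with \<open>max 0\<close>
  extends them to the whole line, where Borel measurability can be combined with other
  functions.\<close>

lemma borel_measurable_rates:
  assumes "measurable_rates r" "(i, j) \<in> state_pairs"
  shows "(\<lambda>y. r i j (max 0 y) n) \<in> borel_measurable borel"
proof -
  have *: "(\<lambda>(y, n). r i j y n) \<in> borel_measurable age_count_measure"
    using assms by (auto simp: measurable_rates_def)
  have "(\<lambda>y::real. max 0 y) \<in> borel \<rightarrow>\<^sub>M restrict_space lborel {0..}"
    by (intro measurable_restrict_space2) auto
  then have "(\<lambda>y. (max 0 y, n)) \<in> borel \<rightarrow>\<^sub>M age_count_measure"
    unfolding age_count_measure_def by measurable
  from measurable_compose[OF this *] show ?thesis by simp
qed

text \<open>In the application \<open>c\<close> is the real value of the supremum in (A1). The null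
  set of ages in \<open>total_rate_le\<close> may depend on \<open>i\<close> and
  \<open>n\<close>.\<close>

locale jump_rates =
  fixes R :: "nat rel" and lam lam_up :: rates and c :: real
  assumes order: "strict_linear_order_on states R"
    and lam: "measurable_rates lam" and lam_up: "measurable_rates lam_up"
    and lam_le: "\<And>i j y n. (i, j) \<in> state_pairs \<Longrightarrow> 0 \<le> y \<Longrightarrow> lam i j y n \<le> lam_up i j y n"
    and c_nonneg: "0 \<le> c"
    and total_rate_le: "\<And>i n. i \<in> states \<Longrightarrow> AE y in lborel. 0 \<le> y \<longrightarrow> total_rate lam i y n \<le> ennreal c"
begin

abbreviation \<Lambda> :: "nat \<Rightarrow> nat \<Rightarrow> real \<Rightarrow> nat \<Rightarrow> real set" where
  "\<Lambda> \<equiv> jump_interval R lam lam_up"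

abbreviation h\<Lambda> :: "nat \<Rightarrow> real \<Rightarrow> nat \<Rightarrow> real \<Rightarrow> real" where
  "h\<Lambda> \<equiv> h_coeff R lam lam_up"

abbreviation g\<Lambda> :: "nat \<Rightarrow> real \<Rightarrow> nat \<Rightarrow> real \<Rightarrow> real" where
  "g\<Lambda> \<equiv> g_coeff R lam lam_up"

text \<open>The marks at which a point of the random measure triggers a jump out of
  \<open>i\<close>; the coefficient \<open>g\<Lambda>\<close> is the indicator of this set.\<close>

definition accept :: "nat \<Rightarrow> real \<Rightarrow> nat \<Rightarrow> real set" where
  "accept i y n = (\<Union>j\<in>states - {i}. \<Lambda> i j y n)"

lemma mem_jump_interval:
  "v \<in> \<Lambda> i j y n \<longleftrightarrow> interval_start R lam_up i j y n \<noteq> \<infinity> \<and>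
    enn2real (interval_start R lam_up i j y n) \<le> v \<and>
    v < enn2real (interval_start R lam_up i j y n) + lam i j y n"
  by (auto simp: jump_interval_def image_add_atLeastLessThan add.commute)

lemma jump_interval_borel: "\<Lambda> i j y n \<in> sets borel"
  unfolding jump_interval_def image_add_atLeastLessThan by simp

lemma lam_nonneg: "(i, j) \<in> state_pairs \<Longrightarrow> 0 \<le> y \<Longrightarrow> 0 \<le> lam i j y n"
  using lam by (auto simp: measurable_rates_def)

text \<open>If \<open>j\<close> precedes \<open>j'\<close>, then \<open>(i, j)\<close> and all its
  predecessors precede \<open>(i, j')\<close>. So the interval of \<open>j'\<close> starts at least
  \<open>lam_up i j\<close>, hence at least \<open>lam i j\<close>, after the start of the interval
  of \<open>j\<close>.\<close>

lemma jump_interval_disjoint_aux: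
  assumes ij: "(i, j) \<in> state_pairs" "(i, j') \<in> state_pairs" and y: "0 \<le> y" and R: "(j, j') \<in> R"
  shows "\<Lambda> i j y n \<inter> \<Lambda> i j' y n = {}"
proof (cases "interval_start R lam_up i j' y n = \<infinity>")
  case True
  then show ?thesis by (simp add: jump_interval_def)
next
  case False
  let ?up = "\<lambda>(i', j'). ennreal (lam_up i' j' y n)"
  let ?P = "\<lambda>j. {p \<in> state_pairs. (p, (i, j)) \<in> R <*lex*> R}"
  from order have "trans R" "irrefl R"
    by (auto simp: strict_linear_order_on_def)
  then have sub: "insert (i, j) (?P j) \<subseteq> ?P j'" and nin: "(i, j) \<notin> ?P j"
    using ij R by (auto simp: irrefl_def dest: transD)
  have "ennreal (lam i j y n) + interval_start R lam_up i j y n \<le>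
      ennreal (lam_up i j y n) + interval_start R lam_up i j y n"
    by (intro add_mono ennreal_leI lam_le ij y order_refl)
  also have "\<dots> = infsum ?up ({(i, j)} \<union> ?P j)"
    using nin
    by (subst infsum_Un_disjoint) (auto simp: interval_start_def intro: nonneg_summable_on_complete)
  also have "\<dots> \<le> interval_start R lam_up i j' y n"
    using sub unfolding interval_start_def
    by (intro infsum_mono_neutral nonneg_summable_on_complete) auto
  finally have le: "ennreal (lam i j y n) + interval_start R lam_up i j y n
    \<le> interval_start R lam_up i j' y n" .
  then have "interval_start R lam_up i j y n < \<infinity>"
    using False by (auto simp: top.not_eq_extremum[symmetric] top_unique)
  moreover have "0 \<le> lam i j y n" by (rule lam_nonneg) fact+
  ultimately have "lam i j y n + enn2real (interval_start R lam_up i j y n)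
    \<le> enn2real (interval_start R lam_up i j' y n)"
    using le False
    by (cases "interval_start R lam_up i j y n"; cases "interval_start R lam_up i j' y n")
      (auto simp: ennreal_plus[symmetric] simp del: ennreal_plus)
  then show ?thesis
    by (auto simp: jump_interval_def)
qed

lemma jump_interval_disjoint:
  assumes "i \<in> states" "j \<in> states - {i}" "j' \<in> states - {i}" "0 \<le> y" "v \<in> \<Lambda> i j y n" "v \<in> \<Lambda> i j' y n"
  shows "j = j'"
proof (rule ccontr)
  assume "j \<noteq> j'"
  with order assms(2,3) have "(j, j') \<in> R \<or> (j', j) \<in> R"
    by (auto simp: strict_linear_order_on_def total_on_def)
  with jump_interval_disjoint_aux[of i j j' y n] jump_interval_disjoint_aux[of i j' j y n] assms
  show False by (auto simp: state_pairs_def)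
qed

lemma h_coeff_eq:
  assumes "i \<in> states" "j \<in> states - {i}" "0 \<le> y" "v \<in> \<Lambda> i j y n"
  shows "h\<Lambda> i y n v = real j - real i"
proof -
  have "v \<notin> \<Lambda> i j' y n" if "j' \<in> states - {i}" "j' \<noteq> j" for j'
    using jump_interval_disjoint assms that by blast
  then have "h\<Lambda> i y n v =
      (\<Sum>\<^sub>\<infinity>j\<in>{j}. (real j - real i) * indicator (\<Lambda> i j y n) v)"
    unfolding h_coeff_def using assms
    by (intro infsum_cong_neutral) (auto simp: indicator_def)
  then show ?thesis using assms by simp
qed

lemma h_coeff_eq_0: "v \<notin> accept i y n \<Longrightarrow> h\<Lambda> i y n v = 0"
  unfolding h_coeff_def by (intro infsum_0) (auto simp: accept_def)

lemma g_coeff_eq: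
  assumes "i \<in> states" "0 \<le> y"
  shows "g\<Lambda> i y n v = indicator (accept i y n) v"
proof (cases "v \<in> accept i y n")
  case False
  then show ?thesis
    unfolding g_coeff_def by (subst infsum_0) (auto simp: accept_def)
next
  case True
  then obtain j where j: "j \<in> states - {i}" "v \<in> \<Lambda> i j y n" by (auto simp: accept_def)
  have "v \<notin> \<Lambda> i j' y n" if "j' \<in> states - {i}" "j' \<noteq> j" for j'
    using jump_interval_disjoint assms j that by blast
  then have "g\<Lambda> i y n v = (\<Sum>\<^sub>\<infinity>j\<in>{j}. indicator (\<Lambda> i j y n) v)"
    unfolding g_coeff_def using assms j
    by (intro infsum_cong_neutral) (auto simp: indicator_def)
  then show ?thesis using True j by simp
qed

lemma g_coeff_nonneg: "0 \<le> g\<Lambda> i y n v"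
  unfolding g_coeff_def by (intro infsum_nonneg) auto

lemma borel_measurable_interval_start:
  "(\<lambda>y. interval_start R lam_up i j (max 0 y) n) \<in> borel_measurable borel"
  unfolding interval_start_def case_prod_beta
  by (intro borel_measurable_infsum_ennreal measurable_compose[OF _ measurable_ennreal]
      borel_measurable_rates lam_up) auto

lemma jump_interval_sets:
  assumes "(i, j) \<in> state_pairs"
  shows "{(y, v). 0 \<le> y \<and> v \<in> \<Lambda> i j y n} \<in> sets plane"
proof -
  have [measurable]: "(\<lambda>y. interval_start R lam_up i j (max 0 y) n) \<in> borel_measurable borel"
    by (rule borel_measurable_interval_start)
  have [measurable]: "(\<lambda>y. lam i j (max 0 y) n) \<in> borel_measurable borel"
    by (rule borel_measurable_rates[OF lam assms])
  let ?s = "\<lambda>x. interval_start R lam_up i j (max 0 (fst x)) n"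
  let ?S = "{x \<in> space plane. 0 \<le> fst x \<and> ?s x \<noteq> \<infinity> \<and>
    enn2real (?s x) \<le> snd x \<and> snd x < enn2real (?s x) + lam i j (max 0 (fst x)) n}"
  have "?S \<in> sets plane" by measurable
  moreover have "?S = {(y, v). 0 \<le> y \<and> v \<in> \<Lambda> i j y n}"
    by (auto simp: space_pair_measure mem_jump_interval max_def)
  ultimately show ?thesis by (simp only:)
qed

lemma accept_sets:
  assumes "i \<in> states"
  shows "{(y, v). 0 \<le> y \<and> v \<in> accept i y n} \<in> sets plane"
proof -
  have "{(y, v). 0 \<le> y \<and> v \<in> accept i y n} = (\<Union>j\<in>states - {i}. {(y, v). 0 \<le> y \<and> v \<in> \<Lambda> i j y n})"
    by (auto simp: accept_def)
  also have "\<dots> \<in> sets plane"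
    using assms
    by (intro sets.countable_UN') (auto simp: state_pairs_def intro!: jump_interval_sets)
  finally show ?thesis .
qed

text \<open>Only an inequality, because the interval is empty when its start is infinite.\<close>

lemma emeasure_jump_interval_le:
  assumes "(i, j) \<in> state_pairs" "0 \<le> y"
  shows "emeasure lborel (\<Lambda> i j y n) \<le> ennreal (lam i j y n)"
proof (cases "interval_start R lam_up i j y n = \<infinity>")
  case False
  then have "\<Lambda> i j y n = {enn2real (interval_start R lam_up i j y n)..<
      enn2real (interval_start R lam_up i j y n) + lam i j y n}"
    by (auto simp: mem_jump_interval)
  then show ?thesis
    using lam_nonneg[OF assms, of n] by simp
qed (simp add: jump_interval_def)

text \<open>Countable subadditivity bounds the length of the accepted set by the sum of the rates
  out of \<open>i\<close>, which is \<open>total_rate\<close>.\<close>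

lemma emeasure_accept_le:
  assumes "i \<in> states"
  shows "AE y in lborel. 0 \<le> y \<longrightarrow> emeasure lborel (accept i y n) \<le> ennreal c"
  using total_rate_le[OF assms, of n]
proof eventually_elim
  case (elim y)
  show ?case
  proof
    assume y: "0 \<le> y"
    have le: "emeasure lborel (if j \<in> states - {i} then \<Lambda> i j y n else {}) \<le>
        (if j \<in> states - {i} then ennreal (lam i j y n) else 0)" for j
    proof (cases "j \<in> states - {i}")
      case True
      then show ?thesis
        using emeasure_jump_interval_le[OF _ y, of i j n] assms by (auto simp: state_pairs_def)
    next
      case False
      then show ?thesis by (simp only: if_False emeasure_empty)
    qed
    let ?f = "\<lambda>j. if j \<in> states - {i} then \<Lambda> i j y n else {}"
    have eq: "accept i y n = (\<Union>j. ?f j)" by (auto simp: accept_def split: if_splits)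
    have "emeasure lborel (accept i y n) \<le> (\<Sum>j. emeasure lborel (?f j))"
      unfolding eq by (rule emeasure_subadditive_countably) (simp add: image_subset_iff jump_interval_borel)
    also have "\<dots> \<le> (\<Sum>j. if j \<in> states - {i} then ennreal (lam i j y n) else 0)"
      by (rule suminf_le[OF le summableI summableI])
    also have "\<dots> = total_rate lam i y n"
      by (simp add: total_rate_def infsum_ennreal_eq_suminf)
    also have "\<dots> \<le> ennreal c" using elim y by simp
    finally show "emeasure lborel (accept i y n) \<le> ennreal c" .
  qed
qed

end

section \<open>Path by path\<close>

text \<open>Functions that agree just before \<open>u\<close> have the same limits there, so the
  description operator inside \<open>Lim\<close> picks the same value, even if no limit
  exists.\<close>

lemma left_lim_cong:
  assumes "s < u" "\<And>r. s < r \<Longrightarrow> r < u \<Longrightarrow> f r = g r"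
  shows "left_lim f u = left_lim g u"
proof -
  have "eventually (\<lambda>r. f r = g r) (at_left u)"
    using assms eventually_at_left_real[of s u] by (auto elim!: eventually_mono)
  then have "(f \<longlongrightarrow> l) (at_left u) \<longleftrightarrow> (g \<longlongrightarrow> l) (at_left u)" for l
    by (rule tendsto_cong)
  then show ?thesis
    unfolding left_lim_def Topological_Spaces.Lim_def by simp
qed

lemma left_lim_eqI:
  assumes "s < u" "\<And>r. s < r \<Longrightarrow> r < u \<Longrightarrow> f r = g r" "(g \<longlongrightarrow> l) (at_left u)"
  shows "left_lim f u = l"
proof -
  have "left_lim g u = l"
    unfolding left_lim_def by (rule tendsto_Lim[OF trivial_limit_at_left_real assms(3)])
  then show ?thesis
    using left_lim_cong[OF assms(1,2)] by simp
qed

lemma half_plane_sets: "{0..} \<times> UNIV \<in> sets (borel :: (real \<times> real) measure)"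
  by (rule borel_Times) auto

lemma sets_strip_measure_iff:
  "A \<in> sets strip_measure \<longleftrightarrow> A \<subseteq> {0..} \<times> UNIV \<and> A \<in> sets borel"
  unfolding strip_measure_def using half_plane_sets by (subst sets_restrict_space_iff) auto

lemma strip_slab_sets:
  assumes "A \<in> sets borel" "B \<in> sets borel" "A \<subseteq> {0..}"
  shows "A \<times> B \<in> sets strip_measure"
  unfolding sets_strip_measure_iff using assms borel_Times by blast

lemma has_jump_integral_cong:
  assumes "\<And>u v. 0 < u \<Longrightarrow> u \<le> t \<Longrightarrow> f u v = g u v"
  shows "has_jump_integral \<rho> f t I \<longleftrightarrow> has_jump_integral \<rho> g t I"
proof -
  have "indicator ({0<..t} \<times> UNIV) p *\<^sub>R (case p of (u, v) \<Rightarrow> f u v) =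
    indicator ({0<..t} \<times> UNIV) p *\<^sub>R (case p of (u, v) \<Rightarrow> g u v)" for p
    using assms by (auto simp: indicator_def)
  then show ?thesis
    unfolding has_jump_integral_def set_integrable_def set_lebesgue_integral_def by (simp only:)
qed

lemma has_jump_integral_unique:
  "has_jump_integral \<rho> f t I \<Longrightarrow> has_jump_integral \<rho> f t J \<Longrightarrow> I = J"
  by (simp add: has_jump_integral_def)

lemma has_jump_integral_diff:
  assumes \<rho>: "sets \<rho> = sets strip_measure" and s: "0 \<le> s" "s \<le> t"
    and I: "has_jump_integral \<rho> f s I" and J: "has_jump_integral \<rho> f t J"
  shows "set_integrable \<rho> ({s<..t} \<times> UNIV) (\<lambda>(u, v). f u v)"
    and "set_lebesgue_integral \<rho> ({s<..t} \<times> UNIV) (\<lambda>(u, v). f u v) = J - I"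
proof -
  have "{s<..t} \<times> UNIV \<in> sets \<rho>"
    unfolding \<rho> using s by (intro strip_slab_sets) auto
  then show int: "set_integrable \<rho> ({s<..t} \<times> UNIV) (\<lambda>(u, v). f u v)"
    using J s by (auto simp: has_jump_integral_def intro: set_integrable_subset)
  have eq: "{0<..t} \<times> (UNIV :: real set) = {0<..s} \<times> UNIV \<union> {s<..t} \<times> UNIV"
    using s by auto
  have "set_lebesgue_integral \<rho> ({0<..t} \<times> UNIV) (\<lambda>(u, v). f u v) =
      set_lebesgue_integral \<rho> ({0<..s} \<times> UNIV) (\<lambda>(u, v). f u v) +
      set_lebesgue_integral \<rho> ({s<..t} \<times> UNIV) (\<lambda>(u, v). f u v)"
    unfolding eq using I int by (intro set_integral_Un) (auto simp: has_jump_integral_def)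
  then have "J = I + set_lebesgue_integral \<rho> ({s<..t} \<times> UNIV) (\<lambda>(u, v). f u v)"
    using I J by (simp add: has_jump_integral_def)
  then show "set_lebesgue_integral \<rho> ({s<..t} \<times> UNIV) (\<lambda>(u, v). f u v) = J - I"
    by simp
qed

text \<open>Up to a null set the integrand on \<open>(s, t]\<close> lives on the line over
  \<open>t\<close>, where it is the constant \<open>a\<close>. Finiteness of the mass of that line
  is requested only for \<open>a \<noteq> 0\<close>: when nothing jumps, no bound on this mass is
  supplied.\<close>

lemma has_jump_integral_step:
  assumes \<rho>: "sets \<rho> = sets strip_measure" and s: "0 \<le> s" "s < t"
    and I: "has_jump_integral \<rho> f s I"
    and f: "(\<lambda>p. indicator ({s<..t} \<times> UNIV) p * f (fst p) (snd p)) \<in> borel_measurable \<rho>"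
    and AE: "AE p in \<rho>. indicator ({s<..t} \<times> UNIV) p * f (fst p) (snd p) = a * indicator ({t} \<times> UNIV) p"
    and fin: "a \<noteq> 0 \<Longrightarrow> emeasure \<rho> ({t} \<times> UNIV) < \<infinity>"
  shows "has_jump_integral \<rho> f t (I + a * measure \<rho> ({t} \<times> UNIV))"
proof -
  have t: "{t} \<times> UNIV \<in> sets \<rho>"
    unfolding \<rho> using s by (intro strip_slab_sets) auto
  have int: "integrable \<rho> (\<lambda>p. a * indicator ({t} \<times> UNIV) p)"
    using t fin by (cases "a = 0") auto
  have int': "integrable \<rho> (\<lambda>p. indicator ({s<..t} \<times> UNIV) p * f (fst p) (snd p))"
    by (subst integrable_cong_AE[OF f _ AE]) (use int t in auto)
  have "(LINT p|\<rho>. indicator ({s<..t} \<times> UNIV) p * f (fst p) (snd p)) =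
      (LINT p|\<rho>. a * indicator ({t} \<times> UNIV) p)"
    by (rule integral_cong_AE[OF f _ AE]) (use t in auto)
  also have "\<dots> = a * measure \<rho> ({t} \<times> UNIV)"
    using t sets.sets_into_space[OF t] by (simp add: Int_absorb2)
  finally have LINT: "set_lebesgue_integral \<rho> ({s<..t} \<times> UNIV) (\<lambda>(u, v). f u v) =
      a * measure \<rho> ({t} \<times> UNIV)"
    by (simp add: set_lebesgue_integral_def case_prod_beta)
  have set_int: "set_integrable \<rho> ({s<..t} \<times> UNIV) (\<lambda>(u, v). f u v)"
    using int' by (simp add: set_integrable_def case_prod_beta)
  have eq: "{0<..t} \<times> (UNIV :: real set) = {0<..s} \<times> UNIV \<union> {s<..t} \<times> UNIV"
    using s by auto
  have meas: "{0<..s} \<times> UNIV \<in> sets \<rho>" "{s<..t} \<times> UNIV \<in> sets \<rho>"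
    unfolding \<rho> using s by (auto intro!: strip_slab_sets)
  have disj: "{0<..s} \<times> UNIV \<inter> {s<..t} \<times> (UNIV :: real set) = {}"
    by auto
  show ?thesis
    using I set_int LINT meas unfolding has_jump_integral_def eq
    by (auto simp: set_integral_Un[OF disj] intro!: set_integrable_Un)
qed

section \<open>Pathwise uniqueness, and propagation of the equations across one interval\<close>

context jump_rates
begin

abbreviation solves_at ::
    "(real \<times> real) measure \<Rightarrow> nat \<Rightarrow> real \<Rightarrow> (real \<Rightarrow> nat) \<Rightarrow> (real \<Rightarrow> real) \<Rightarrow> (real \<Rightarrow> nat) \<Rightarrow> real \<Rightarrow> bool" where
  "solves_at \<rho> x0 y0 x y n t \<equiv>
    has_jump_integral \<rho>
      (\<lambda>u v. h\<Lambda> (left_lim x u) (left_lim y u) (left_lim n u) v)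
      t (real (x t) - real x0) \<and>
    has_jump_integral \<rho>
      (\<lambda>u v. left_lim y u * g\<Lambda> (left_lim x u) (left_lim y u) (left_lim n u) v)
      t (y0 + t - y t) \<and>
    has_jump_integral \<rho>
      (\<lambda>u v. g\<Lambda> (left_lim x u) (left_lim y u) (left_lim n u) v)
      t (real (n t))"

text \<open>The increment of \<open>n\<close> is the integral of the nonnegative function
  \<open>g\<Lambda>\<close>. If it is zero, \<open>g\<Lambda>\<close> vanishes almost everywhere on
  \<open>(s, t]\<close>, hence so does its product with the left limit of \<open>y\<close>, and the
  age grows with unit speed.\<close>

lemma solves_system_no_jump:
  assumes \<rho>: "sets \<rho> = sets strip_measure" and sol: "solves_system R lam lam_up \<rho> x0 y0 x y n"
    and s: "0 \<le> s" "s \<le> t" and n: "n t = n s"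
  shows "y t = y s + (t - s)"
proof -
  let ?g = "\<lambda>(u, v). g\<Lambda> (left_lim x u) (left_lim y u) (left_lim n u) v"
  let ?yg = "\<lambda>(u, v). left_lim y u * g\<Lambda> (left_lim x u) (left_lim y u) (left_lim n u) v"
  let ?S = "{s<..t} \<times> (UNIV :: real set)"
  have sol': "solves_at \<rho> x0 y0 x y n s" "solves_at \<rho> x0 y0 x y n t"
    using sol s unfolding solves_system_def by auto
  have g: "set_integrable \<rho> ?S ?g" "set_lebesgue_integral \<rho> ?S ?g = 0"
    using has_jump_integral_diff[OF \<rho> s conjunct2[OF conjunct2[OF sol'(1)]] conjunct2[OF conjunct2[OF sol'(2)]]] n
    by auto
  have yg: "set_integrable \<rho> ?S ?yg"
    "set_lebesgue_integral \<rho> ?S ?yg = (y0 + t - y t) - (y0 + s - y s)"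
    using has_jump_integral_diff[OF \<rho> s conjunct1[OF conjunct2[OF sol'(1)]] conjunct1[OF conjunct2[OF sol'(2)]]]
    by auto
  have "AE p in \<rho>. indicator ?S p *\<^sub>R ?g p = 0"
    using g unfolding set_integrable_def set_lebesgue_integral_def
    by (subst (asm) integral_nonneg_eq_0_iff_AE) (auto intro!: AE_I2 mult_nonneg_nonneg g_coeff_nonneg)
  then have "AE p in \<rho>. indicator ?S p *\<^sub>R ?yg p = 0"
    by eventually_elim (auto simp: indicator_def)
  then have "set_lebesgue_integral \<rho> ?S ?yg = 0"
    unfolding set_lebesgue_integral_def by (rule integral_eq_zero_AE)
  with yg show ?thesis by simp
qed

text \<open>In a discrete space the neighbourhood filter is principal, so right continuity means
  being constant for a short while.\<close>

lemma eventually_at_right_eq: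
  fixes f :: "real \<Rightarrow> 'a::discrete_topology"
  assumes "(f \<longlongrightarrow> f t) (at_right t)"
  shows "eventually (\<lambda>s. f s = f t) (at_right t)"
  using assms by (simp add: nhds_discrete filterlim_principal)

lemma solves_system_unique:
  assumes \<rho>: "sets \<rho> = sets strip_measure"
    and sol: "solves_system R lam lam_up \<rho> x0 y0 x y n" and rc: "cadlag x" "cadlag n"
    and sol': "solves_system R lam lam_up \<rho> x0 y0 x' y' n'" and rc': "cadlag x'" "cadlag n'"
    and t: "0 \<le> t"
  shows "x' t = x t \<and> y' t = y t \<and> n' t = n t"
proof (rule ccontr)
  define agree where "agree t \<longleftrightarrow> x' t = x t \<and> y' t = y t \<and> n' t = n t" for t
  define D where "D = {t. 0 \<le> t \<and> \<not> agree t}"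
  define \<sigma> where "\<sigma> = Inf D"
  assume "\<not> (x' t = x t \<and> y' t = y t \<and> n' t = n t)"
  with t have D: "D \<noteq> {}" by (auto simp: D_def agree_def)
  have bdd: "bdd_below D" by (auto simp: D_def bdd_below_def)
  have \<sigma>: "0 \<le> \<sigma>" unfolding \<sigma>_def by (rule cInf_greatest[OF D]) (simp add: D_def)
  have before: "agree r" if "0 \<le> r" "r < \<sigma>" for r
    using that cInf_lower[OF _ bdd, of r] by (auto simp: \<sigma>_def D_def)
  have lims: "left_lim x' u = left_lim x u" "left_lim y' u = left_lim y u" "left_lim n' u = left_lim n u"
    if "0 < u" "u \<le> \<sigma>" for u
    using before that by (auto intro!: left_lim_cong[of 0] simp: agree_def)
  have "solves_at \<rho> x0 y0 x y n \<sigma>" "solves_at \<rho> x0 y0 x' y' n' \<sigma>"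
    using sol sol' \<sigma> unfolding solves_system_def by auto
  moreover have
    "has_jump_integral \<rho> (\<lambda>u v. h\<Lambda> (left_lim x' u) (left_lim y' u) (left_lim n' u) v) \<sigma> I \<longleftrightarrow>
     has_jump_integral \<rho> (\<lambda>u v. h\<Lambda> (left_lim x u) (left_lim y u) (left_lim n u) v) \<sigma> I"
    "has_jump_integral \<rho> (\<lambda>u v. left_lim y' u * g\<Lambda> (left_lim x' u) (left_lim y' u) (left_lim n' u) v) \<sigma> I \<longleftrightarrow>
     has_jump_integral \<rho> (\<lambda>u v. left_lim y u * g\<Lambda> (left_lim x u) (left_lim y u) (left_lim n u) v) \<sigma> I"
    "has_jump_integral \<rho> (\<lambda>u v. g\<Lambda> (left_lim x' u) (left_lim y' u) (left_lim n' u) v) \<sigma> I \<longleftrightarrow>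
     has_jump_integral \<rho> (\<lambda>u v. g\<Lambda> (left_lim x u) (left_lim y u) (left_lim n u) v) \<sigma> I" for I
    by (auto intro!: has_jump_integral_cong simp: lims)
  ultimately have "real (x' \<sigma>) - real x0 = real (x \<sigma>) - real x0 \<and>
      y0 + \<sigma> - y' \<sigma> = y0 + \<sigma> - y \<sigma> \<and> real (n' \<sigma>) = real (n \<sigma>)"
    by (metis (no_types, lifting) has_jump_integral_unique)
  then have at: "agree \<sigma>"
    by (simp add: agree_def)
  \<comment> \<open>State and counter are integer valued and hence constant just after
    \<open>\<sigma>\<close>. The age needs no such argument: with a constant counter
    \<open>solves_system_no_jump\<close> determines it.\<close>
  have "eventually (\<lambda>s. x s = x \<sigma> \<and> n s = n \<sigma> \<and> x' s = x' \<sigma> \<and> n' s = n' \<sigma>) (at_right \<sigma>)"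
    using rc rc' \<sigma> by (intro eventually_conj eventually_at_right_eq) (auto simp: cadlag_def)
  then obtain b where b: "\<sigma> < b"
    "\<And>s. \<sigma> < s \<Longrightarrow> s < b \<Longrightarrow> x s = x \<sigma> \<and> n s = n \<sigma> \<and> x' s = x' \<sigma> \<and> n' s = n' \<sigma>"
    unfolding eventually_at_right_field by auto
  have after: "agree s" if "\<sigma> < s" "s < b" for s
    using b(2)[OF that] at solves_system_no_jump[OF \<rho> sol \<sigma>, of s]
      solves_system_no_jump[OF \<rho> sol' \<sigma>, of s] that
    by (auto simp: agree_def)
  have "b \<le> r" if "r \<in> D" for r
    using before[of r] at after[of r] that by (fastforce simp: D_def not_le)
  then have "b \<le> \<sigma>"
    unfolding \<sigma>_def by (intro cInf_greatest D)
  with b(1) show False by simp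
qed

text \<open>The infinite signed sum is replaced by a \<open>LEAST\<close> over countably many
  measurable predicates, which makes \<open>h\<Lambda>\<close> measurable in age and mark.\<close>

lemma h_coeff_eq_Least:
  assumes "i \<in> states" "0 \<le> y"
  shows "h\<Lambda> i y n v = (if v \<in> accept i y n
    then real (LEAST j. j \<in> states - {i} \<and> v \<in> \<Lambda> i j y n) - real i else 0)"
proof (cases "v \<in> accept i y n")
  case True
  then obtain j where "j \<in> states - {i} \<and> v \<in> \<Lambda> i j y n" by (auto simp: accept_def)
  from LeastI[of "\<lambda>j. j \<in> states - {i} \<and> v \<in> \<Lambda> i j y n", OF this]
  show ?thesis using True assms h_coeff_eq by simp
qed (simp add: h_coeff_eq_0)

lemma borel_measurable_coeffs:
  assumes i: "i \<in> states"
  shows "(\<lambda>p. h\<Lambda> i (max 0 (fst p)) n (snd p)) \<in> borel_measurable plane"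
    and "(\<lambda>p. g\<Lambda> i (max 0 (fst p)) n (snd p)) \<in> borel_measurable plane"
proof -
  have m: "(\<lambda>p. (max 0 (fst p), snd p)) \<in> plane \<rightarrow>\<^sub>M plane"
    by measurable
  have [measurable]: "Measurable.pred plane (\<lambda>p. snd p \<in> accept i (max 0 (fst p)) n)"
    using measurable_sets[OF m accept_sets[OF i, of n]]
    by (auto simp: pred_def vimage_def Int_def space_pair_measure)
  have [measurable]: "Measurable.pred plane
      (\<lambda>p. j \<in> states - {i} \<and> snd p \<in> \<Lambda> i j (max 0 (fst p)) n)" for j
  proof (cases "j \<in> states - {i}")
    case True
    then show ?thesis
      using measurable_sets[OF m jump_interval_sets[of i j n]] i
      by (auto simp: pred_def vimage_def Int_def space_pair_measure state_pairs_def)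
  next
    case False
    then have "(\<lambda>p. j \<in> states - {i} \<and> snd p \<in> \<Lambda> i j (max 0 (fst p)) n) = (\<lambda>p. False)"
      by auto
    then show ?thesis by simp
  qed
  show "(\<lambda>p. h\<Lambda> i (max 0 (fst p)) n (snd p)) \<in> borel_measurable plane"
    using i by (simp add: h_coeff_eq_Least) measurable
  show "(\<lambda>p. g\<Lambda> i (max 0 (fst p)) n (snd p)) \<in> borel_measurable plane"
    using i by (simp add: g_coeff_eq) measurable
qed

text \<open>On \<open>(s, t]\<close> the left limits are explicit (state \<open>i\<close>, age
  \<open>u - a\<close>, counter \<open>k\<close>), so the integrands are fixed functions of time and
  mark that vanish almost everywhere before \<open>t\<close>. The two cases of \<open>jump\<close>
  are: no accepted mass at time \<open>t\<close>, or unit mass at time \<open>t\<close> with its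
  mark in the interval of \<open>j\<close>. The number \<open>a\<close> is the time of the last
  jump, or minus the initial age.\<close>

lemma solves_at_step:
  assumes \<rho>: "sets \<rho> = sets strip_measure" and s: "0 \<le> s" "s < t"
    and sol: "solves_at \<rho> x0 y0 x y n s" and i: "i \<in> states" and a: "a \<le> s"
    and path: "\<And>u. s \<le> u \<Longrightarrow> u < t \<Longrightarrow> x u = i \<and> y u = u - a \<and> n u = k"
    and null: "AE p in \<rho>. s < fst p \<and> fst p < t \<longrightarrow> snd p \<notin> accept i (fst p - a) k"
    and jump: "x t = i \<and> y t = t - a \<and> n t = k \<and>
        (AE p in \<rho>. fst p = t \<longrightarrow> snd p \<notin> accept i (fst p - a) k) \<or>
      j \<in> states - {i} \<and> x t = j \<and> y t = 0 \<and> n t = Suc k \<and> emeasure \<rho> ({t} \<times> UNIV) = 1 \<and>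
        (AE p in \<rho>. fst p = t \<longrightarrow> snd p \<in> \<Lambda> i j (t - a) k)"
  shows "solves_at \<rho> x0 y0 x y n t"
proof -
  have lims: "left_lim x u = i" "left_lim y u = u - a" "left_lim n u = k" if "s < u" "u \<le> t" for u
    using that path
    by (auto intro!: left_lim_eqI[of s u x "\<lambda>_. i"] left_lim_eqI[of s u y "\<lambda>u. u - a"]
        left_lim_eqI[of s u n "\<lambda>_. k"] tendsto_intros)
  have at_s: "x s = i" "y s = s - a" "n s = k" using path[of s] s by auto
  have strip: "f \<in> borel_measurable \<rho>" if "f \<in> borel_measurable plane"
    for f :: "real \<times> real \<Rightarrow> real"
    using that unfolding measurable_cong_sets[OF \<rho> refl] strip_measure_def
    by (intro measurable_restrict_space1) (simp add: borel_prod)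
  have "(\<lambda>p. (fst p - a, snd p)) \<in> plane \<rightarrow>\<^sub>M plane"
    by measurable
  from borel_measurable_coeffs[OF i, THEN measurable_compose[OF this], of k]
  have [measurable]:
    "(\<lambda>p. h\<Lambda> i (max 0 (fst p - a)) k (snd p)) \<in> borel_measurable plane"
    "(\<lambda>p. g\<Lambda> i (max 0 (fst p - a)) k (snd p)) \<in> borel_measurable plane"
    by simp_all
  \<comment> \<open>Common to the three equations: \<open>g\<close> is the integrand written as a
    measurable function on the plane, and \<open>d\<close> is its value on the line over
    \<open>t\<close>.\<close>
  have step: "has_jump_integral \<rho> f t (I + d * measure \<rho> ({t} \<times> UNIV))"
    if I: "has_jump_integral \<rho> f s I"
      and f: "\<And>u v. s < u \<Longrightarrow> u \<le> t \<Longrightarrow> f u v = g (u, v)"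
      and g: "g \<in> borel_measurable plane"
      and g0: "\<And>u v. s < u \<Longrightarrow> u \<le> t \<Longrightarrow> v \<notin> accept i (u - a) k \<Longrightarrow> g (u, v) = 0"
      and d: "d = 0 \<and> (AE p in \<rho>. fst p = t \<longrightarrow> snd p \<notin> accept i (fst p - a) k) \<or>
        emeasure \<rho> ({t} \<times> UNIV) = 1 \<and> (AE p in \<rho>. fst p = t \<longrightarrow> g p = d)"
    for f g I d
  proof (rule has_jump_integral_step[OF \<rho> s I])
    have eq: "indicator ({s<..t} \<times> UNIV) p * f (fst p) (snd p) = indicator ({s<..t} \<times> UNIV) p * g p" for p
      using f[of "fst p" "snd p"] by (auto simp: indicator_def)
    have "(\<lambda>p. indicator ({s<..t} \<times> UNIV) p * g p) \<in> borel_measurable plane"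
      using g by (intro borel_measurable_times borel_measurable_indicator) auto
    then show "(\<lambda>p. indicator ({s<..t} \<times> UNIV) p * f (fst p) (snd p)) \<in> borel_measurable \<rho>"
      unfolding eq by (rule strip)
    have "AE p in \<rho>. fst p = t \<longrightarrow> g p = d"
      using d
    proof
      assume d: "d = 0 \<and> (AE p in \<rho>. fst p = t \<longrightarrow> snd p \<notin> accept i (fst p - a) k)"
      then have "AE p in \<rho>. fst p = t \<longrightarrow> snd p \<notin> accept i (fst p - a) k" ..
      then show ?thesis
        by eventually_elim (use g0 s d in force)
    qed simp
    with null show "AE p in \<rho>. indicator ({s<..t} \<times> UNIV) p * f (fst p) (snd p) = d * indicator ({t} \<times> UNIV) p"
    proof eventually_elim
      case (elim p)
      then show ?case
        using g0[of "fst p" "snd p"] s unfolding eq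
        by (cases p) (auto simp: indicator_def)
    qed
    show "d \<noteq> 0 \<Longrightarrow> emeasure \<rho> ({t} \<times> UNIV) < \<infinity>"
      using d by auto
  qed
  have g0: "g\<Lambda> i (u - a) k v = 0" if "s < u" "v \<notin> accept i (u - a) k" for u v
    using that a i s by (simp add: g_coeff_eq)
  have h0: "h\<Lambda> i (u - a) k v = 0" if "s < u" "v \<notin> accept i (u - a) k" for u v
    using that by (simp add: h_coeff_eq_0)
  note int = sol[THEN conjunct1] sol[THEN conjunct2, THEN conjunct1] sol[THEN conjunct2, THEN conjunct2]
  from jump show ?thesis
  proof (elim disjE conjE)
    assume at_t: "x t = i" "y t = t - a" "n t = k"
      and *: "AE p in \<rho>. fst p = t \<longrightarrow> snd p \<notin> accept i (fst p - a) k"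
    show ?thesis
      using step[OF int(1), of "\<lambda>p. h\<Lambda> i (max 0 (fst p - a)) k (snd p)" 0]
        step[OF int(2), of "\<lambda>p. (fst p - a) * g\<Lambda> i (max 0 (fst p - a)) k (snd p)" 0]
        step[OF int(3), of "\<lambda>p. g\<Lambda> i (max 0 (fst p - a)) k (snd p)" 0]
      using * a s by (simp add: lims g0 h0 at_s at_t)
  next
    assume j: "j \<in> states - {i}" and at_t: "x t = j" "y t = 0" "n t = Suc k"
      and one: "emeasure \<rho> ({t} \<times> UNIV) = 1"
      and AE: "AE p in \<rho>. fst p = t \<longrightarrow> snd p \<in> \<Lambda> i j (t - a) k"
    have *: "measure \<rho> ({t} \<times> UNIV) = 1"
      using one by (simp add: measure_def)
    have ta: "0 \<le> t - a" using a s by simp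
    have h: "AE p in \<rho>. fst p = t \<longrightarrow> h\<Lambda> i (max 0 (fst p - a)) k (snd p) = real j - real i"
      using AE by eventually_elim (use h_coeff_eq[OF i j ta] ta in auto)
    have g: "AE p in \<rho>. fst p = t \<longrightarrow> g\<Lambda> i (max 0 (fst p - a)) k (snd p) = 1"
      using AE
    proof eventually_elim
      case (elim p)
      then have "snd p \<in> accept i (t - a) k" if "fst p = t"
        using that j by (auto simp: accept_def)
      then show ?case using ta i by (auto simp: g_coeff_eq)
    qed
    \<comment> \<open>The age just before the jump is \<open>t - a\<close>; this is the amount that
      the second equation removes, resetting the age to 0.\<close>
    then have yg: "AE p in \<rho>. fst p = t \<longrightarrow>
        (fst p - a) * g\<Lambda> i (max 0 (fst p - a)) k (snd p) = t - a"
      by eventually_elim auto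
    show ?thesis
      using step[OF int(1), of "\<lambda>p. h\<Lambda> i (max 0 (fst p - a)) k (snd p)" "real j - real i"]
        step[OF int(2), of "\<lambda>p. (fst p - a) * g\<Lambda> i (max 0 (fst p - a)) k (snd p)" "t - a"]
        step[OF int(3), of "\<lambda>p. g\<Lambda> i (max 0 (fst p - a)) k (snd p)" 1]
      using h g yg one * a s by (simp add: lims g0 h0 at_s at_t add.commute[of 1])
  qed
qed

end

text \<open>Nonzero masses are at least 1, a lower bound that survives passage to the limit along
  shrinking sets.\<close>

lemma ennreal_of_enat_range_ge_1:
  assumes "x \<in> range ennreal_of_enat" "x \<noteq> 0"
  shows "1 \<le> x"
proof -
  from assms obtain e where e: "x = ennreal_of_enat e" by auto
  with assms have "e \<noteq> 0" by auto
  then have "ennreal_of_enat 1 \<le> ennreal_of_enat e"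
    by (subst ennreal_of_enat_le_iff) (simp add: one_eSuc ileI1 zero_less_iff_neq_zero)
  with e show ?thesis by simp
qed

lemma ereal_less_sets: "{u. ereal u < e} \<in> sets borel"
proof -
  have "{u \<in> space borel. ereal u < e} \<in> sets borel" by measurable
  then show ?thesis by simp
qed

section \<open>The chain of jump times and states of one realisation\<close>

context jump_rates
begin

text \<open>After the \<open>k\<close>-th jump, at time \<open>T\<close> and into state \<open>i\<close>, the next jump happens at the first point of
  \<open>\<rho>\<close> in \<open>candidates T i k\<close>. Taking \<open>- y0\<close> for the time of the zeroth jump makes \<open>u - T\<close> the age
  before the first jump as well.\<close>

definition candidates :: "ereal \<Rightarrow> nat \<Rightarrow> nat \<Rightarrow> (real \<times> real) set" where
  "candidates T i k = {(u, v). 0 < u \<and> T < ereal u \<and> v \<in> accept i (u - real_of_ereal T) k}"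

abbreviation candidates_upto :: "ereal \<Rightarrow> nat \<Rightarrow> nat \<Rightarrow> real \<Rightarrow> (real \<times> real) set" where
  "candidates_upto T i k t \<equiv> candidates T i k \<inter> {0<..t} \<times> UNIV"

text \<open>Expressed through masses, since the realisation is a measure. If there is never a
  candidate, the infimum over the empty set is \<open>\<infinity>\<close>.\<close>

definition next_time :: "(real \<times> real) measure \<Rightarrow> ereal \<Rightarrow> nat \<Rightarrow> nat \<Rightarrow> ereal" where
  "next_time \<rho> T i k = Inf {ereal t | t. emeasure \<rho> (candidates_upto T i k t) \<noteq> 0}"

definition hits :: "(real \<times> real) measure \<Rightarrow> ereal \<Rightarrow> nat \<Rightarrow> nat \<Rightarrow> ereal \<Rightarrow> nat \<Rightarrow> bool" where
  "hits \<rho> T i k T' j \<longleftrightarrow> j \<in> states - {i} \<and> T < T' \<and> 0 < T' \<and>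
     emeasure \<rho> ({real_of_ereal T'} \<times> \<Lambda> i j (real_of_ereal T' - real_of_ereal T) k) \<noteq> 0"

text \<open>\<open>LEAST\<close> keeps the choice of the state measurable. The default 1 is an
  element of \<open>states\<close>, so the chain stays inside the state space even where no interval
  is hit.\<close>

definition next_state :: "(real \<times> real) measure \<Rightarrow> ereal \<Rightarrow> nat \<Rightarrow> nat \<Rightarrow> ereal \<Rightarrow> nat" where
  "next_state \<rho> T i k T' = (if \<exists>j. hits \<rho> T i k T' j then LEAST j. hits \<rho> T i k T' j else 1)"

primrec jump_chain :: "(real \<times> real) measure \<Rightarrow> nat \<Rightarrow> real \<Rightarrow> nat \<Rightarrow> ereal \<times> nat" where
  "jump_chain \<rho> x0 y0 0 = (ereal (- y0), x0)"
| "jump_chain \<rho> x0 y0 (Suc k) =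
     (let (T, i) = jump_chain \<rho> x0 y0 k; T' = next_time \<rho> T i k in (T', next_state \<rho> T i k T'))"

definition jump_time where "jump_time \<rho> x0 y0 k = fst (jump_chain \<rho> x0 y0 k)"
definition jump_state where "jump_state \<rho> x0 y0 k = snd (jump_chain \<rho> x0 y0 k)"

lemma jump_time_0: "jump_time \<rho> x0 y0 0 = ereal (- y0)"
  and jump_state_0: "jump_state \<rho> x0 y0 0 = x0"
  and jump_time_Suc: "jump_time \<rho> x0 y0 (Suc k) =
    next_time \<rho> (jump_time \<rho> x0 y0 k) (jump_state \<rho> x0 y0 k) k"
  and jump_state_Suc: "jump_state \<rho> x0 y0 (Suc k) =
    next_state \<rho> (jump_time \<rho> x0 y0 k) (jump_state \<rho> x0 y0 k) k (jump_time \<rho> x0 y0 (Suc k))"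
  by (simp_all add: jump_time_def jump_state_def Let_def case_prod_beta)

text \<open>The default 0 is used when all jump times are at most \<open>t\<close>, that is, when
  infinitely many jumps have happened by then.\<close>

definition jump_count :: "(real \<times> real) measure \<Rightarrow> nat \<Rightarrow> real \<Rightarrow> real \<Rightarrow> nat" where
  "jump_count \<rho> x0 y0 t = (if \<exists>k. ereal t < jump_time \<rho> x0 y0 (Suc k)
    then LEAST k. ereal t < jump_time \<rho> x0 y0 (Suc k) else 0)"

definition state_at :: "(real \<times> real) measure \<Rightarrow> nat \<Rightarrow> real \<Rightarrow> real \<Rightarrow> nat" where
  "state_at \<rho> x0 y0 t = jump_state \<rho> x0 y0 (jump_count \<rho> x0 y0 t)"

text \<open>The truncation by \<open>max 0\<close> makes the age nonnegative for every realisation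
  and every real time.\<close>

definition age_at :: "(real \<times> real) measure \<Rightarrow> nat \<Rightarrow> real \<Rightarrow> real \<Rightarrow> real" where
  "age_at \<rho> x0 y0 t = max 0 (t - real_of_ereal (jump_time \<rho> x0 y0 (jump_count \<rho> x0 y0 t)))"

lemma hits_next_state: "hits \<rho> T i k T' j \<Longrightarrow> hits \<rho> T i k T' (next_state \<rho> T i k T')"
  unfolding next_state_def by (auto intro: LeastI)

lemma next_state_in_states: "next_state \<rho> T i k T' \<in> states"
proof (cases "\<exists>j. hits \<rho> T i k T' j")
  case True
  then show ?thesis using hits_next_state[of \<rho> T i k T'] by (auto simp: hits_def)
qed (simp add: next_state_def states_def)

lemma jump_state_in_states: "x0 \<in> states \<Longrightarrow> jump_state \<rho> x0 y0 k \<in> states"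
  by (cases k) (simp_all add: jump_state_0 jump_state_Suc next_state_in_states)

lemma candidates_sets:
  assumes i: "i \<in> states" and T: "T \<noteq> - \<infinity>"
  shows "candidates T i k \<in> sets plane"
proof (cases T)
  case (real a)
  have m: "(\<lambda>p. (fst p - a, snd p)) \<in> plane \<rightarrow>\<^sub>M plane"
    by measurable
  have "{p \<in> space plane. 0 < fst p \<and> a < fst p} \<in> sets plane"
    by measurable
  with measurable_sets[OF m accept_sets[OF i, of k]]
  have "((\<lambda>p. (fst p - a, snd p)) -` {(y, v). 0 \<le> y \<and> v \<in> accept i y k} \<inter> space plane) \<inter>
    {p \<in> space plane. 0 < fst p \<and> a < fst p} \<in> sets plane"
    by (rule sets.Int)
  also have "((\<lambda>p. (fst p - a, snd p)) -` {(y, v). 0 \<le> y \<and> v \<in> accept i y k} \<inter> space plane) \<inter>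
    {p \<in> space plane. 0 < fst p \<and> a < fst p} = candidates T i k"
    using real by (auto simp: candidates_def space_pair_measure)
  finally show ?thesis .
qed (use T in \<open>auto simp: candidates_def\<close>)

lemma candidates_slab_sets:
  assumes "i \<in> states" "T \<noteq> - \<infinity>" "A \<in> sets borel" "sets \<rho> = sets strip_measure"
  shows "candidates T i k \<inter> A \<times> UNIV \<in> sets \<rho>"
proof -
  have "A \<times> (UNIV :: real set) \<in> sets borel"
    using assms(3) by (intro borel_Times) auto
  moreover have "candidates T i k \<in> sets borel"
    using candidates_sets[OF assms(1,2), of k] unfolding borel_prod .
  ultimately have "candidates T i k \<inter> A \<times> UNIV \<in> sets borel"
    by (intro sets.Int)
  then show ?thesis
    unfolding assms(4) sets_strip_measure_iff by (auto simp: candidates_def)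
qed

text \<open>The candidate mass grows with the window, so a time \<open>t < r\<close> with nonzero
  mass can be enlarged to a rational one. The countable union over rationals later turns this
  equivalence into measurability.\<close>

lemma next_time_less_iff:
  assumes i: "i \<in> states" and T: "T \<noteq> - \<infinity>" and \<rho>: "sets \<rho> = sets strip_measure"
  shows "next_time \<rho> T i k < ereal r \<longleftrightarrow>
    (\<exists>q\<in>\<rat>. 0 < q \<and> q < r \<and> emeasure \<rho> (candidates_upto T i k q) \<noteq> 0)"
proof
  assume "next_time \<rho> T i k < ereal r"
  then obtain t where t: "t < r" "emeasure \<rho> (candidates_upto T i k t) \<noteq> 0"
    by (auto simp: next_time_def Inf_less_iff)
  then have "0 < t" by (cases "0 < t") auto
  obtain q where q: "q \<in> \<rat>" "t < q" "q < r" using Rats_dense_in_real[OF t(1)] by auto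
  have "emeasure \<rho> (candidates_upto T i k t) \<le> emeasure \<rho> (candidates_upto T i k q)"
    using q by (intro emeasure_mono candidates_slab_sets i T \<rho>) auto
  with t q \<open>0 < t\<close> show "\<exists>q\<in>\<rat>. 0 < q \<and> q < r \<and> emeasure \<rho> (candidates_upto T i k q) \<noteq> 0"
    by (intro bexI[of _ q]) auto
next
  assume "\<exists>q\<in>\<rat>. 0 < q \<and> q < r \<and> emeasure \<rho> (candidates_upto T i k q) \<noteq> 0"
  then show "next_time \<rho> T i k < ereal r"
    by (auto simp: next_time_def Inf_less_iff)
qed

text \<open>The region before the infimum is a countable union of windows ending at rational times,
  and each of them is null by the definition of the infimum.\<close>

lemma emeasure_candidates_before:
  assumes i: "i \<in> states" and T: "T \<noteq> - \<infinity>" and \<rho>: "sets \<rho> = sets strip_measure"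
  shows "emeasure \<rho> (candidates T i k \<inter> {u. ereal u < next_time \<rho> T i k} \<times> UNIV) = 0"
proof -
  let ?Q = "{q \<in> \<rat>. ereal q < next_time \<rho> T i k}"
  have "(\<Union>q\<in>?Q. candidates_upto T i k q) \<in> null_sets \<rho>"
  proof (rule null_sets_UN')
    show "countable ?Q" using countable_rat by (rule countable_subset[rotated]) auto
    fix q assume "q \<in> ?Q"
    moreover have "next_time \<rho> T i k \<le> ereal q" if "emeasure \<rho> (candidates_upto T i k q) \<noteq> 0"
      using that by (auto simp: next_time_def intro!: Inf_lower)
    ultimately have "emeasure \<rho> (candidates_upto T i k q) = 0"
      by fastforce
    then show "candidates_upto T i k q \<in> null_sets \<rho>"
      using candidates_slab_sets[OF i T _ \<rho>] by (intro null_setsI) auto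
  qed
  moreover have "candidates T i k \<inter> {u. ereal u < next_time \<rho> T i k} \<times> UNIV =
    (\<Union>q\<in>?Q. candidates_upto T i k q)"
  proof -
    have "\<exists>q\<in>?Q. u \<le> q" if "ereal u < next_time \<rho> T i k" for u
    proof -
      obtain r where "ereal u < ereal r" "ereal r < next_time \<rho> T i k"
        using ereal_dense2[of "ereal u" "next_time \<rho> T i k"] \<open>ereal u < next_time \<rho> T i k\<close> by blast
      moreover then obtain q where "q \<in> \<rat>" "u < q" "q < r" using Rats_dense_in_real[of u r] by auto
      ultimately show ?thesis
        using less_trans[of "ereal q" "ereal r" "next_time \<rho> T i k"] by (intro bexI[of _ q]) auto
    qed
    moreover have "ereal u < next_time \<rho> T i k" if "q \<in> ?Q" "u \<le> q" for u q
      using that le_less_trans[of "ereal u" "ereal q" "next_time \<rho> T i k"] by simp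
    ultimately have "{u. ereal u < next_time \<rho> T i k} = (\<Union>q\<in>?Q. {..q})"
      by blast
    moreover have "candidates_upto T i k q = candidates T i k \<inter> {..q} \<times> UNIV" for q
      by (auto simp: candidates_def)
    ultimately show ?thesis by blast
  qed
  ultimately show ?thesis by auto
qed

lemma next_time_ge: "T \<le> next_time \<rho> T i k" "0 \<le> next_time \<rho> T i k"
proof -
  have *: "T \<le> ereal t \<and> 0 \<le> t" if "emeasure \<rho> (candidates_upto T i k t) \<noteq> 0" for t
  proof -
    from that have "candidates_upto T i k t \<noteq> {}" by auto
    then obtain u where "T < ereal u" "0 < u" "u \<le> t" by (auto simp: candidates_def)
    then have "T < ereal t" "0 \<le> t"
      using less_le_trans[of T "ereal u" "ereal t"] by simp_all
    then show ?thesis by simp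
  qed
  then show "T \<le> next_time \<rho> T i k" "0 \<le> next_time \<rho> T i k"
    unfolding next_time_def by (auto intro!: Inf_greatest)
qed

text \<open>The infimum is attained. Windows ending slightly after \<open>t\<close> have nonzero
  integer mass, hence mass at least 1; their masses are finite, so continuity from above gives mass
  at least 1 up to \<open>t\<close>, and nothing lies before \<open>t\<close>. Finiteness excludes
  candidates accumulating at \<open>t\<close> from the right.\<close>

lemma emeasure_candidates_at:
  assumes i: "i \<in> states" and T: "T \<noteq> - \<infinity>" and \<rho>: "sets \<rho> = sets strip_measure"
    and int: "\<And>A. A \<in> sets \<rho> \<Longrightarrow> emeasure \<rho> A \<in> range ennreal_of_enat"
    and fin: "\<And>t. 0 \<le> t \<Longrightarrow> emeasure \<rho> (candidates_upto T i k t) < \<infinity>"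
    and t: "next_time \<rho> T i k = ereal t"
  shows "emeasure \<rho> (candidates T i k \<inter> {t} \<times> UNIV) \<noteq> 0"
proof -
  note sets = candidates_slab_sets[OF i T _ \<rho>]
  have t0: "0 \<le> t" using next_time_ge(2)[of \<rho> T i k] t by simp
  let ?A = "\<lambda>n. candidates T i k \<inter> {0<..t + 1 / Suc n} \<times> UNIV"
  have "1 \<le> emeasure \<rho> (?A n)" for n
  proof -
    have "next_time \<rho> T i k < ereal (t + 1 / Suc n)" using t by simp
    then obtain q where "q < t + 1 / Suc n" "emeasure \<rho> (candidates_upto T i k q) \<noteq> 0"
      using next_time_less_iff[OF i T \<rho>] by blast
    moreover from this(1) have "emeasure \<rho> (candidates_upto T i k q) \<le> emeasure \<rho> (?A n)"
      by (intro emeasure_mono sets) auto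
    ultimately have "emeasure \<rho> (?A n) \<noteq> 0" by auto
    then show ?thesis using int[OF sets] by (intro ennreal_of_enat_range_ge_1) auto
  qed
  then have "1 \<le> (INF n. emeasure \<rho> (?A n))" by (rule INF_greatest)
  also have "\<dots> = emeasure \<rho> (\<Inter>n. ?A n)"
  proof (rule INF_emeasure_decseq)
    show "range ?A \<subseteq> sets \<rho>" using sets by auto
    show "decseq ?A"
    proof (rule decseq_SucI)
      fix n
      have "t + 1 / Suc (Suc n) \<le> t + 1 / Suc n"
        by (intro add_left_mono frac_le) auto
      then show "?A (Suc n) \<subseteq> ?A n"
        by (auto simp del: of_nat_Suc intro: order_trans)
    qed
    show "emeasure \<rho> (?A n) \<noteq> \<infinity>" for n using fin[of "t + 1 / Suc n"] t0 by auto
  qed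
  finally have le: "1 \<le> emeasure \<rho> (\<Inter>n. ?A n)" .
  have Inter: "(\<Inter>n. ?A n) = candidates_upto T i k t"
  proof -
    have "u \<le> t" if "\<forall>n. u \<le> t + 1 / Suc n" for u
      using LIMSEQ_inverse_real_of_nat_add[of t]
      by (rule LIMSEQ_le_const) (use that in \<open>auto simp: inverse_eq_divide\<close>)
    moreover have "u \<le> t + 1 / Suc n" if "u \<le> t" for u n
      using that by (rule order_trans) simp
    ultimately have "(\<Inter>n. {0<..t + 1 / Suc n}) = {0<..t}"
      by (intro equalityI subsetI) (simp_all del: of_nat_Suc)
    moreover have "(\<Inter>n. ?A n) = candidates T i k \<inter> (\<Inter>n. {0<..t + 1 / Suc n}) \<times> UNIV"
      by blast
    ultimately show ?thesis by (simp only:)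
  qed
  have Un: "candidates_upto T i k t =
      candidates T i k \<inter> {u. ereal u < next_time \<rho> T i k} \<times> UNIV \<union> candidates T i k \<inter> {t} \<times> UNIV"
    unfolding t using t0 by (auto simp: candidates_def)
  note le
  also have "emeasure \<rho> (\<Inter>n. ?A n) \<le> emeasure \<rho> (candidates T i k \<inter> {u. ereal u < next_time \<rho> T i k} \<times> UNIV) +
      emeasure \<rho> (candidates T i k \<inter> {t} \<times> UNIV)"
    unfolding Inter Un by (intro emeasure_subadditive sets ereal_less_sets) simp
  finally show ?thesis
    using emeasure_candidates_before[OF i T \<rho>, of k] by auto
qed

text \<open>The candidates at time \<open>t\<close> are covered by the countably many jump
  intervals, so some interval has nonzero mass, hence mass at least 1. The whole line over
  \<open>t\<close> has mass at most 1, so the interval of the chosen state carries all of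
  it.\<close>

lemma next_jump:
  assumes i: "i \<in> states" and T: "T \<noteq> - \<infinity>" and \<rho>: "sets \<rho> = sets strip_measure"
    and int: "\<And>A. A \<in> sets \<rho> \<Longrightarrow> emeasure \<rho> A \<in> range ennreal_of_enat"
    and fin: "\<And>t. 0 \<le> t \<Longrightarrow> emeasure \<rho> (candidates_upto T i k t) < \<infinity>"
    and simple: "\<And>t. 0 < t \<Longrightarrow> emeasure \<rho> ({t} \<times> UNIV) \<le> 1"
    and t: "next_time \<rho> T i k = ereal t"
  shows "0 < t" "T < ereal t" "next_state \<rho> T i k (ereal t) \<in> states - {i}"
    "emeasure \<rho> ({t} \<times> UNIV) = 1"
    "AE p in \<rho>. fst p = t \<longrightarrow> snd p \<in> \<Lambda> i (next_state \<rho> T i k (ereal t)) (t - real_of_ereal T) k"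
proof -
  have nz: "emeasure \<rho> (candidates T i k \<inter> {t} \<times> UNIV) \<noteq> 0"
    by (rule emeasure_candidates_at) fact+
  then have "candidates T i k \<inter> {t} \<times> UNIV \<noteq> {}" by auto
  then show t0: "0 < t" and Tt: "T < ereal t" by (auto simp: candidates_def)
  let ?a = "t - real_of_ereal T"
  have sets: "{t} \<times> B \<in> sets \<rho>" if "B \<in> sets borel" for B
    unfolding \<rho> using that t0 by (intro strip_slab_sets) auto
  have "\<exists>j. hits \<rho> T i k (ereal t) j"
  proof (rule ccontr)
    assume "\<nexists>j. hits \<rho> T i k (ereal t) j"
    then have "(\<Union>j\<in>states - {i}. {t} \<times> \<Lambda> i j ?a k) \<in> null_sets \<rho>"
      using sets[OF jump_interval_borel] by (intro null_sets_UN' null_setsI) (use t0 Tt in \<open>auto simp: hits_def\<close>)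
    moreover have "candidates T i k \<inter> {t} \<times> UNIV \<subseteq> (\<Union>j\<in>states - {i}. {t} \<times> \<Lambda> i j ?a k)"
      by (auto simp: candidates_def accept_def)
    ultimately have "emeasure \<rho> (candidates T i k \<inter> {t} \<times> UNIV) = 0"
      by (metis emeasure_eq_0 null_setsD1 null_setsD2)
    with nz show False by simp
  qed
  then obtain j where "hits \<rho> T i k (ereal t) j" ..
  then have hits: "hits \<rho> T i k (ereal t) (next_state \<rho> T i k (ereal t))"
    by (rule hits_next_state)
  let ?j = "next_state \<rho> T i k (ereal t)"
  show "?j \<in> states - {i}" using hits by (simp add: hits_def)
  have "1 \<le> emeasure \<rho> ({t} \<times> \<Lambda> i ?j ?a k)"
    using hits int[OF sets[OF jump_interval_borel]]
    by (intro ennreal_of_enat_range_ge_1) (auto simp: hits_def)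
  moreover have "emeasure \<rho> ({t} \<times> \<Lambda> i ?j ?a k) \<le> emeasure \<rho> ({t} \<times> UNIV)"
    by (intro emeasure_mono sets) auto
  ultimately have eq: "emeasure \<rho> ({t} \<times> UNIV) = 1" "emeasure \<rho> ({t} \<times> \<Lambda> i ?j ?a k) = 1"
    using simple[OF t0] by auto
  then show "emeasure \<rho> ({t} \<times> UNIV) = 1" by simp
  have "emeasure \<rho> ({t} \<times> UNIV - {t} \<times> \<Lambda> i ?j ?a k) = 0"
    using eq by (subst emeasure_Diff) (auto intro!: sets jump_interval_borel)
  then have "{t} \<times> UNIV - {t} \<times> \<Lambda> i ?j ?a k \<in> null_sets \<rho>"
    by (intro null_setsI sets.Diff sets jump_interval_borel) auto
  then show "AE p in \<rho>. fst p = t \<longrightarrow> snd p \<in> \<Lambda> i ?j ?a k"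
    by (rule AE_I') auto
qed

end

section \<open>The constructed path of a well-behaved realisation is a cadlag solution\<close>

locale jump_path = jump_rates +
  fixes \<rho> :: "(real \<times> real) measure" and x0 :: nat and y0 :: real
  assumes sets_\<rho>: "sets \<rho> = sets strip_measure"
    and int: "\<And>A. A \<in> sets \<rho> \<Longrightarrow> emeasure \<rho> A \<in> range ennreal_of_enat"
    and simple: "\<And>t. 0 < t \<Longrightarrow> emeasure \<rho> ({t} \<times> UNIV) \<le> 1"
    and x0: "x0 \<in> states" and y0: "0 \<le> y0"
    and fin: "\<And>k t. 0 \<le> t \<Longrightarrow>
      emeasure \<rho> (candidates (jump_time \<rho> x0 y0 k) (jump_state \<rho> x0 y0 k) k \<inter> {0<..t} \<times> UNIV) < \<infinity>"
    and no_explosion: "\<And>t. \<exists>k. ereal t < jump_time \<rho> x0 y0 k"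
begin

abbreviation "T \<equiv> jump_time \<rho> x0 y0"
abbreviation "S \<equiv> jump_state \<rho> x0 y0"
abbreviation "X \<equiv> state_at \<rho> x0 y0"
abbreviation "Y \<equiv> age_at \<rho> x0 y0"
abbreviation "N \<equiv> jump_count \<rho> x0 y0"

lemma S_states: "S k \<in> states"
  using x0 by (rule jump_state_in_states)

lemma T_Suc_ge: "T k \<le> T (Suc k)" "0 \<le> T (Suc k)"
  by (simp_all add: jump_time_Suc next_time_ge)

lemma T_mono: "k \<le> l \<Longrightarrow> T k \<le> T l"
  by (rule lift_Suc_mono_le[of T]) (simp_all add: T_Suc_ge)

lemma T_finite: "T k \<noteq> - \<infinity>"
  using T_Suc_ge(2) by (cases k) (auto simp: jump_time_0)

lemma T_0_le: "0 \<le> t \<Longrightarrow> T 0 \<le> ereal t"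
  using y0 by (simp add: jump_time_0)

lemma jump:
  assumes "T (Suc k) = ereal t"
  shows "0 < t" "T k < ereal t" "S (Suc k) \<in> states - {S k}"
    "emeasure \<rho> ({t} \<times> UNIV) = 1"
    "AE p in \<rho>. fst p = t \<longrightarrow> snd p \<in> \<Lambda> (S k) (S (Suc k)) (t - real_of_ereal (T k)) k"
  using next_jump[OF S_states T_finite sets_\<rho> int fin simple, of k t] assms
  by (simp_all add: jump_time_Suc jump_state_Suc)

lemma no_candidates:
  assumes a: "T k = ereal a" "a \<le> s" "0 \<le> s"
  shows "AE p in \<rho>. s < fst p \<and> ereal (fst p) < T (Suc k) \<longrightarrow> snd p \<notin> accept (S k) (fst p - a) k"
proof -
  let ?N = "candidates (T k) (S k) k \<inter> {u. ereal u < T (Suc k)} \<times> UNIV"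
  have "?N \<in> null_sets \<rho>"
    using emeasure_candidates_before[OF S_states T_finite sets_\<rho>, of k k]
    by (intro null_setsI candidates_slab_sets S_states T_finite sets_\<rho> ereal_less_sets) (simp_all add: jump_time_Suc)
  then show ?thesis
    by (rule AE_I') (use a in \<open>auto simp: candidates_def\<close>)
qed

lemma N_eq:
  assumes t: "0 \<le> t" "T k \<le> ereal t" "ereal t < T (Suc k)"
  shows "N t = k"
proof -
  have "k \<le> l" if "ereal t < T (Suc l)" for l
  proof (rule ccontr)
    assume "\<not> k \<le> l"
    then have "T (Suc l) \<le> T k" by (intro T_mono) simp
    with t(2) that show False by (auto simp: not_le[symmetric])
  qed
  with t(3) show ?thesis
    unfolding jump_count_def by (auto intro!: Least_equality)
qed

lemma ex_interval:
  assumes "0 \<le> t"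
  obtains k where "T k \<le> ereal t" "ereal t < T (Suc k)"
proof -
  define l where "l = (LEAST l. ereal t < T l)"
  have l: "ereal t < T l"
    unfolding l_def using no_explosion[of t] by (rule LeastI_ex)
  with T_0_le[OF assms] obtain k where k: "l = Suc k" by (cases l) auto
  then have "\<not> ereal t < T k" using not_less_Least[of k "\<lambda>l. ereal t < T l"] by (simp add: l_def)
  with l k show ?thesis by (intro that[of k]) auto
qed

lemma in_interval:
  assumes "0 \<le> t" "T k \<le> ereal t" "ereal t < T (Suc k)"
  shows "N t = k" "X t = S k" "Y t = t - real_of_ereal (T k)"
proof -
  show N: "N t = k" by (rule N_eq) fact+
  show "X t = S k" by (simp add: state_at_def N)
  have "real_of_ereal (T k) \<le> t" using assms T_finite[of k] by (cases "T k") auto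
  then show "Y t = t - real_of_ereal (T k)" by (simp add: age_at_def N)
qed

text \<open>Induction over the jumps. The zeroth jump time \<open>- y0\<close> is not positive, and
  \<open>max 0\<close> moves the start of the induction to time 0.\<close>

lemma solves_at_jump_time:
  assumes "T k < \<infinity>"
  shows "solves_at \<rho> x0 y0 X Y N (max 0 (real_of_ereal (T k)))"
  using assms
proof (induction k)
  case 0
  \<comment> \<open>The first jump comes strictly after time 0, so the path starts with the initial
    values and zero jumps.\<close>
  have "0 < T (Suc 0)"
    using T_Suc_ge(2)[of 0] jump(1)[of 0] by (cases "T (Suc 0)") auto
  then have "N 0 = 0" "X 0 = x0" "Y 0 = y0"
    using in_interval[of 0 0] T_0_le[of 0] by (simp_all add: zero_ereal_def jump_state_0 jump_time_0)
  then show ?case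
    using y0 by (simp add: jump_time_0 has_jump_integral_def set_integrable_def set_lebesgue_integral_def)
next
  case (Suc k)
  then obtain t where t: "T (Suc k) = ereal t"
    using T_finite[of "Suc k"] by (cases "T (Suc k)") auto
  note j = jump[OF t]
  then obtain a where a: "T k = ereal a" using T_finite[of k] by (cases "T k") auto
  have IH: "solves_at \<rho> x0 y0 X Y N (max 0 a)"
    using Suc a by simp
  have "T (Suc k) < T (Suc (Suc k))"
    using T_Suc_ge(1)[of "Suc k"] jump(2)[of "Suc k"] t by (cases "T (Suc (Suc k))") auto
  then have at: "X t = S (Suc k)" "Y t = 0" "N t = Suc k"
    using in_interval[of t "Suc k"] t j(1) by simp_all
  have "solves_at \<rho> x0 y0 X Y N t"
  proof (rule solves_at_step[OF sets_\<rho> _ _ IH S_states, where a=a and k=k and j="S (Suc k)"])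
    show "0 \<le> max 0 a" "max 0 a < t" "a \<le> max 0 a" using j a by auto
    show "X u = S k \<and> Y u = u - a \<and> N u = k" if "max 0 a \<le> u" "u < t" for u
      using in_interval[of u k] that a t by simp
    show "AE p in \<rho>. max 0 a < fst p \<and> fst p < t \<longrightarrow> snd p \<notin> accept (S k) (fst p - a) k"
      using no_candidates[OF a, of "max 0 a"] t by simp
  qed (use j a at in auto)
  then show ?case using t j(1) by simp
qed

theorem solves: "solves_system R lam lam_up \<rho> x0 y0 X Y N"
  unfolding solves_system_def
proof (intro allI impI)
  fix t :: real assume t: "0 \<le> t"
  then obtain k where k: "T k \<le> ereal t" "ereal t < T (Suc k)" by (rule ex_interval)
  then obtain a where a: "T k = ereal a" "a \<le> t" using T_finite[of k] by (cases "T k") auto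
  have at_s: "solves_at \<rho> x0 y0 X Y N (max 0 a)"
    using solves_at_jump_time[of k] a by simp
  show "solves_at \<rho> x0 y0 X Y N t"
  proof (cases "max 0 a = t")
    case False
    show ?thesis
    \<comment> \<open>Since \<open>t < T (Suc k)\<close>, nothing jumps at \<open>t\<close>; the
      first alternative of the step applies and the value given for \<open>j\<close> is
      arbitrary.\<close>
    proof (rule solves_at_step[OF sets_\<rho> _ _ at_s S_states, where a=a and k=k and j=0])
      show "0 \<le> max 0 a" "max 0 a < t" "a \<le> max 0 a" using False a t by auto
      have v: "X u = S k \<and> Y u = u - a \<and> N u = k" if "max 0 a \<le> u" "u \<le> t" for u
        using in_interval[of u k] le_less_trans[of "ereal u" "ereal t" "T (Suc k)"] that a k by simp
      show "X u = S k \<and> Y u = u - a \<and> N u = k" if "max 0 a \<le> u" "u < t" for u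
        using v that by simp
      have "AE p in \<rho>. max 0 a < fst p \<and> ereal (fst p) < T (Suc k) \<longrightarrow> snd p \<notin> accept (S k) (fst p - a) k"
        using no_candidates[OF a(1), of "max 0 a"] by simp
      then have AE: "AE p in \<rho>. max 0 a < fst p \<and> fst p \<le> t \<longrightarrow> snd p \<notin> accept (S k) (fst p - a) k"
      proof eventually_elim
        case (elim p)
        then show ?case using le_less_trans[of "ereal (fst p)" "ereal t" "T (Suc k)"] k by simp
      qed
      then show "AE p in \<rho>. max 0 a < fst p \<and> fst p < t \<longrightarrow> snd p \<notin> accept (S k) (fst p - a) k"
        by eventually_elim auto
      from AE have "AE p in \<rho>. fst p = t \<longrightarrow> snd p \<notin> accept (S k) (fst p - a) k"
        by eventually_elim (use False a t in auto)
      then show "X t = S k \<and> Y t = t - a \<and> N t = k \<and>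
        (AE p in \<rho>. fst p = t \<longrightarrow> snd p \<notin> accept (S k) (fst p - a) k) \<or>
        0 \<in> states - {S k} \<and> X t = 0 \<and> Y t = 0 \<and> N t = Suc k \<and> emeasure \<rho> ({t} \<times> UNIV) = 1 \<and>
        (AE p in \<rho>. fst p = t \<longrightarrow> snd p \<in> \<Lambda> (S k) 0 (t - a) k)"
        using v[of t] a t by auto
    qed
  qed (use at_s in simp)
qed

text \<open>Without explosion every time \<open>t \<ge> 0\<close> lies in some
  \<open>[T k, T (Suc k))\<close>, which gives right continuity, and every \<open>t > 0\<close> in
  some \<open>(T k, T (Suc k)]\<close>, which gives the left limit.\<close>

lemma cadlag_pieces:
  fixes f :: "real \<Rightarrow> 'b::topological_space"
  assumes f: "\<And>k t. 0 \<le> t \<Longrightarrow> T k \<le> ereal t \<Longrightarrow> ereal t < T (Suc k) \<Longrightarrow> f t = g k t"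
    and g: "\<And>k t. isCont (g k) t"
  shows "cadlag f"
  unfolding cadlag_def
proof (intro conjI allI impI)
  fix t :: real assume t: "0 \<le> t"
  then obtain k where k: "T k \<le> ereal t" "ereal t < T (Suc k)" by (rule ex_interval)
  obtain b where b: "t < b" "ereal b < T (Suc k)"
    using ereal_dense2[OF k(2)] by auto
  have "eventually (\<lambda>u. f u = g k u) (at_right t)"
    unfolding eventually_at_right_field
  proof (intro exI[of _ b] conjI allI impI)
    fix u assume u: "t < u" "u < b"
    then have "T k \<le> ereal u" using order_trans[OF k(1), of "ereal u"] by simp
    moreover have "ereal u < T (Suc k)" using u less_trans[OF _ b(2), of "ereal u"] by simp
    ultimately show "f u = g k u" using u t by (intro f) auto
  qed (use b in simp)
  moreover have "(g k \<longlongrightarrow> f t) (at_right t)"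
    using g f[OF t k] by (simp add: isCont_def filterlim_at_split)
  ultimately show "(f \<longlongrightarrow> f t) (at_right t)"
    by (rule iffD2[OF tendsto_cong])
next
  fix t :: real assume t: "0 < t"
  \<comment> \<open>The weak inequality selects the interval that is open on the left and contains
    \<open>t\<close>, even when \<open>t\<close> itself is a jump time.\<close>
  define l where "l = (LEAST l. ereal t \<le> T l)"
  have l: "ereal t \<le> T l"
  proof -
    have "\<exists>l. ereal t \<le> T l" using no_explosion[of t] less_imp_le by blast
    then show ?thesis unfolding l_def by (rule LeastI_ex)
  qed
  with T_0_le[of 0] t obtain k where k: "l = Suc k" by (cases l) (auto simp: jump_time_0)
  then have lt: "T k < ereal t" using not_less_Least[of k "\<lambda>l. ereal t \<le> T l"] by (simp add: l_def)
  then obtain b where b: "T k < ereal b" "b < t" using ereal_dense2 by fastforce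
  have "eventually (\<lambda>u. f u = g k u) (at_left t)"
    unfolding eventually_at_left_field
  proof (intro exI[of _ "max 0 b"] conjI allI impI)
    fix u assume u: "max 0 b < u" "u < t"
    then have "T k \<le> ereal u" using less_trans[OF b(1), of "ereal u"] by simp
    moreover have "ereal u < T (Suc k)" using u l k less_le_trans[of "ereal u" "ereal t"] by simp
    ultimately show "f u = g k u" using u by (intro f) auto
  qed (use b t in simp)
  moreover have "(g k \<longlongrightarrow> g k t) (at_left t)"
    using g by (simp add: isCont_def filterlim_at_split)
  ultimately have "(f \<longlongrightarrow> g k t) (at_left t)"
    by (rule iffD2[OF tendsto_cong])
  then show "\<exists>l. (f \<longlongrightarrow> l) (at_left t)" ..
qed

lemma cadlag_X: "cadlag X" and cadlag_Y: "cadlag Y" and cadlag_N: "cadlag N"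
  by (rule cadlag_pieces[where g="\<lambda>k _. S k"], simp_all add: in_interval)
    (rule cadlag_pieces[where g="\<lambda>k u. u - real_of_ereal (T k)"], simp_all add: in_interval,
     rule cadlag_pieces[where g="\<lambda>k _. k"], simp_all add: in_interval)

end

section \<open>Predictable sets and the compensation formula\<close>

text \<open>The Poisson law enters through \<open>\<rho>_intensity\<close>: given
  \<open>G s\<close>, the expected mass of a bounded window after \<open>s\<close> is its Lebesgue
  measure. Local finiteness is asked of every realisation, since masses are subtracted
  pointwise.\<close>

locale jump_noise = prob_space M for M :: "'w measure" +
  fixes G :: "real \<Rightarrow> 'w measure" and \<rho> :: "'w \<Rightarrow> (real \<times> real) measure"
  assumes space_G: "0 \<le> t \<Longrightarrow> space (G t) = space M"
    and sets_G: "0 \<le> t \<Longrightarrow> sets (G t) \<subseteq> sets M"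
    and G_mono: "0 \<le> s \<Longrightarrow> s \<le> t \<Longrightarrow> sets (G s) \<subseteq> sets (G t)"
    and sets_\<rho>: "\<omega> \<in> space M \<Longrightarrow> sets (\<rho> \<omega>) = sets strip_measure"
    and \<rho>_measurable: "0 \<le> t \<Longrightarrow> B \<in> sets borel \<Longrightarrow>
      (\<lambda>\<omega>. emeasure (\<rho> \<omega>) ({0<..t} \<times> B)) \<in> borel_measurable (G t)"
    and \<rho>_finite: "\<omega> \<in> space M \<Longrightarrow> emeasure (\<rho> \<omega>) ({0<..t} \<times> {- b..b}) < \<infinity>"
    and \<rho>_intensity: "0 \<le> s \<Longrightarrow> s \<le> t \<Longrightarrow> H \<in> sets (G s) \<Longrightarrow> B \<in> sets borel \<Longrightarrow> B \<subseteq> {- b..b} \<Longrightarrow>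
      (\<integral>\<^sup>+\<omega>. indicator H \<omega> * emeasure (\<rho> \<omega>) ({s<..t} \<times> B) \<partial>M) =
      emeasure M H * (ennreal (t - s) * emeasure lborel B)"
begin

lemma strip_sets:
  assumes "\<omega> \<in> space M" "A \<in> sets borel" "A \<subseteq> {0<..} \<times> UNIV"
  shows "A \<in> sets (\<rho> \<omega>)"
  unfolding sets_\<rho>[OF assms(1)] sets_strip_measure_iff using assms(2,3) by force

text \<open>The usual predictable sigma-algebra with an additional mark coordinate. Rays in time
  make the generator stable under intersection, the starting time of an intersection being the
  maximum of the two.\<close>

definition predictable :: "((real \<times> real) \<times> 'w) measure" where
  "predictable = sigma (({0<..} \<times> UNIV) \<times> space M)
    {({s<..} \<times> B) \<times> H | s B H. 0 \<le> s \<and> B \<in> sets borel \<and> H \<in> sets (G s)}"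

abbreviation points :: "((real \<times> real) \<times> 'w) set \<Rightarrow> 'w \<Rightarrow> (real \<times> real) set" where
  "points A \<omega> \<equiv> {p. (p, \<omega>) \<in> A}"

abbreviation slab_mass :: "(real \<times> real) measure \<Rightarrow> ((real \<times> real) \<times> 'w) set \<Rightarrow> real \<Rightarrow> 'w \<Rightarrow> ennreal" where
  "slab_mass m A t \<omega> \<equiv> emeasure m (points A \<omega> \<inter> {0<..t} \<times> UNIV)"

lemma G_into_space: "0 \<le> s \<Longrightarrow> H \<in> sets (G s) \<Longrightarrow> H \<subseteq> space M"
  using sets.sets_into_space[of H "G s"] space_G by auto

lemma predictable_generators:
  "{({s<..} \<times> B) \<times> H | s B H. 0 \<le> s \<and> B \<in> sets borel \<and> H \<in> sets (G s)} \<subseteq>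
    Pow (({0<..} \<times> (UNIV :: real set)) \<times> space M)"
proof -
  have "u \<in> {s<..} \<Longrightarrow> 0 \<le> s \<Longrightarrow> 0 < u" for u s :: real by simp
  then show ?thesis using G_into_space by blast
qed

lemma space_predictable: "space predictable = ({0<..} \<times> UNIV) \<times> space M"
  unfolding predictable_def using predictable_generators by (rule space_measure_of)

lemma sets_predictable: "sets predictable = sigma_sets (({0<..} \<times> UNIV) \<times> space M)
    {({s<..} \<times> B) \<times> H | s B H. 0 \<le> s \<and> B \<in> sets borel \<and> H \<in> sets (G s)}"
  unfolding predictable_def using predictable_generators by (rule sets_measure_of)

lemma predictable_generator:
  assumes "0 \<le> s" "B \<in> sets borel" "H \<in> sets (G s)"
  shows "({s<..} \<times> B) \<times> H \<in> sets predictable"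
  unfolding sets_predictable using assms by (intro sigma_sets.Basic) blast

lemma Int_stable_predictable:
  "Int_stable {({s<..} \<times> B) \<times> H | s B H. 0 \<le> s \<and> B \<in> sets borel \<and> H \<in> sets (G s)}"
  (is "Int_stable ?E")
proof (rule Int_stableI)
  fix a a' assume "a \<in> ?E" "a' \<in> ?E"
  then obtain s s' B B' H H' where a: "a = ({s<..} \<times> B) \<times> H" "a' = ({s'<..} \<times> B') \<times> H'"
    and *: "0 \<le> s" "0 \<le> s'" "B \<in> sets borel" "B' \<in> sets borel" "H \<in> sets (G s)" "H' \<in> sets (G s')"
    by blast
  have "H \<in> sets (G (max s s'))" "H' \<in> sets (G (max s s'))"
    using G_mono[of s "max s s'"] G_mono[of s' "max s s'"] * by auto
  then have "H \<inter> H' \<in> sets (G (max s s'))" by (rule sets.Int)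
  moreover have "a \<inter> a' = ({max s s'<..} \<times> (B \<inter> B')) \<times> (H \<inter> H')"
    by (auto simp: a)
  moreover have "0 \<le> max s s'" "B \<inter> B' \<in> sets borel"
    using * by auto
  ultimately show "a \<inter> a' \<in> ?E" by blast
qed

lemma points_sets:
  assumes "A \<in> sets predictable"
  shows "points A \<omega> \<in> sets borel"
proof -
  have "sets predictable \<subseteq> sets (borel \<Otimes>\<^sub>M M)"
  proof -
    have sp: "({0 :: real<..} \<times> (UNIV :: real set)) \<times> space M \<in> sets (borel \<Otimes>\<^sub>M M)"
      by (intro pair_measureI borel_Times sets.top) auto
    have "({s<..} \<times> B) \<times> H \<in> sets (borel \<Otimes>\<^sub>M M)"
      if "0 \<le> s" "B \<in> sets borel" "H \<in> sets (G s)" for s :: real and B :: "real set" and H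
      using that sets_G[of s] by (intro pair_measureI borel_Times) auto
    then show "sets predictable \<subseteq> sets (borel \<Otimes>\<^sub>M M)"
      unfolding sets_predictable by (intro sets.sigma_sets_subset'[OF _ sp]) auto
  qed
  with assms have "(\<lambda>p. (p, \<omega>)) -` A \<in> sets borel" by (intro sets_Pair2) auto
  then show ?thesis by (simp add: vimage_def)
qed

lemma points_subset: "A \<in> sets predictable \<Longrightarrow> points A \<omega> \<subseteq> {0<..} \<times> UNIV"
  using sets.sets_into_space[of A predictable] by (auto simp: space_predictable)

context
  fixes t b :: real
  assumes t: "0 \<le> t"
begin

private abbreviation "window \<equiv> {0<..t} \<times> {- b..b}"

private abbreviation "mass m A \<omega> \<equiv> emeasure m (points A \<omega> \<inter> window)"

lemma window_sets: "window \<in> sets borel"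
  by (rule borel_Times) auto

lemma emeasure_points_compl:
  assumes A: "A \<in> sets predictable" and \<omega>: "\<omega> \<in> space M"
    and m: "\<And>S. S \<in> sets borel \<Longrightarrow> S \<subseteq> {0<..} \<times> UNIV \<Longrightarrow> S \<in> sets m"
    and fin: "emeasure m window < \<infinity>"
  shows "mass m (space predictable - A) \<omega> =
    emeasure m window - mass m A \<omega>"
proof -
  have sets: "points A \<omega> \<inter> window \<in> sets m" "window \<in> sets m"
    using points_sets[OF A] window_sets by (auto intro!: m)
  have "mass m A \<omega> \<le> emeasure m window"
    using sets by (intro emeasure_mono) auto
  with fin have "mass m A \<omega> \<noteq> \<infinity>" by auto
  moreover have "points (space predictable - A) \<omega> \<inter> window = window - points A \<omega> \<inter> window"
    using \<omega> by (auto simp: space_predictable)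
  ultimately show ?thesis
    using sets by (simp add: emeasure_Diff)
qed

lemma emeasure_points_UN:
  assumes A: "range A \<subseteq> sets predictable" "disjoint_family A"
    and m: "\<And>S. S \<in> sets borel \<Longrightarrow> S \<subseteq> {0<..} \<times> UNIV \<Longrightarrow> S \<in> sets m"
  shows "mass m (\<Union>i::nat. A i) \<omega> = (\<Sum>i. mass m (A i) \<omega>)"
proof -
  have "points (A i) \<omega> \<inter> window \<in> sets m" for i
  proof (rule m)
    show "points (A i) \<omega> \<inter> window \<in> sets borel"
      using A(1) by (intro sets.Int points_sets window_sets) auto
  qed auto
  moreover have "disjoint_family (\<lambda>i. points (A i) \<omega> \<inter> window)"
    using A(2) unfolding disjoint_family_on_def by blast
  ultimately have "(\<Sum>i. mass m (A i) \<omega>) = emeasure m (\<Union>i. points (A i) \<omega> \<inter> window)"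
    by (intro suminf_emeasure) auto
  also have "(\<Union>i. points (A i) \<omega> \<inter> window) = points (\<Union>i. A i) \<omega> \<inter> window"
    by auto
  finally show ?thesis ..
qed

lemma emeasure_window: "emeasure lborel window < \<infinity>"
  unfolding lborel_prod[symmetric]
  by (subst lborel.emeasure_pair_measure_Times) (use t in \<open>auto simp: ennreal_mult_less_top emeasure_lborel_Icc_eq\<close>)

text \<open>Dynkin argument from the generating rectangles, where the identity is the intensity
  assumption. Complements are taken by subtraction and need finite masses; this is why the marks are
  first confined to \<open>[- b, b]\<close>.\<close>

lemma compensation_window:
  assumes "A \<in> sets predictable"
  shows "(\<lambda>\<omega>. mass (\<rho> \<omega>) A \<omega>) \<in> borel_measurable (G t) \<and>
    (\<lambda>\<omega>. mass lborel A \<omega>) \<in> borel_measurable M \<and>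
    (\<integral>\<^sup>+\<omega>. mass (\<rho> \<omega>) A \<omega> \<partial>M) = (\<integral>\<^sup>+\<omega>. mass lborel A \<omega> \<partial>M)"
  using Int_stable_predictable predictable_generators assms[unfolded sets_predictable]
proof (induction rule: sigma_sets_induct_disjoint)
  case (basic A)
  then obtain s B H where A: "A = ({s<..} \<times> B) \<times> H" and s: "0 \<le> s"
    and B: "B \<in> sets borel" and H: "H \<in> sets (G s)" by blast
  show ?case
  proof (cases "s < t")
    case False
    then have "points A \<omega> \<inter> window = {}" for \<omega> by (auto simp: A)
    then show ?thesis by simp
  next
    case True
    let ?B = "B \<inter> {- b..b}"
    have eq: "mass m A \<omega> = indicator H \<omega> * emeasure m ({s<..t} \<times> ?B)" for m \<omega>
    proof -
      have "points A \<omega> \<inter> window = (if \<omega> \<in> H then {s<..t} \<times> ?B else {})"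
        using s by (auto simp: A)
      then show ?thesis by simp
    qed
    have HG: "H \<in> sets (G t)" using H G_mono[of s t] s True by auto
    have HM: "H \<in> sets M" using H sets_G[OF s] by auto
    have [measurable]: "(\<lambda>\<omega>. emeasure (\<rho> \<omega>) ({0<..t} \<times> ?B)) \<in> borel_measurable (G t)"
      using B t by (intro \<rho>_measurable) auto
    have "(\<lambda>\<omega>. emeasure (\<rho> \<omega>) ({0<..s} \<times> ?B)) \<in> borel_measurable (G s)"
      using B s by (intro \<rho>_measurable) auto
    then have [measurable]: "(\<lambda>\<omega>. emeasure (\<rho> \<omega>) ({0<..s} \<times> ?B)) \<in> borel_measurable (G t)"
      by (rule borel_measurable_subalgebra[rotated 2]) (use G_mono[of s t] space_G s t True in auto)
    \<comment> \<open>Measurability is available for windows that start at time 0, so the mass over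
      \<open>(s, t]\<close> is written as a difference of two such masses.\<close>
    have diff: "emeasure (\<rho> \<omega>) ({s<..t} \<times> ?B) =
      emeasure (\<rho> \<omega>) ({0<..t} \<times> ?B) - emeasure (\<rho> \<omega>) ({0<..s} \<times> ?B)" if \<omega>: "\<omega> \<in> space M" for \<omega>
    proof -
      have sets: "{0<..r} \<times> ?B \<in> sets (\<rho> \<omega>)" "{0<..s} \<times> {-b..b} \<in> sets (\<rho> \<omega>)" for r
        using B \<omega> by (auto intro!: strip_sets borel_Times)
      have "emeasure (\<rho> \<omega>) ({0<..s} \<times> ?B) \<le> emeasure (\<rho> \<omega>) ({0<..s} \<times> {-b..b})"
        using sets by (intro emeasure_mono) auto
      also have "\<dots> < \<infinity>" using \<omega> by (rule \<rho>_finite)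
      finally have "emeasure (\<rho> \<omega>) ({0<..t} \<times> ?B - {0<..s} \<times> ?B) =
        emeasure (\<rho> \<omega>) ({0<..t} \<times> ?B) - emeasure (\<rho> \<omega>) ({0<..s} \<times> ?B)"
        using sets True by (intro emeasure_Diff) auto
      moreover have "{0<..t} \<times> ?B - {0<..s} \<times> ?B = {s<..t} \<times> ?B"
        using s by auto
      ultimately show ?thesis by simp
    qed
    have "(\<lambda>\<omega>. indicator H \<omega> * (emeasure (\<rho> \<omega>) ({0<..t} \<times> ?B) - emeasure (\<rho> \<omega>) ({0<..s} \<times> ?B)))
        \<in> borel_measurable (G t)"
      using HG by measurable
    then have 1: "(\<lambda>\<omega>. indicator H \<omega> * emeasure (\<rho> \<omega>) ({s<..t} \<times> ?B)) \<in> borel_measurable (G t)"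
      by (rule measurable_cong[THEN iffD2, rotated]) (simp add: space_G t diff)
    have "emeasure lborel ({s<..t} \<times> ?B) = ennreal (t - s) * emeasure lborel ?B"
      unfolding lborel_prod[symmetric] using B True
      by (subst lborel.emeasure_pair_measure_Times) auto
    then have "(\<integral>\<^sup>+\<omega>. indicator H \<omega> * emeasure (\<rho> \<omega>) ({s<..t} \<times> ?B) \<partial>M) =
        (\<integral>\<^sup>+\<omega>. indicator H \<omega> * emeasure lborel ({s<..t} \<times> ?B) \<partial>M)"
      using HM \<rho>_intensity[of s t H ?B b] s True H B
      by (simp add: nn_integral_multc)
    then show ?thesis
      unfolding eq using 1 HM by auto
  qed
next
  case (compl A)
  then have A: "A \<in> sets predictable" by (simp add: sets_predictable)
  let ?e = "\<lambda>A \<omega>. mass (\<rho> \<omega>) A \<omega>" and ?l = "\<lambda>A \<omega>. mass lborel A \<omega>"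
  have eq: "?e (space predictable - A) \<omega> = emeasure (\<rho> \<omega>) window - ?e A \<omega>"
    "?l (space predictable - A) \<omega> = emeasure lborel window - ?l A \<omega>" if "\<omega> \<in> space M" for \<omega>
    using emeasure_points_compl[OF A that strip_sets[OF that] \<rho>_finite[OF that]]
      emeasure_points_compl[OF A that _ emeasure_window] by auto
  have le: "?e A \<omega> \<le> emeasure (\<rho> \<omega>) window" "?l A \<omega> \<le> emeasure lborel window" if "\<omega> \<in> space M" for \<omega>
    using window_sets that by (auto intro!: emeasure_mono strip_sets)
  have m1: "?e A \<in> borel_measurable (G t)" and m2: "?l A \<in> borel_measurable M"
    and int: "(\<integral>\<^sup>+\<omega>. ?e A \<omega> \<partial>M) = (\<integral>\<^sup>+\<omega>. ?l A \<omega> \<partial>M)"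
    using compl by auto
  have m1': "?e A \<in> borel_measurable M"
    by (rule borel_measurable_subalgebra[OF _ _ m1]) (use sets_G space_G t in auto)
  have mb: "(\<lambda>\<omega>. emeasure (\<rho> \<omega>) window) \<in> borel_measurable (G t)"
    using t by (intro \<rho>_measurable) auto
  then have mb': "(\<lambda>\<omega>. emeasure (\<rho> \<omega>) window) \<in> borel_measurable M"
    by (rule borel_measurable_subalgebra[rotated 2]) (use sets_G space_G t in auto)
  \<comment> \<open>The identity for the full window, from the intensity with \<open>s = 0\<close>
    and the sure event.\<close>
  have window: "(\<integral>\<^sup>+\<omega>. emeasure (\<rho> \<omega>) window \<partial>M) = emeasure lborel window"
  proof -
    have "emeasure lborel window = ennreal t * emeasure lborel {-b..b}"
      unfolding lborel_prod[symmetric] using t by (subst lborel.emeasure_pair_measure_Times) auto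
    moreover have "space M \<in> sets (G 0)" using sets.top[of "G 0"] space_G[of 0] by simp
    then have "(\<integral>\<^sup>+\<omega>. indicator (space M) \<omega> * emeasure (\<rho> \<omega>) window \<partial>M) = ennreal t * emeasure lborel {-b..b}"
      using \<rho>_intensity[of 0 t "space M" "{-b..b}" b] t by (simp add: emeasure_space_1)
    moreover have "(\<integral>\<^sup>+\<omega>. indicator (space M) \<omega> * emeasure (\<rho> \<omega>) window \<partial>M) = (\<integral>\<^sup>+\<omega>. emeasure (\<rho> \<omega>) window \<partial>M)"
      by (intro nn_integral_cong) simp
    ultimately show ?thesis by simp
  qed
  \<comment> \<open>Subtracting integrals needs a finite subtrahend. The bounded window gives this
    on the Lebesgue side, and the induction hypothesis transfers it to the random measure.\<close>
  have fin: "(\<integral>\<^sup>+\<omega>. ?l A \<omega> \<partial>M) < \<infinity>"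
  proof -
    have "(\<integral>\<^sup>+\<omega>. ?l A \<omega> \<partial>M) \<le> (\<integral>\<^sup>+\<omega>. emeasure lborel window \<partial>M)"
      using le by (intro nn_integral_mono)
    also have "\<dots> < \<infinity>" using emeasure_window by (simp add: emeasure_space_1)
    finally show ?thesis .
  qed
  have "(\<integral>\<^sup>+\<omega>. ?e (space predictable - A) \<omega> \<partial>M) = (\<integral>\<^sup>+\<omega>. emeasure (\<rho> \<omega>) window - ?e A \<omega> \<partial>M)"
    by (intro nn_integral_cong eq)
  also have "\<dots> = emeasure lborel window - (\<integral>\<^sup>+\<omega>. ?l A \<omega> \<partial>M)"
    using fin le by (subst nn_integral_diff) (auto simp: int window m1' mb' intro!: AE_I2)
  also have "\<dots> = (\<integral>\<^sup>+\<omega>. emeasure lborel window - ?l A \<omega> \<partial>M)"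
    using fin le by (subst nn_integral_diff) (auto simp: m2 emeasure_space_1 intro!: AE_I2)
  also have "\<dots> = (\<integral>\<^sup>+\<omega>. ?l (space predictable - A) \<omega> \<partial>M)"
    by (intro nn_integral_cong eq[symmetric])
  finally have "(\<integral>\<^sup>+\<omega>. ?e (space predictable - A) \<omega> \<partial>M) = (\<integral>\<^sup>+\<omega>. ?l (space predictable - A) \<omega> \<partial>M)" .
  moreover have "(\<lambda>\<omega>. emeasure (\<rho> \<omega>) window - ?e A \<omega>) \<in> borel_measurable (G t)"
    using mb m1 by simp
  then have "?e (space predictable - A) \<in> borel_measurable (G t)"
    by (rule measurable_cong[THEN iffD2, rotated]) (use eq space_G t in auto)
  moreover have "(\<lambda>\<omega>. emeasure lborel window - ?l A \<omega>) \<in> borel_measurable M"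
    using m2 by simp
  then have "?l (space predictable - A) \<in> borel_measurable M"
    by (rule measurable_cong[THEN iffD2, rotated]) (use eq in auto)
  ultimately show ?case unfolding space_predictable by blast
next
  case (union A)
  then have A: "range A \<subseteq> sets predictable" by (simp add: sets_predictable)
  have eq: "mass (\<rho> \<omega>) (\<Union>i. A i) \<omega> = (\<Sum>i. mass (\<rho> \<omega>) (A i) \<omega>)"
    "mass lborel (\<Union>i. A i) \<omega> = (\<Sum>i. mass lborel (A i) \<omega>)"
    if "\<omega> \<in> space M" for \<omega>
    using emeasure_points_UN[OF A union(1) strip_sets[OF that]] emeasure_points_UN[OF A union(1)] by auto
  have m1: "(\<lambda>\<omega>. mass (\<rho> \<omega>) (A i) \<omega>) \<in> borel_measurable (G t)"
    and m2: "(\<lambda>\<omega>. mass lborel (A i) \<omega>) \<in> borel_measurable M"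
    and int: "(\<integral>\<^sup>+\<omega>. mass (\<rho> \<omega>) (A i) \<omega> \<partial>M) = (\<integral>\<^sup>+\<omega>. mass lborel (A i) \<omega> \<partial>M)"
    for i using union(3)[of i] by auto
  have m1': "(\<lambda>\<omega>. mass (\<rho> \<omega>) (A i) \<omega>) \<in> borel_measurable M" for i
    by (rule borel_measurable_subalgebra[OF _ _ m1]) (use sets_G space_G t in auto)
  have "(\<lambda>\<omega>. \<Sum>i. mass (\<rho> \<omega>) (A i) \<omega>) \<in> borel_measurable (G t)"
    using m1 by measurable
  then have "(\<lambda>\<omega>. mass (\<rho> \<omega>) (\<Union>i. A i) \<omega>) \<in> borel_measurable (G t)"
    by (rule measurable_cong[THEN iffD2, rotated]) (simp only: eq space_G t)
  moreover have "(\<lambda>\<omega>. \<Sum>i. mass lborel (A i) \<omega>) \<in> borel_measurable M"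
    using m2 by measurable
  then have "(\<lambda>\<omega>. mass lborel (\<Union>i. A i) \<omega>) \<in> borel_measurable M"
    by (rule measurable_cong[THEN iffD2, rotated]) (simp only: eq)
  moreover have "(\<integral>\<^sup>+\<omega>. mass (\<rho> \<omega>) (\<Union>i. A i) \<omega> \<partial>M) =
      (\<integral>\<^sup>+\<omega>. mass lborel (\<Union>i. A i) \<omega> \<partial>M)"
  proof -
    have "(\<integral>\<^sup>+\<omega>. mass (\<rho> \<omega>) (\<Union>i. A i) \<omega> \<partial>M) =
        (\<integral>\<^sup>+\<omega>. (\<Sum>i. mass (\<rho> \<omega>) (A i) \<omega>) \<partial>M)"
      by (intro nn_integral_cong eq)
    also have "\<dots> = (\<Sum>i. \<integral>\<^sup>+\<omega>. mass lborel (A i) \<omega> \<partial>M)"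
      by (subst nn_integral_suminf[OF m1']) (simp only: int)
    also have "\<dots> = (\<integral>\<^sup>+\<omega>. (\<Sum>i. mass lborel (A i) \<omega>) \<partial>M)"
      by (rule nn_integral_suminf[OF m2, symmetric])
    also have "\<dots> = (\<integral>\<^sup>+\<omega>. mass lborel (\<Union>i. A i) \<omega> \<partial>M)"
      by (intro nn_integral_cong eq[symmetric])
    finally show ?thesis .
  qed
  ultimately show ?case by blast
qed simp

end

lemma emeasure_slab_SUP:
  fixes m :: "(real \<times> real) measure"
  assumes m: "\<And>S. S \<in> sets borel \<Longrightarrow> S \<subseteq> {0<..} \<times> UNIV \<Longrightarrow> S \<in> sets m" and A: "A \<in> sets borel"
  shows "emeasure m (A \<inter> {0<..t} \<times> UNIV) = (SUP n::nat. emeasure m (A \<inter> {0<..t} \<times> {- real n..real n}))"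
    and "incseq (\<lambda>n::nat. emeasure m (A \<inter> {0<..t} \<times> {- real n..real n}))"
proof -
  have sets: "A \<inter> {0<..t} \<times> {- real n..real n} \<in> sets m" for n
    using A by (intro m sets.Int borel_Times) auto
  have inc: "incseq (\<lambda>n. A \<inter> {0<..t} \<times> {- real n..real n})"
    by (auto simp: incseq_def)
  have "(\<Union>n. A \<inter> {0<..t} \<times> {- real n..real n}) = A \<inter> {0<..t} \<times> UNIV"
  proof -
    have "\<exists>n::nat. v \<in> {- real n..real n}" for v :: real
    proof -
      obtain n :: nat where "\<bar>v\<bar> \<le> real n" using real_arch_simple by blast
      then have "v \<in> {- real n..real n}" by auto
      then show ?thesis ..
    qed
    then have "(\<Union>n::nat. {- real n..real n}) = UNIV" by blast
    moreover have "(\<Union>n. A \<inter> {0<..t} \<times> {- real n..real n}) = A \<inter> {0<..t} \<times> (\<Union>n::nat. {- real n..real n})"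
      by blast
    ultimately show ?thesis by simp
  qed
  moreover have "range (\<lambda>n. A \<inter> {0<..t} \<times> {- real n..real n}) \<subseteq> sets m"
    using sets by blast
  ultimately show "emeasure m (A \<inter> {0<..t} \<times> UNIV) =
      (SUP n::nat. emeasure m (A \<inter> {0<..t} \<times> {- real n..real n}))"
    using SUP_emeasure_incseq[OF _ inc, of m] by simp
  show "incseq (\<lambda>n::nat. emeasure m (A \<inter> {0<..t} \<times> {- real n..real n}))"
    unfolding incseq_def using sets inc by (auto simp: incseq_def intro!: emeasure_mono)
qed

text \<open>The number of points of a predictable set up to time \<open>t\<close> is known at time
  \<open>t\<close>. This turns predictable descriptions of the next jump into events of the
  filtration.\<close>

lemma predictable_count_measurable:
  assumes A: "A \<in> sets predictable" and t: "0 \<le> t"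
  shows "(\<lambda>\<omega>. slab_mass (\<rho> \<omega>) A t \<omega>) \<in> borel_measurable (G t)"
proof -
  have "(\<lambda>\<omega>. SUP n::nat. emeasure (\<rho> \<omega>) (points A \<omega> \<inter> {0<..t} \<times> {- real n..real n})) \<in> borel_measurable (G t)"
    using compensation_window[OF t A] by (intro borel_measurable_SUP) auto
  then show ?thesis
    by (rule measurable_cong[THEN iffD2, rotated])
      (simp only: space_G[OF t] emeasure_slab_SUP(1)[OF strip_sets points_sets[OF A]])
qed

lemma predictable_lborel_measurable:
  assumes A: "A \<in> sets predictable" and t: "0 \<le> t"
  shows "(\<lambda>\<omega>. slab_mass lborel A t \<omega>) \<in> borel_measurable M"
proof -
  have "(\<lambda>\<omega>. SUP n::nat. emeasure lborel (points A \<omega> \<inter> {0<..t} \<times> {- real n..real n})) \<in> borel_measurable M"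
    using compensation_window[OF t A] by (intro borel_measurable_SUP) auto
  then show ?thesis
    by (rule measurable_cong[THEN iffD2, rotated])
      (rule emeasure_slab_SUP(1)[OF _ points_sets[OF A]], simp)
qed

text \<open>Monotone convergence on both sides removes the confinement of the marks to
  \<open>[- n, n]\<close>.\<close>

lemma compensation:
  assumes A: "A \<in> sets predictable" and t: "0 \<le> t"
  shows "(\<integral>\<^sup>+\<omega>. slab_mass (\<rho> \<omega>) A t \<omega> \<partial>M) =
    (\<integral>\<^sup>+\<omega>. slab_mass lborel A t \<omega> \<partial>M)"
proof -
  note window = compensation_window[OF t A]
  have m: "(\<lambda>\<omega>. emeasure (\<rho> \<omega>) (points A \<omega> \<inter> {0<..t} \<times> {- b..b})) \<in> borel_measurable M" for b
    by (rule borel_measurable_subalgebra[OF _ _ conjunct1[OF window]]) (use sets_G space_G t in auto)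
  note \<rho>S = emeasure_slab_SUP[OF strip_sets points_sets[OF A]]
  note lS = emeasure_slab_SUP[of lborel, OF _ points_sets[OF A]]
  have "(\<integral>\<^sup>+\<omega>. slab_mass (\<rho> \<omega>) A t \<omega> \<partial>M) =
      (\<integral>\<^sup>+\<omega>. (SUP n::nat. emeasure (\<rho> \<omega>) (points A \<omega> \<inter> {0<..t} \<times> {- real n..real n})) \<partial>M)"
    by (intro nn_integral_cong \<rho>S)
  also have "\<dots> = (SUP n::nat. \<integral>\<^sup>+\<omega>. emeasure (\<rho> \<omega>) (points A \<omega> \<inter> {0<..t} \<times> {- real n..real n}) \<partial>M)"
    by (intro nn_integral_monotone_convergence_SUP_AE m AE_I2 incseq_SucD[OF \<rho>S(2)])
  also have "\<dots> = (SUP n::nat. \<integral>\<^sup>+\<omega>. emeasure lborel (points A \<omega> \<inter> {0<..t} \<times> {- real n..real n}) \<partial>M)"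
    using window by simp
  also have "\<dots> = (\<integral>\<^sup>+\<omega>. (SUP n::nat. emeasure lborel (points A \<omega> \<inter> {0<..t} \<times> {- real n..real n})) \<partial>M)"
    using window by (intro nn_integral_monotone_convergence_SUP_AE[symmetric] AE_I2 incseq_SucD[OF lS(2)]) auto
  also have "\<dots> = (\<integral>\<^sup>+\<omega>. slab_mass lborel A t \<omega> \<partial>M)"
    by (intro nn_integral_cong lS(1)[symmetric]) auto
  finally show ?thesis .
qed

end

lemma nonzero_sets:
  assumes [measurable]: "f \<in> borel_measurable N"
  shows "{x \<in> space N. f x \<noteq> (0 :: ennreal)} \<in> sets N"
  by measurable

text \<open>By Fubini, slice at a fixed time \<open>u\<close>: the slice is contained in the
  accepted set at age \<open>u - a\<close>, whose length is at most \<open>c\<close> for almost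
  every \<open>u\<close> after \<open>a\<close>. The exceptional times are null by
  \<open>lborel_AE_shift\<close>.\<close>

lemma (in jump_rates) emeasure_candidates_le:
  assumes i: "i \<in> states" and T: "T \<noteq> - \<infinity>" and A: "A \<in> sets borel"
  shows "emeasure lborel (candidates T i k \<inter> A \<times> UNIV) \<le> ennreal c * emeasure lborel (A \<inter> {u. T < ereal u})"
proof (cases T)
  case (real a)
  have "A \<times> (UNIV :: real set) \<in> sets borel"
    using A by (intro borel_Times) auto
  then have meas: "candidates T i k \<inter> A \<times> UNIV \<in> sets plane"
    using candidates_sets[OF i T, of k] by (metis borel_prod sets.Int)
  have A': "A \<inter> {u. T < ereal u} \<in> sets borel"
    using A real by (simp add: greaterThan_def[symmetric])
  have "emeasure lborel (candidates T i k \<inter> A \<times> UNIV) =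
      (\<integral>\<^sup>+u. emeasure lborel (Pair u -` (candidates T i k \<inter> A \<times> UNIV)) \<partial>lborel)"
    unfolding lborel_prod[symmetric] using meas
    by (intro lborel.emeasure_pair_measure_alt) (simp cong: sets_pair_measure_cong)
  also have "\<dots> \<le> (\<integral>\<^sup>+u. ennreal c * indicator (A \<inter> {u. T < ereal u}) u \<partial>lborel)"
  proof (rule nn_integral_mono_AE)
    have "AE u in lborel. 0 \<le> u - a \<longrightarrow> emeasure lborel (accept i (u - a) k) \<le> ennreal c"
      using emeasure_accept_le[OF i] by (rule lborel_AE_shift)
    then show "AE u in lborel. emeasure lborel (Pair u -` (candidates T i k \<inter> A \<times> UNIV))
      \<le> ennreal c * indicator (A \<inter> {u. T < ereal u}) u"
    proof eventually_elim
      case (elim u)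
      have "Pair u -` (candidates T i k \<inter> A \<times> UNIV) =
          (if 0 < u \<and> u \<in> A \<and> a < u then accept i (u - a) k else {})"
        using real by (auto simp: candidates_def)
      then show ?case using elim real by (auto simp: indicator_def)
    qed
  qed
  also have "\<dots> = ennreal c * emeasure lborel (A \<inter> {u. T < ereal u})"
    using A' by (simp add: nn_integral_cmult)
  finally show ?thesis .
qed (use T in \<open>auto simp: candidates_def\<close>)

section \<open>Adaptedness of the jump chain to the small filtration\<close>

locale driven_system = jump_rates R lam lam_up c + jump_noise M G \<rho>
  for R lam lam_up c M G \<rho> +
  fixes X0 :: "'a \<Rightarrow> nat" and Y0 :: "'a \<Rightarrow> real"
  assumes X0: "X0 \<in> measurable (G 0) (count_space UNIV)" "\<And>\<omega>. \<omega> \<in> space M \<Longrightarrow> X0 \<omega> \<in> states"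
    and Y0: "Y0 \<in> borel_measurable (G 0)" "\<And>\<omega>. \<omega> \<in> space M \<Longrightarrow> 0 \<le> Y0 \<omega>"
    and \<rho>_int: "\<And>\<omega> A. \<omega> \<in> space M \<Longrightarrow> A \<in> sets (\<rho> \<omega>) \<Longrightarrow> emeasure (\<rho> \<omega>) A \<in> range ennreal_of_enat"
    and \<rho>_simple: "AE \<omega> in M. \<forall>t>0. emeasure (\<rho> \<omega>) ({t} \<times> UNIV) \<le> 1"
begin

definition T :: "nat \<Rightarrow> 'a \<Rightarrow> ereal" where "T k \<omega> = jump_time (\<rho> \<omega>) (X0 \<omega>) (Y0 \<omega>) k"
definition S :: "nat \<Rightarrow> 'a \<Rightarrow> nat" where "S k \<omega> = jump_state (\<rho> \<omega>) (X0 \<omega>) (Y0 \<omega>) k"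

abbreviation "cand k \<omega> \<equiv> candidates (T k \<omega>) (S k \<omega>) k"
abbreviation "hit k \<omega> \<equiv> hits (\<rho> \<omega>) (T k \<omega>) (S k \<omega>) k (T (Suc k) \<omega>)"
abbreviation "accepted k \<equiv> {(p, \<omega>). (p, \<omega>) \<in> space predictable \<and> p \<in> cand k \<omega>}"

lemma T_Suc: "T (Suc k) \<omega> = next_time (\<rho> \<omega>) (T k \<omega>) (S k \<omega>) k"
  and S_Suc: "S (Suc k) \<omega> = next_state (\<rho> \<omega>) (T k \<omega>) (S k \<omega>) k (T (Suc k) \<omega>)"
  by (simp_all add: T_def S_def jump_time_Suc jump_state_Suc)

lemma S_states: "\<omega> \<in> space M \<Longrightarrow> S k \<omega> \<in> states"
  unfolding S_def using X0 by (intro jump_state_in_states)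

lemma T_Suc_ge: "T k \<omega> \<le> T (Suc k) \<omega>" "0 \<le> T (Suc k) \<omega>"
  by (simp_all add: T_Suc next_time_ge)

lemma T_mono: "k \<le> l \<Longrightarrow> T k \<omega> \<le> T l \<omega>"
  by (rule lift_Suc_mono_le[of "\<lambda>k. T k \<omega>"]) (simp_all add: T_Suc_ge)

lemma T_finite: "T k \<omega> \<noteq> - \<infinity>"
proof (cases k)
  case (Suc l)
  then show ?thesis using T_Suc_ge(2)[of l \<omega>] by auto
qed (simp add: T_def jump_time_0)

text \<open>Since \<open>G\<close> need not be right continuous, only strict inequalities between \<open>T k\<close> and constants give
  events of \<open>G\<close>.\<close>

definition adapted_stage :: "nat \<Rightarrow> bool" where
  "adapted_stage k \<longleftrightarrow> (\<forall>r j. {\<omega> \<in> space M. T k \<omega> < ereal r \<and> S k \<omega> = j} \<in> sets (G (max 0 r)))"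

text \<open>For \<open>u > 0\<close>, the inequality \<tau> < u holds exactly if some nonnegative
  rational lies strictly below \<open>u\<close> and strictly above \<tau>. The set is therefore a
  countable union of generating rectangles.\<close>

lemma after_time_predictable:
  assumes "\<And>q. 0 \<le> q \<Longrightarrow> {\<omega> \<in> space M. \<tau> \<omega> < ereal q \<and> P \<omega>} \<in> sets (G q)"
  shows "{(p, \<omega>). (p, \<omega>) \<in> space predictable \<and> \<tau> \<omega> < ereal (fst p) \<and> P \<omega>} \<in> sets predictable"
proof -
  have "\<exists>q\<in>\<rat> \<inter> {0..}. q < u \<and> \<tau> \<omega> < ereal q" if "0 < u" "\<tau> \<omega> < ereal u" for u \<omega>
  proof -
    from that have "max 0 (\<tau> \<omega>) < ereal u" by simp
    then obtain r where r: "max 0 (\<tau> \<omega>) < ereal r" "r < u"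
      using ereal_dense2[of "max 0 (\<tau> \<omega>)" "ereal u"] by auto
    then obtain q where "q \<in> \<rat>" "r < q" "q < u" using Rats_dense_in_real[of r u] by auto
    moreover have "\<tau> \<omega> < ereal q" "0 \<le> q"
      using r \<open>r < q\<close> less_trans[of "\<tau> \<omega>" "ereal r" "ereal q"] by simp_all
    ultimately show ?thesis by (intro bexI[of _ q]) auto
  qed
  moreover have "\<tau> \<omega> < ereal u" if "q < u" "\<tau> \<omega> < ereal q" for q u \<omega>
    using that less_trans[of "\<tau> \<omega>" "ereal q" "ereal u"] by simp
  ultimately have "{(p, \<omega>). (p, \<omega>) \<in> space predictable \<and> \<tau> \<omega> < ereal (fst p) \<and> P \<omega>} =
    (\<Union>q\<in>\<rat> \<inter> {0..}. ({q<..} \<times> UNIV) \<times> {\<omega> \<in> space M. \<tau> \<omega> < ereal q \<and> P \<omega>})"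
    by (auto simp: space_predictable; blast)
  also have "\<dots> \<in> sets predictable"
    using assms by (intro sets.countable_UN' countable_Int1 countable_rat) (auto intro!: predictable_generator)
  finally show ?thesis .
qed

context
  fixes k :: nat
  assumes stage: "adapted_stage k"
begin

text \<open>The additional bound \<open>r\<close> on \<open>T k\<close> allows the value of
  \<open>T k\<close> to be recovered as a measurable function after time \<open>T k\<close>.\<close>

lemma started_predictable:
  "{(p, \<omega>). (p, \<omega>) \<in> space predictable \<and> T k \<omega> < ereal (fst p) \<and> T k \<omega> < ereal r \<and> S k \<omega> = j} \<in> sets predictable"
proof (rule after_time_predictable)
  fix q :: real assume q: "0 \<le> q"
  have "{\<omega> \<in> space M. T k \<omega> < ereal (min q r) \<and> S k \<omega> = j} \<in> sets (G (max 0 (min q r)))"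
    using stage unfolding adapted_stage_def by blast
  moreover have "sets (G (max 0 (min q r))) \<subseteq> sets (G q)"
    using q by (intro G_mono) auto
  moreover have "{\<omega> \<in> space M. T k \<omega> < ereal (min q r) \<and> S k \<omega> = j} =
      {\<omega> \<in> space M. T k \<omega> < ereal q \<and> T k \<omega> < ereal r \<and> S k \<omega> = j}"
    by (auto simp: min_def less_le_trans)
  ultimately show "{\<omega> \<in> space M. T k \<omega> < ereal q \<and> T k \<omega> < ereal r \<and> S k \<omega> = j} \<in> sets (G q)"
    by auto
qed

lemma started_predictable':
  "{(p, \<omega>). (p, \<omega>) \<in> space predictable \<and> T k \<omega> < ereal (fst p) \<and> S k \<omega> = j} \<in> sets predictable"
proof -
  have "\<exists>n::nat. T k \<omega> < ereal (real n)" if "T k \<omega> < ereal u" for u \<omega>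
    using that reals_Archimedean2[of u] by (metis less_ereal.simps(1) less_trans)
  then have "{(p, \<omega>). (p, \<omega>) \<in> space predictable \<and> T k \<omega> < ereal (fst p) \<and> S k \<omega> = j} =
    (\<Union>n::nat. {(p, \<omega>). (p, \<omega>) \<in> space predictable \<and> T k \<omega> < ereal (fst p) \<and> T k \<omega> < ereal (real n) \<and> S k \<omega> = j})"
    by blast
  also have "\<dots> \<in> sets predictable"
    by (intro sets.countable_UN) (auto intro: started_predictable)
  finally show ?thesis .
qed

text \<open>Before \<open>T k\<close> has passed, its value is in general not yet known, so it is
  replaced by 0 there; afterwards it is determined by the past.\<close>

lemma origin_measurable:
  "(\<lambda>w. if T k (snd w) < ereal (fst (fst w)) then real_of_ereal (T k (snd w)) else 0) \<in> borel_measurable predictable"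
  unfolding borel_measurable_iff_less
proof
  fix r :: real
  let ?f = "\<lambda>w. if T k (snd w) < ereal (fst (fst w)) then real_of_ereal (T k (snd w)) else 0"
  let ?B = "\<lambda>j. {(p, \<omega>). (p, \<omega>) \<in> space predictable \<and> T k \<omega> < ereal (fst p) \<and> T k \<omega> < ereal r \<and> S k \<omega> = j}"
  let ?A = "\<lambda>j. {(p, \<omega>). (p, \<omega>) \<in> space predictable \<and> T k \<omega> < ereal (fst p) \<and> S k \<omega> = j}"
  have "real_of_ereal (T k \<omega>) < r \<longleftrightarrow> T k \<omega> < ereal r" if "T k \<omega> < ereal u" for \<omega> u
    using that T_finite[of k \<omega>] by (cases "T k \<omega>") auto
  \<comment> \<open>Points not later than \<open>T k\<close> have value 0 and belong to the sublevel
    set exactly if \<open>r\<close> is positive.\<close>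
  then have "{w \<in> space predictable. ?f w < r} =
    (\<Union>j. ?B j) \<union> (if 0 < r then space predictable - (\<Union>j. ?A j) else {})"
    by auto
  also have "\<dots> \<in> sets predictable"
  proof -
    have "(\<Union>j. ?A j) \<in> sets predictable" "(\<Union>j. ?B j) \<in> sets predictable"
      by (intro sets.countable_UN; auto intro: started_predictable started_predictable')+
    then show ?thesis by auto
  qed
  finally show "{w \<in> space predictable. ?f w < r} \<in> sets predictable" .
qed

lemma coordinates_measurable:
  "(\<lambda>w. fst (fst w)) \<in> borel_measurable predictable" "(\<lambda>w. snd (fst w)) \<in> borel_measurable predictable"
proof -
  have top: "space M \<in> sets (G s)" if "0 \<le> s" for s
    using sets.top[of "G s"] space_G[OF that] by simp
  show "(\<lambda>w. fst (fst w)) \<in> borel_measurable predictable"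
    unfolding borel_measurable_iff_greater
  proof
    fix r :: real
    have "{w \<in> space predictable. r < fst (fst w)} = ({max 0 r<..} \<times> UNIV) \<times> space M"
      by (auto simp: space_predictable)
    also have "\<dots> \<in> sets predictable"
      by (intro predictable_generator top) auto
    finally show "{w \<in> space predictable. r < fst (fst w)} \<in> sets predictable" .
  qed
  show "(\<lambda>w. snd (fst w)) \<in> borel_measurable predictable"
  proof (rule measurableI)
    fix B :: "real set" assume "B \<in> sets borel"
    then have "({0<..} \<times> B) \<times> space M \<in> sets predictable"
      by (intro predictable_generator top) auto
    also have "({0<..} \<times> B) \<times> space M = (\<lambda>w. snd (fst w)) -` B \<inter> space predictable"
      by (auto simp: space_predictable)
    finally show "(\<lambda>w. snd (fst w)) -` B \<inter> space predictable \<in> sets predictable" .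
  qed simp
qed

text \<open>The condition on age and mark depends on the random state, which is resolved by a
  countable union over its possible values.\<close>

lemma marked_predictable:
  assumes B: "\<And>j. j \<in> states \<Longrightarrow> B j \<in> sets plane"
  shows "{(p, \<omega>). (p, \<omega>) \<in> space predictable \<and> T k \<omega> < ereal (fst p) \<and>
    (fst p - real_of_ereal (T k \<omega>), snd p) \<in> B (S k \<omega>)} \<in> sets predictable" (is "?L \<in> _")
proof -
  let ?f = "\<lambda>w. if T k (snd w) < ereal (fst (fst w)) then real_of_ereal (T k (snd w)) else 0"
  let ?A = "\<lambda>j. {(p, \<omega>). (p, \<omega>) \<in> space predictable \<and> T k \<omega> < ereal (fst p) \<and> S k \<omega> = j}"
  have m: "(\<lambda>w. (fst (fst w) - ?f w, snd (fst w))) \<in> predictable \<rightarrow>\<^sub>M plane"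
    by (intro measurable_Pair borel_measurable_diff coordinates_measurable origin_measurable)
  have "(\<lambda>w. (fst (fst w) - ?f w, snd (fst w))) -` B j \<inter> space predictable \<inter> ?A j \<in> sets predictable"
    if "j \<in> states" for j
    using measurable_sets[OF m B[OF that]] started_predictable' by (rule sets.Int)
  then have "(\<Union>j\<in>states. (\<lambda>w. (fst (fst w) - ?f w, snd (fst w))) -` B j \<inter> space predictable \<inter> ?A j) \<in> sets predictable"
    by (intro sets.countable_UN') auto
  also have "(\<Union>j\<in>states. (\<lambda>w. (fst (fst w) - ?f w, snd (fst w))) -` B j \<inter> space predictable \<inter> ?A j) = ?L"
    using S_states by (auto simp: space_predictable)
  finally show ?thesis .
qed

lemma candidates_predictable:
  "accepted k \<in> sets predictable"
proof -
  have "0 \<le> u - real_of_ereal (T k \<omega>)" if "T k \<omega> < ereal u" for u \<omega>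
    using that T_finite[of k \<omega>] by (cases "T k \<omega>") auto
  then have "accepted k =
    {(p, \<omega>). (p, \<omega>) \<in> space predictable \<and> T k \<omega> < ereal (fst p) \<and>
      (fst p - real_of_ereal (T k \<omega>), snd p) \<in> {(y, v). 0 \<le> y \<and> v \<in> accept (S k \<omega>) y k}}"
    by (auto simp: candidates_def space_predictable)
  also have "\<dots> \<in> sets predictable"
    by (rule marked_predictable) (rule accept_sets)
  finally show ?thesis .
qed

lemma points_candidates:
  "\<omega> \<in> space M \<Longrightarrow> points (accepted k) \<omega> =
    cand k \<omega>"
  by (auto simp: space_predictable candidates_def)

text \<open>By \<open>next_time_less_iff\<close> the event says that the predictable set of accepted
  points has nonzero mass up to some rational \<open>q < r\<close>, and each of these events is
  known at time \<open>q\<close>.\<close>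

lemma next_time_adapted:
  "{\<omega> \<in> space M. T (Suc k) \<omega> < ereal r} \<in> sets (G (max 0 r))"
proof -
  let ?C = "accepted k"
  let ?H = "\<lambda>q. {\<omega> \<in> space (G q). slab_mass (\<rho> \<omega>) ?C q \<omega> \<noteq> 0}"
  have "?H q \<in> sets (G (max 0 r))" if "0 < q" "q < r" for q
  proof -
    have "(\<lambda>\<omega>. slab_mass (\<rho> \<omega>) ?C q \<omega>) \<in> borel_measurable (G q)"
      using that by (intro predictable_count_measurable candidates_predictable) auto
    then have "?H q \<in> sets (G q)" by (rule nonzero_sets)
    moreover have "sets (G q) \<subseteq> sets (G (max 0 r))" using that by (intro G_mono) auto
    ultimately show ?thesis by (rule subsetD[rotated])
  qed
  then have "(\<Union>q\<in>{q\<in>\<rat>. 0 < q \<and> q < r}. ?H q) \<in> sets (G (max 0 r))"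
    by (intro sets.countable_UN' countable_subset[OF _ countable_rat]) auto
  also have "(\<Union>q\<in>{q\<in>\<rat>. 0 < q \<and> q < r}. ?H q) = {\<omega> \<in> space M. T (Suc k) \<omega> < ereal r}"
  proof -
    have "(\<exists>q\<in>\<rat>. 0 < q \<and> q < r \<and> slab_mass (\<rho> \<omega>) ?C q \<omega> \<noteq> 0) \<longleftrightarrow>
        T (Suc k) \<omega> < ereal r" if \<omega>: "\<omega> \<in> space M" for \<omega>
      unfolding points_candidates[OF \<omega>] T_Suc
      using next_time_less_iff[OF S_states[OF \<omega>] T_finite sets_\<rho>[OF \<omega>]] by simp
    then show ?thesis by (auto simp: space_G)
  qed
  finally show ?thesis .
qed

text \<open>The random interval is closed at \<open>T (Suc k)\<close>, so the jump point itself
  belongs to this predictable set.\<close>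

lemma not_after_next_predictable:
  "{(p, \<omega>). (p, \<omega>) \<in> space predictable \<and> ereal (fst p) \<le> T (Suc k) \<omega>} \<in> sets predictable"
proof -
  have "{\<omega> \<in> space M. T (Suc k) \<omega> < ereal q \<and> True} \<in> sets (G q)" if "0 \<le> q" for q
    using next_time_adapted[of q] that by simp
  then have "{(p, \<omega>). (p, \<omega>) \<in> space predictable \<and> T (Suc k) \<omega> < ereal (fst p) \<and> True} \<in> sets predictable"
    by (rule after_time_predictable)
  then have "space predictable - {(p, \<omega>). (p, \<omega>) \<in> space predictable \<and> T (Suc k) \<omega> < ereal (fst p) \<and> True} \<in> sets predictable"
    by (rule sets.compl_sets)
  also have "space predictable - {(p, \<omega>). (p, \<omega>) \<in> space predictable \<and> T (Suc k) \<omega> < ereal (fst p) \<and> True} =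
    {(p, \<omega>). (p, \<omega>) \<in> space predictable \<and> ereal (fst p) \<le> T (Suc k) \<omega>}"
    by (auto simp: not_less)
  finally show ?thesis .
qed

text \<open>Accepted points before \<open>T (Suc k)\<close> have total mass 0. So if one counts
  points up to and including \<open>T (Suc k)\<close> whose marks select the state \<open>i\<close>,
  the count can be nonzero only through the line at the jump time, and it then detects both that the
  jump has occurred and that it hits \<open>i\<close>.\<close>

lemma hits_adapted:
  "{\<omega> \<in> space M. T (Suc k) \<omega> < ereal r \<and> hit k \<omega> i} \<in> sets (G (max 0 r))"
proof -
  let ?B = "\<lambda>j. {(y, v). 0 \<le> y \<and> i \<in> states - {j} \<and> v \<in> \<Lambda> j i y k}"
  define D where "D = {(p, \<omega>). (p, \<omega>) \<in> space predictable \<and> T k \<omega> < ereal (fst p) \<and>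
      (fst p - real_of_ereal (T k \<omega>), snd p) \<in> ?B (S k \<omega>)} \<inter>
    {(p, \<omega>). (p, \<omega>) \<in> space predictable \<and> ereal (fst p) \<le> T (Suc k) \<omega>}"
  have B: "?B j \<in> sets plane" if "j \<in> states" for j
  proof (cases "i \<in> states - {j}")
    case True
    then show ?thesis using jump_interval_sets[of j i k] that by (simp add: state_pairs_def)
  next
    case False
    then have "?B j = {}" by auto
    then show ?thesis by (simp only: sets.empty_sets)
  qed
  have D: "D \<in> sets predictable"
    unfolding D_def by (intro sets.Int marked_predictable not_after_next_predictable B)
  let ?H = "\<lambda>q. {\<omega> \<in> space (G q). slab_mass (\<rho> \<omega>) D q \<omega> \<noteq> 0}"
  have "?H q \<in> sets (G (max 0 r))" if "0 < q" "q < r" for q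
  proof -
    have "(\<lambda>\<omega>. slab_mass (\<rho> \<omega>) D q \<omega>) \<in> borel_measurable (G q)"
      using that by (intro predictable_count_measurable D) auto
    then have "?H q \<in> sets (G q)" by (rule nonzero_sets)
    moreover have "sets (G q) \<subseteq> sets (G (max 0 r))" using that by (intro G_mono) auto
    ultimately show ?thesis by (rule subsetD[rotated])
  qed
  then have "(\<Union>q\<in>{q\<in>\<rat>. 0 < q \<and> q < r}. ?H q) \<in> sets (G (max 0 r))"
    by (intro sets.countable_UN' countable_subset[OF _ countable_rat]) auto
  also have "(\<Union>q\<in>{q\<in>\<rat>. 0 < q \<and> q < r}. ?H q) =
    {\<omega> \<in> space M. T (Suc k) \<omega> < ereal r \<and> hit k \<omega> i}"
  proof -
    have "(\<exists>q\<in>\<rat>. 0 < q \<and> q < r \<and> slab_mass (\<rho> \<omega>) D q \<omega> \<noteq> 0) \<longleftrightarrow>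
      T (Suc k) \<omega> < ereal r \<and> hit k \<omega> i"
      if \<omega>: "\<omega> \<in> space M" for \<omega>
    proof -
      let ?a = "real_of_ereal (T k \<omega>)"
      have Dsets: "points D \<omega> \<inter> {0<..q} \<times> UNIV \<in> sets (\<rho> \<omega>)" for q
        using points_subset[OF D]
        by (intro strip_sets[OF \<omega>] sets.Int points_sets[OF D] borel_Times) auto
      have line: "{t} \<times> \<Lambda> (S k \<omega>) i y k \<in> sets (\<rho> \<omega>)" if "0 < t" for t y
        using that by (intro strip_sets[OF \<omega>] borel_Times jump_interval_borel) auto
      show ?thesis
      proof (intro iffI conjI)
        assume "\<exists>q\<in>\<rat>. 0 < q \<and> q < r \<and> slab_mass (\<rho> \<omega>) D q \<omega> \<noteq> 0"
        then obtain q where q: "0 < q" "q < r" "slab_mass (\<rho> \<omega>) D q \<omega> \<noteq> 0"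
          by blast
        let ?N = "cand k \<omega> \<inter> {u. ereal u < T (Suc k) \<omega>} \<times> UNIV"
        have N: "?N \<in> null_sets (\<rho> \<omega>)"
          using emeasure_candidates_before[OF S_states[OF \<omega>, of k] T_finite[of k \<omega>] sets_\<rho>[OF \<omega>], of k]
          by (intro null_setsI candidates_slab_sets S_states[OF \<omega>] T_finite sets_\<rho>[OF \<omega>] ereal_less_sets)
            (simp_all add: T_Suc)
        \<comment> \<open>The null set \<open>?N\<close> cannot contain a set of nonzero mass. A
          point of \<open>D\<close> outside it is not before \<open>T (Suc k)\<close>, and as a
          point of \<open>D\<close> not after it.\<close>
        have "\<not> points D \<omega> \<inter> {0<..q} \<times> UNIV \<subseteq> ?N"
          using q(3) emeasure_eq_0[of ?N "\<rho> \<omega>"] N by (auto simp: null_sets_def)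
        then obtain u v where uv: "((u, v), \<omega>) \<in> D" "0 < u" "u \<le> q" "(u, v) \<notin> ?N"
          unfolding subset_iff by (clarsimp simp del: Int_iff)
        then have "(u, v) \<in> cand k \<omega>"
          by (auto simp: D_def candidates_def accept_def)
        with uv have T': "T (Suc k) \<omega> = ereal u" by (auto simp: D_def)
        show "T (Suc k) \<omega> < ereal r" using T' uv q by simp
        have "points D \<omega> \<inter> {0<..q} \<times> UNIV \<subseteq> {u} \<times> \<Lambda> (S k \<omega>) i (u - ?a) k \<union> ?N"
        proof (rule subsetI)
          fix p assume "p \<in> points D \<omega> \<inter> {0<..q} \<times> UNIV"
          then show "p \<in> {u} \<times> \<Lambda> (S k \<omega>) i (u - ?a) k \<union> ?N"
            using T' by (cases "fst p = u") (auto simp: D_def candidates_def accept_def)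
        qed
        then have "slab_mass (\<rho> \<omega>) D q \<omega> \<le>
            emeasure (\<rho> \<omega>) ({u} \<times> \<Lambda> (S k \<omega>) i (u - ?a) k \<union> ?N)"
          using N line[OF uv(2)] by (intro emeasure_mono) auto
        also have "\<dots> = emeasure (\<rho> \<omega>) ({u} \<times> \<Lambda> (S k \<omega>) i (u - ?a) k)"
          using N line[OF uv(2)] by (intro emeasure_Un_null_set) auto
        finally show "hit k \<omega> i"
          using q(3) uv T' by (auto simp: D_def hits_def)
      next
        assume *: "T (Suc k) \<omega> < ereal r \<and> hit k \<omega> i"
        then obtain t where t: "T (Suc k) \<omega> = ereal t" "0 < t" "t < r" "T k \<omega> < ereal t"
          by (cases "T (Suc k) \<omega>") (auto simp: hits_def)
        obtain q where q: "q \<in> \<rat>" "t < q" "q < r" using Rats_dense_in_real[OF t(3)] by auto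
        have "0 \<le> t - ?a" using t(4) T_finite[of k \<omega>] by (cases "T k \<omega>") auto
        then have "{t} \<times> \<Lambda> (S k \<omega>) i (t - ?a) k \<subseteq> points D \<omega> \<inter> {0<..q} \<times> UNIV"
          using * t q \<omega> by (auto simp: D_def space_predictable hits_def)
        then have "emeasure (\<rho> \<omega>) ({t} \<times> \<Lambda> (S k \<omega>) i (t - ?a) k) \<le> slab_mass (\<rho> \<omega>) D q \<omega>"
          by (rule emeasure_mono[OF _ Dsets])
        moreover have "emeasure (\<rho> \<omega>) ({t} \<times> \<Lambda> (S k \<omega>) i (t - ?a) k) \<noteq> 0"
          using * t by (simp add: hits_def)
        ultimately show "\<exists>q\<in>\<rat>. 0 < q \<and> q < r \<and> slab_mass (\<rho> \<omega>) D q \<omega> \<noteq> 0"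
          using q t by (intro bexI[of _ q]) auto
      qed
    qed
    then show ?thesis by (auto simp: space_G)
  qed
  finally show ?thesis .
qed

lemma adapted_stage_Suc: "adapted_stage (Suc k)"
  unfolding adapted_stage_def
proof (intro allI)
  fix r j
  let ?h = "\<lambda>\<omega> i. hit k \<omega> i"
  let ?N = "G (max 0 r)"
  let ?T = "{\<omega> \<in> space M. T (Suc k) \<omega> < ereal r}"
  let ?H = "\<lambda>i. {\<omega> \<in> space M. T (Suc k) \<omega> < ereal r \<and> ?h \<omega> i}"
  have H: "?H i \<in> sets ?N" for i by (rule hits_adapted)
  have T: "?T \<in> sets ?N" by (rule next_time_adapted)
  \<comment> \<open>Unfolding \<open>LEAST\<close> and its default makes the event for the new state
    a countable combination of hit events.\<close>
  have "next_state (\<rho> \<omega>) (T k \<omega>) (S k \<omega>) k (T (Suc k) \<omega>) = j \<longleftrightarrow>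
      ?h \<omega> j \<and> (\<forall>i<j. \<not> ?h \<omega> i) \<or> j = 1 \<and> (\<forall>i. \<not> ?h \<omega> i)" for \<omega>
  proof (cases "\<exists>i. ?h \<omega> i")
    case True
    then have "next_state (\<rho> \<omega>) (T k \<omega>) (S k \<omega>) k (T (Suc k) \<omega>) = (LEAST i. ?h \<omega> i)" "?h \<omega> (LEAST i. ?h \<omega> i)"
      by (auto simp: next_state_def intro: LeastI_ex)
    moreover have "(LEAST i. ?h \<omega> i) = j" if "?h \<omega> j" "\<forall>i<j. \<not> ?h \<omega> i"
      using that by (intro Least_equality) (auto simp: not_less[symmetric])
    ultimately show ?thesis using True not_less_Least[of _ "?h \<omega>"] by metis
  next
    case False
    then have "next_state (\<rho> \<omega>) (T k \<omega>) (S k \<omega>) k (T (Suc k) \<omega>) = 1"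
      by (simp add: next_state_def)
    with False show ?thesis by auto
  qed
  then have "{\<omega> \<in> space M. T (Suc k) \<omega> < ereal r \<and> S (Suc k) \<omega> = j} =
      (?H j - (\<Union>i\<in>{..<j}. ?H i)) \<union> (if j = 1 then ?T - (\<Union>i. ?H i) else {})"
    by (auto simp: S_Suc)
  also have "\<dots> \<in> sets ?N"
  proof -
    have "(\<Union>i. ?H i) \<in> sets ?N" by (intro sets.countable_UN) (auto intro: H)
    moreover have "(\<Union>i\<in>{..<j}. ?H i) \<in> sets ?N" by (intro sets.finite_UN) (auto intro: H)
    ultimately have "?H j - (\<Union>i\<in>{..<j}. ?H i) \<in> sets ?N" "?T - (\<Union>i. ?H i) \<in> sets ?N"
      using H T by (auto intro: sets.Diff)
    then show ?thesis by (simp only: sets.Un sets.empty_sets split: if_split) simp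
  qed
  finally show "{\<omega> \<in> space M. T (Suc k) \<omega> < ereal r \<and> S (Suc k) \<omega> = j} \<in> sets ?N" .
qed

end

lemma adapted_stage_0: "adapted_stage 0"
  unfolding adapted_stage_def
proof (intro allI)
  fix r j
  have "{\<omega> \<in> space (G 0). - Y0 \<omega> < r \<and> X0 \<omega> = j} \<in> sets (G 0)"
    using X0(1) Y0(1) by measurable
  moreover have "sets (G 0) \<subseteq> sets (G (max 0 r))" by (rule G_mono) auto
  ultimately show "{\<omega> \<in> space M. T 0 \<omega> < ereal r \<and> S 0 \<omega> = j} \<in> sets (G (max 0 r))"
    by (auto simp: T_def S_def jump_time_0 jump_state_0 space_G)
qed

lemma adapted_stage: "adapted_stage k"
  by (induction k) (auto intro: adapted_stage_0 adapted_stage_Suc)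

end

section \<open>Almost surely finitely many candidates and jumps in bounded time\<close>

context driven_system
begin

lemma count_measurable_M:
  assumes "A \<in> sets predictable" "0 \<le> t"
  shows "(\<lambda>\<omega>. slab_mass (\<rho> \<omega>) A t \<omega>) \<in> borel_measurable M"
  by (rule borel_measurable_subalgebra[OF _ _ predictable_count_measurable[OF assms]])
    (use sets_G space_G assms in auto)

text \<open>The compensation formula bounds the expected number of candidates up to time
  \<open>n\<close> by \<open>c * n\<close>, so this number is almost surely finite. Countably many
  \<open>k\<close> and \<open>n\<close> share one null set, and other times follow by
  monotonicity.\<close>

lemma AE_candidates_finite:
  "AE \<omega> in M. \<forall>k. \<forall>t\<ge>0. emeasure (\<rho> \<omega>) (cand k \<omega> \<inter> {0<..t} \<times> UNIV) < \<infinity>"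
proof -
  have "AE \<omega> in M. emeasure (\<rho> \<omega>) (cand k \<omega> \<inter> {0<..real n} \<times> UNIV) \<noteq> \<infinity>"
    for k and n :: nat
  proof -
    define C where "C = accepted k"
    have C: "C \<in> sets predictable"
      unfolding C_def by (rule candidates_predictable[OF adapted_stage])
    have pts: "points C \<omega> = cand k \<omega>" if "\<omega> \<in> space M" for \<omega>
      unfolding C_def by (rule points_candidates[OF adapted_stage that])
    have "(\<integral>\<^sup>+\<omega>. slab_mass (\<rho> \<omega>) C (real n) \<omega> \<partial>M) =
        (\<integral>\<^sup>+\<omega>. slab_mass lborel C (real n) \<omega> \<partial>M)"
      by (rule compensation[OF C]) simp
    also have "\<dots> \<le> (\<integral>\<^sup>+\<omega>. ennreal c * ennreal n \<partial>M)"
    proof (rule nn_integral_mono)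
      fix \<omega> assume \<omega>: "\<omega> \<in> space M"
      have "slab_mass lborel C (real n) \<omega> \<le>
          ennreal c * emeasure lborel ({0<..real n} \<inter> {u. T k \<omega> < ereal u})"
        unfolding pts[OF \<omega>] by (intro emeasure_candidates_le S_states[OF \<omega>] T_finite) simp
      also have "\<dots> \<le> ennreal c * emeasure lborel {0<..real n}"
        by (intro mult_left_mono emeasure_mono) auto
      finally show "slab_mass lborel C (real n) \<omega> \<le> ennreal c * ennreal n"
        by simp
    qed
    also have "\<dots> < \<infinity>"
      by (simp add: emeasure_space_1 ennreal_mult_less_top)
    finally have "AE \<omega> in M. slab_mass (\<rho> \<omega>) C (real n) \<omega> \<noteq> \<infinity>"
      by (intro nn_integral_PInf_AE count_measurable_M C) auto
    then show ?thesis
      by (rule AE_mp) (auto simp: pts)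
  qed
  then have "AE \<omega> in M. \<forall>k n. emeasure (\<rho> \<omega>) (cand k \<omega> \<inter> {0<..real n} \<times> UNIV) \<noteq> \<infinity>"
    by (simp add: AE_all_countable)
  then show ?thesis
    using AE_space
  proof eventually_elim
    case (elim \<omega>)
    show ?case
    proof (intro allI impI)
      fix k and t :: real assume "0 \<le> t"
      obtain n :: nat where n: "t \<le> real n" using real_arch_simple by blast
      have "emeasure (\<rho> \<omega>) (cand k \<omega> \<inter> {0<..t} \<times> UNIV) \<le>
          emeasure (\<rho> \<omega>) (cand k \<omega> \<inter> {0<..real n} \<times> UNIV)"
        using n elim(2) by (intro emeasure_mono candidates_slab_sets S_states T_finite sets_\<rho>) auto
      also have "\<dots> < \<infinity>" using elim(1) by (simp add: top.not_eq_extremum)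
      finally show "emeasure (\<rho> \<omega>) (cand k \<omega> \<inter> {0<..t} \<times> UNIV) < \<infinity>" .
    qed
  qed
qed

text \<open>Between the \<open>k\<close>-th and the next jump the expected number of accepted points is at most \<open>c\<close> times
  the expected time spent there; summed over \<open>k\<close> this bounds the expected number of jumps up to time
  \<open>t\<close> by \<open>c * t\<close>.\<close>

lemma AE_no_explosion: "AE \<omega> in M. \<forall>t. \<exists>k. ereal t < T k \<omega>"
proof -
  \<comment> \<open>Accepted points in the random interval \<open>(T k, T (Suc k)]\<close>; the
    right end is included so that the jump itself is counted.\<close>
  define B where "B k = accepted k \<inter>
    {(p, \<omega>). (p, \<omega>) \<in> space predictable \<and> ereal (fst p) \<le> T (Suc k) \<omega>}" for k
  have B: "B k \<in> sets predictable" for k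
    unfolding B_def
    by (intro sets.Int candidates_predictable not_after_next_predictable adapted_stage)
  have pts: "points (B k) \<omega> \<inter> {0<..t} \<times> UNIV =
      cand k \<omega> \<inter> ({0<..t} \<inter> {u. ereal u \<le> T (Suc k) \<omega>}) \<times> UNIV"
    if "\<omega> \<in> space M" for k \<omega> t
    using that by (auto simp: B_def space_predictable candidates_def)
  have meas: "{u. ereal u \<le> e} \<in> sets borel" for e
  proof -
    have "{u \<in> space borel. ereal u \<le> e} \<in> sets borel" by measurable
    then show ?thesis by simp
  qed
  have "AE \<omega> in M. (\<Sum>k. slab_mass (\<rho> \<omega>) (B k) (real n) \<omega>) \<noteq> \<infinity>" for n :: nat
  proof -
    have "(\<integral>\<^sup>+\<omega>. (\<Sum>k. slab_mass (\<rho> \<omega>) (B k) (real n) \<omega>) \<partial>M) =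
        (\<Sum>k. \<integral>\<^sup>+\<omega>. slab_mass (\<rho> \<omega>) (B k) (real n) \<omega> \<partial>M)"
      by (intro nn_integral_suminf count_measurable_M B) simp
    also have "\<dots> = (\<Sum>k. \<integral>\<^sup>+\<omega>. slab_mass lborel (B k) (real n) \<omega> \<partial>M)"
      by (simp only: compensation[OF B of_nat_0_le_iff])
    also have "\<dots> = (\<integral>\<^sup>+\<omega>. (\<Sum>k. slab_mass lborel (B k) (real n) \<omega>) \<partial>M)"
      by (intro nn_integral_suminf[symmetric] predictable_lborel_measurable B) simp
    also have "\<dots> \<le> (\<integral>\<^sup>+\<omega>. ennreal c * ennreal n \<partial>M)"
    proof (rule nn_integral_mono)
      fix \<omega> assume \<omega>: "\<omega> \<in> space M"
      \<comment> \<open>These parts of \<open>(0, n]\<close> are pairwise disjoint for different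
        \<open>k\<close>, so their lengths add up to at most \<open>n\<close>; no factor depending
        on the number of jumps appears.\<close>
      let ?D = "\<lambda>k. {0<..real n} \<inter> {u. ereal u \<le> T (Suc k) \<omega>} \<inter> {u. T k \<omega> < ereal u}"
      have gt: "{u. T k \<omega> < ereal u} \<in> sets borel" for k
      proof -
        have "- {u. ereal u \<le> T k \<omega>} \<in> sets borel"
          using meas by (intro borel_comp)
        also have "- {u. ereal u \<le> T k \<omega>} = {u. T k \<omega> < ereal u}" by auto
        finally show ?thesis .
      qed
      have le: "slab_mass lborel (B k) (real n) \<omega> \<le> ennreal c * emeasure lborel (?D k)" for k
        unfolding pts[OF \<omega>]
        by (intro emeasure_candidates_le S_states[OF \<omega>] T_finite sets.Int meas) simp
      have disj: "disjoint_family ?D"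
      proof -
        have "?D k \<inter> ?D l = {}" if "k < l" for k l
        proof -
          have "T (Suc k) \<omega> \<le> T l \<omega>" using that by (intro T_mono) simp
          then have "\<not> T l \<omega> < ereal u" if "ereal u \<le> T (Suc k) \<omega>" for u
            using that by (simp add: not_less)
          then show ?thesis by blast
        qed
        then show ?thesis
          unfolding disjoint_family_on_def by (metis Int_commute linorder_neqE_nat)
      qed
      have D: "?D k \<in> sets lborel" for k
        using gt meas by (simp add: sets.Int)
      have "(\<Sum>k. slab_mass lborel (B k) (real n) \<omega>) \<le>
          (\<Sum>k. ennreal c * emeasure lborel (?D k))"
        by (rule suminf_le[OF le summableI summableI])
      also have "\<dots> = ennreal c * (\<Sum>k. emeasure lborel (?D k))"
        by (rule ennreal_suminf_cmult)
      also have "(\<Sum>k. emeasure lborel (?D k)) = emeasure lborel (\<Union>k. ?D k)"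
        by (rule suminf_emeasure[OF _ disj]) (use D in blast)
      also have "ennreal c * \<dots> \<le> ennreal c * emeasure lborel {0<..real n}"
        by (intro mult_left_mono emeasure_mono) auto
      finally show "(\<Sum>k. slab_mass lborel (B k) (real n) \<omega>) \<le> ennreal c * ennreal n"
        by simp
    qed
    also have "\<dots> < \<infinity>"
      by (simp add: emeasure_space_1 ennreal_mult_less_top)
    finally show ?thesis
      by (intro nn_integral_PInf_AE borel_measurable_suminf_order count_measurable_M B) auto
  qed
  then have "AE \<omega> in M. \<forall>n::nat. (\<Sum>k. slab_mass (\<rho> \<omega>) (B k) (real n) \<omega>) \<noteq> \<infinity>"
    by (simp add: AE_all_countable)
  with AE_candidates_finite show ?thesis
    using AE_space
  proof eventually_elim
    case (elim \<omega>)
    note \<omega> = elim(3)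
    show ?case
    proof (rule ccontr)
      assume "\<not> (\<forall>t. \<exists>k. ereal t < T k \<omega>)"
      then obtain t where t: "T k \<omega> \<le> ereal t" for k by (auto simp: not_less)
      obtain n :: nat where n: "t \<le> real n" using real_arch_simple by blast
      \<comment> \<open>If all jump times stay below \<open>t\<close>, each is attained by an
        accepted point, so every \<open>B k\<close> contributes at least 1 and the sum
        diverges.\<close>
      have one: "1 \<le> slab_mass (\<rho> \<omega>) (B k) (real n) \<omega>" for k
      proof -
        obtain u where u: "T (Suc k) \<omega> = ereal u" "u \<le> t"
          using t[of "Suc k"] T_finite[of "Suc k" \<omega>] by (cases "T (Suc k) \<omega>") auto
        let ?C = "cand k \<omega> \<inter> {u} \<times> UNIV"
        have sets: "?C \<in> sets (\<rho> \<omega>)" "points (B k) \<omega> \<inter> {0<..real n} \<times> UNIV \<in> sets (\<rho> \<omega>)"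
          unfolding pts[OF \<omega>]
          by (intro candidates_slab_sets S_states[OF \<omega>] T_finite sets_\<rho>[OF \<omega>] sets.Int meas; simp)+
        have "emeasure (\<rho> \<omega>) ?C \<noteq> 0"
          using emeasure_candidates_at[OF S_states[OF \<omega>, of k] T_finite[of k \<omega>] sets_\<rho>[OF \<omega>] \<rho>_int[OF \<omega>], of k u]
            elim(1) u T_Suc[of k \<omega>] by simp
        then have "1 \<le> emeasure (\<rho> \<omega>) ?C"
          using \<rho>_int[OF \<omega> sets(1)] by (intro ennreal_of_enat_range_ge_1)
        also have "?C \<subseteq> points (B k) \<omega> \<inter> {0<..real n} \<times> UNIV"
          unfolding pts[OF \<omega>] using u n by (auto simp: candidates_def)
        then have "emeasure (\<rho> \<omega>) ?C \<le> slab_mass (\<rho> \<omega>) (B k) (real n) \<omega>"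
          using sets(2) by (rule emeasure_mono)
        finally show ?thesis .
      qed
      have "of_nat K \<le> (\<Sum>k. slab_mass (\<rho> \<omega>) (B k) (real n) \<omega>)" for K
      proof -
        have "of_nat K = (\<Sum>k<K. 1 :: ennreal)" by simp
        also have "\<dots> \<le> (\<Sum>k<K. slab_mass (\<rho> \<omega>) (B k) (real n) \<omega>)"
          using one by (rule sum_mono)
        also have "\<dots> \<le> (\<Sum>k. slab_mass (\<rho> \<omega>) (B k) (real n) \<omega>)"
          by (intro sum_le_suminf) auto
        finally show ?thesis .
      qed
      moreover obtain K where "(\<Sum>k. slab_mass (\<rho> \<omega>) (B k) (real n) \<omega>) < of_nat K"
        using elim(2) ennreal_Ex_less_of_nat by (metis infinity_ennreal_def top.not_eq_extremum)
      ultimately show False by (simp add: not_less[symmetric])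
    qed
  qed
qed

definition X :: "real \<Rightarrow> 'a \<Rightarrow> nat" where "X t \<omega> = state_at (\<rho> \<omega>) (X0 \<omega>) (Y0 \<omega>) t"
definition Y :: "real \<Rightarrow> 'a \<Rightarrow> real" where "Y t \<omega> = age_at (\<rho> \<omega>) (X0 \<omega>) (Y0 \<omega>) t"
definition N :: "real \<Rightarrow> 'a \<Rightarrow> nat" where "N t \<omega> = jump_count (\<rho> \<omega>) (X0 \<omega>) (Y0 \<omega>) t"

lemma AE_solution:
  "AE \<omega> in M. cadlag (\<lambda>t. X t \<omega>) \<and> cadlag (\<lambda>t. Y t \<omega>) \<and> cadlag (\<lambda>t. N t \<omega>) \<and>
    solves_system R lam lam_up (\<rho> \<omega>) (X0 \<omega>) (Y0 \<omega>) (\<lambda>t. X t \<omega>) (\<lambda>t. Y t \<omega>) (\<lambda>t. N t \<omega>)"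
  using AE_no_explosion AE_candidates_finite \<rho>_simple AE_space
proof eventually_elim
  case (elim \<omega>)
  interpret path: jump_path R lam lam_up c "\<rho> \<omega>" "X0 \<omega>" "Y0 \<omega>"
    by unfold_locales
      (use elim X0(2) Y0(2) sets_\<rho> \<rho>_int in \<open>auto simp: T_def S_def\<close>)
  show ?case
    unfolding X_def Y_def N_def
    using path.cadlag_X path.cadlag_Y path.cadlag_N path.solves by simp
qed

lemma X_states: "\<omega> \<in> space M \<Longrightarrow> X t \<omega> \<in> states"
  unfolding X_def state_at_def using X0(2) by (intro jump_state_in_states)

lemma Y_nonneg: "0 \<le> Y t \<omega>"
  by (simp add: Y_def age_at_def)

section \<open>Adaptedness of the constructed processes to a larger right continuous
  filtration\<close>

context
  fixes F :: "real \<Rightarrow> 'a measure" and t :: real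
  assumes F_space: "\<And>t. 0 \<le> t \<Longrightarrow> space (F t) = space M"
    and G_le_F: "\<And>t. 0 \<le> t \<Longrightarrow> sets (G t) \<subseteq> sets (F t)"
    and F_right: "\<And>t. 0 \<le> t \<Longrightarrow> sets (F t) = (\<Inter>s\<in>{t<..}. sets (F s))"
    and t: "0 \<le> t"
begin

text \<open>The event is the intersection of its versions with
  \<open>T k < t + (s - t) / (n + 1)\<close>, all of which are known at time \<open>s\<close>. This
  works for every \<open>s > t\<close>, and right continuity of \<open>F\<close> brings it down to
  time \<open>t\<close>.\<close>

lemma stopped_adapted:
  assumes P: "\<And>r. {\<omega> \<in> space M. T k \<omega> < ereal r \<and> P \<omega>} \<in> sets (G (max 0 r))"
  shows "{\<omega> \<in> space M. T k \<omega> \<le> ereal t \<and> P \<omega>} \<in> sets (F t)"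
  unfolding F_right[OF t]
proof (rule INT_I)
  fix s assume "s \<in> {t<..}"
  then have s: "t < s" by simp
  let ?r = "\<lambda>n. t + (s - t) / real (Suc n)"
  have "{\<omega> \<in> space M. T k \<omega> < ereal (?r n) \<and> P \<omega>} \<in> sets (F s)" for n
  proof -
    have "(s - t) / real (Suc n) \<le> s - t"
      using s by (simp add: divide_le_eq)
    then have "sets (G (max 0 (?r n))) \<subseteq> sets (G s)"
      using s t by (intro G_mono) auto
    with P[of "?r n"] G_le_F[of s] s t show ?thesis by auto
  qed
  then have "(\<Inter>n. {\<omega> \<in> space M. T k \<omega> < ereal (?r n) \<and> P \<omega>}) \<in> sets (F s)"
    by (intro sets.countable_INT) auto
  also have "(\<Inter>n. {\<omega> \<in> space M. T k \<omega> < ereal (?r n) \<and> P \<omega>}) = {\<omega> \<in> space M. T k \<omega> \<le> ereal t \<and> P \<omega>}"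
  proof -
    have "T k \<omega> \<le> ereal t \<longleftrightarrow> (\<forall>n. T k \<omega> < ereal (?r n))" for \<omega>
    proof
      assume le: "T k \<omega> \<le> ereal t"
      show "\<forall>n. T k \<omega> < ereal (?r n)"
      proof
        fix n
        have "ereal t < ereal (?r n)" using s by simp
        with le show "T k \<omega> < ereal (?r n)" by (rule le_less_trans)
      qed
    next
      assume lt: "\<forall>n. T k \<omega> < ereal (?r n)"
      have "(\<lambda>n. t + (s - t) * (1 / real (Suc n))) \<longlonglongrightarrow> t + (s - t) * 0"
        by (intro tendsto_intros LIMSEQ_Suc lim_1_over_n)
      then have "(\<lambda>n. ereal (?r n)) \<longlonglongrightarrow> ereal t" by simp
      then show "T k \<omega> \<le> ereal t"
        by (rule LIMSEQ_le_const) (use lt in \<open>auto intro: less_imp_le\<close>)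
    qed
    then show ?thesis by blast
  qed
  finally show "{\<omega> \<in> space M. T k \<omega> \<le> ereal t \<and> P \<omega>} \<in> sets (F s)" .
qed

lemma T_less_adapted: "{\<omega> \<in> space M. T k \<omega> < ereal r} \<in> sets (G (max 0 r))"
proof -
  have "(\<Union>j. {\<omega> \<in> space M. T k \<omega> < ereal r \<and> S k \<omega> = j}) \<in> sets (G (max 0 r))"
    using adapted_stage[of k] by (intro sets.countable_UN) (auto simp: adapted_stage_def)
  also have "(\<Union>j. {\<omega> \<in> space M. T k \<omega> < ereal r \<and> S k \<omega> = j}) = {\<omega> \<in> space M. T k \<omega> < ereal r}"
    by auto
  finally show ?thesis .
qed

lemma T_le_adapted: "{\<omega> \<in> space M. T k \<omega> \<le> ereal t} \<in> sets (F t)"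
  using stopped_adapted[of k "\<lambda>_. True"] T_less_adapted by simp

text \<open>The last alternative reflects the default value 0 of \<open>jump_count\<close>.
  Adaptedness is claimed for the process on the whole space, so exploding realisations are covered
  as well.\<close>

lemma N_eq_iff:
  "N t \<omega> = k \<longleftrightarrow> (\<forall>l<k. T (Suc l) \<omega> \<le> ereal t) \<and>
    (ereal t < T (Suc k) \<omega> \<or> k = 0 \<and> (\<forall>l. T (Suc l) \<omega> \<le> ereal t))"
proof (cases "\<exists>l. ereal t < T (Suc l) \<omega>")
  case True
  then have N: "N t \<omega> = (LEAST l. ereal t < T (Suc l) \<omega>)"
    by (simp add: N_def jump_count_def T_def)
  have "ereal t < T (Suc (N t \<omega>)) \<omega>"
    unfolding N by (rule LeastI_ex[OF True])
  moreover have "T (Suc l) \<omega> \<le> ereal t" if "l < N t \<omega>" for l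
    using not_less_Least[of l "\<lambda>l. ereal t < T (Suc l) \<omega>"] that by (auto simp: N not_less)
  moreover have "N t \<omega> = k" if "ereal t < T (Suc k) \<omega>" "\<forall>l<k. T (Suc l) \<omega> \<le> ereal t"
    unfolding N using that by (intro Least_equality) (auto simp: not_less[symmetric])
  ultimately show ?thesis using True by (auto simp: not_less[symmetric])
next
  case False
  then have "N t \<omega> = 0" by (simp add: N_def jump_count_def T_def)
  moreover from False have "T (Suc l) \<omega> \<le> ereal t" for l by (auto simp: not_less)
  ultimately show ?thesis using False by auto
qed

lemma N_eq_sets: "{\<omega> \<in> space M. N t \<omega> = k} \<in> sets (F t)"
proof -
  let ?A = "\<lambda>l. {\<omega> \<in> space M. T (Suc l) \<omega> \<le> ereal t}"
  have A: "?A l \<in> sets (F t)" for l by (rule T_le_adapted)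
  have top: "space M \<in> sets (F t)" using sets.top[of "F t"] F_space[OF t] by simp
  have 1: "space M \<inter> (\<Inter>l\<in>{..<k}. ?A l) \<in> sets (F t)"
    by (cases "k = 0") (auto intro!: sets.Int sets.finite_INT A top)
  have 2: "(\<Inter>l. ?A l) \<in> sets (F t)"
    by (intro sets.countable_INT) (auto intro: A)
  have "{\<omega> \<in> space M. N t \<omega> = k} =
      (space M \<inter> (\<Inter>l\<in>{..<k}. ?A l)) \<inter> ((space M - ?A k) \<union> (if k = 0 then (\<Inter>l. ?A l) else {}))"
    by (auto simp: N_eq_iff not_le)
  also have "\<dots> \<in> sets (F t)"
    using 2 by (intro sets.Int 1 sets.Un sets.Diff top A) auto
  finally show ?thesis .
qed

lemma T_N_le: "\<omega> \<in> space M \<Longrightarrow> T (N t \<omega>) \<omega> \<le> ereal t"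
proof (cases "N t \<omega>")
  case 0
  assume "\<omega> \<in> space M"
  then show ?thesis using 0 Y0(2)[of \<omega>] t by (simp add: T_def jump_time_0)
next
  case (Suc l)
  then show ?thesis using N_eq_iff[of \<omega> "Suc l"] by simp
qed

lemma N_adapted: "N t \<in> measurable (F t) (count_space UNIV)"
  unfolding measurable_count_space_eq2_countable
  using N_eq_sets by (auto simp: F_space[OF t] vimage_def Int_def conj_commute)

lemma X_adapted: "X t \<in> measurable (F t) (count_space UNIV)"
proof -
  have "{\<omega> \<in> space M. X t \<omega> = j} \<in> sets (F t)" for j
  proof -
    have "(\<Union>k. {\<omega> \<in> space M. N t \<omega> = k} \<inter> {\<omega> \<in> space M. T k \<omega> \<le> ereal t \<and> S k \<omega> = j}) \<in> sets (F t)"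
      using adapted_stage
      by (intro sets.countable_UN) (auto simp: adapted_stage_def intro!: sets.Int N_eq_sets stopped_adapted)
    also have "(\<Union>k. {\<omega> \<in> space M. N t \<omega> = k} \<inter> {\<omega> \<in> space M. T k \<omega> \<le> ereal t \<and> S k \<omega> = j}) =
        {\<omega> \<in> space M. X t \<omega> = j}"
      using T_N_le by (auto simp: X_def S_def state_at_def N_def)
    finally show ?thesis .
  qed
  then show ?thesis
    unfolding measurable_count_space_eq2_countable
    by (auto simp: F_space[OF t] vimage_def Int_def conj_commute)
qed

lemma Y_adapted: "Y t \<in> borel_measurable (F t)"
proof -
  let ?W = "\<lambda>\<omega>. real_of_ereal (T (N t \<omega>) \<omega>)"
  have "?W \<in> borel_measurable (F t)"
    unfolding borel_measurable_iff_less
  proof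
    fix r
    \<comment> \<open>By \<open>T_N_le\<close> the last jump time is at most \<open>t\<close>, so
      adding this condition changes nothing and leaves only events known at time \<open>t\<close>,
      also when \<open>r > t\<close>.\<close>
    have *: "{\<omega> \<in> space M. T k \<omega> \<le> ereal t \<and> T k \<omega> < ereal r} \<in> sets (F t)" for k
    proof (cases "r \<le> t")
      case True
      then have "{\<omega> \<in> space M. T k \<omega> \<le> ereal t \<and> T k \<omega> < ereal r} = {\<omega> \<in> space M. T k \<omega> < ereal r}"
        by (auto dest: less_le_trans[of _ "ereal r" "ereal t"])
      also have "\<dots> \<in> sets (F t)"
        using T_less_adapted[of k r] G_mono[of "max 0 r" t] G_le_F[OF t] True t by auto
      finally show ?thesis .
    next
      case False
      then have "{\<omega> \<in> space M. T k \<omega> \<le> ereal t \<and> T k \<omega> < ereal r} = {\<omega> \<in> space M. T k \<omega> \<le> ereal t}"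
        by (auto dest: le_less_trans[of _ "ereal t" "ereal r"])
      then show ?thesis using T_le_adapted by simp
    qed
    have "?W \<omega> < r \<longleftrightarrow> T (N t \<omega>) \<omega> < ereal r" if "\<omega> \<in> space M" for \<omega>
      using T_N_le[OF that] T_finite[of "N t \<omega>" \<omega>] by (cases "T (N t \<omega>) \<omega>") auto
    then have "{\<omega> \<in> space (F t). ?W \<omega> < r} =
        (\<Union>k. {\<omega> \<in> space M. N t \<omega> = k} \<inter> {\<omega> \<in> space M. T k \<omega> \<le> ereal t \<and> T k \<omega> < ereal r})"
      using T_N_le F_space[OF t] by auto
    also have "\<dots> \<in> sets (F t)"
      using * by (intro sets.countable_UN) (auto intro!: sets.Int N_eq_sets)
    finally show "{\<omega> \<in> space (F t). ?W \<omega> < r} \<in> sets (F t)" .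
  qed
  then have "(\<lambda>\<omega>. max 0 (t - ?W \<omega>)) \<in> borel_measurable (F t)" by measurable
  then show ?thesis
    by (simp add: Y_def[abs_def] age_at_def T_def N_def)
qed

end

end

section \<open>Poisson random measures\<close>

lemma count_sets:
  fixes f :: "'a \<Rightarrow> ennreal"
  assumes [measurable]: "f \<in> borel_measurable N"
  shows "{x \<in> space N. f x = c} \<in> sets N" "{x \<in> space N. \<not> f x \<le> c} \<in> sets N"
  by measurable

lemma sums_poisson_mean:
  fixes m :: real
  shows "(\<lambda>k. real k * (m ^ k / fact k * exp (- m))) sums m"
proof -
  have "(\<lambda>k. m * exp (- m) * (m ^ k /\<^sub>R fact k)) sums (m * exp (- m) * exp m)"
    by (intro sums_mult exp_converges)
  then have "(\<lambda>k. real (Suc k) * (m ^ Suc k / fact (Suc k) * exp (- m))) sums m"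
    by (simp add: field_simps exp_minus del: of_nat_Suc)
  then show ?thesis
    by (subst (asm) sums_Suc_iff) simp
qed

locale poisson_noise = prob_space M for M :: "'w measure" +
  fixes \<pi> :: "'w \<Rightarrow> (real \<times> real) measure"
  assumes prm: "poisson_random_measure M strip_measure \<pi>"
begin

lemma sets_\<pi>: "\<omega> \<in> space M \<Longrightarrow> sets (\<pi> \<omega>) = sets strip_measure"
  and \<pi>_int: "\<omega> \<in> space M \<Longrightarrow> A \<in> sets strip_measure \<Longrightarrow> emeasure (\<pi> \<omega>) A \<in> range ennreal_of_enat"
  and \<pi>_measurable: "A \<in> sets strip_measure \<Longrightarrow> (\<lambda>\<omega>. emeasure (\<pi> \<omega>) A) \<in> borel_measurable M"
  and \<pi>_poisson: "A \<in> sets strip_measure \<Longrightarrow> emeasure strip_measure A < \<infinity> \<Longrightarrow>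
    prob {\<omega> \<in> space M. emeasure (\<pi> \<omega>) A = of_nat k} =
    measure strip_measure A ^ k / fact k * exp (- measure strip_measure A)"
  using prm by (simp_all add: poisson_random_measure_def)

lemma \<pi>_indep:
  fixes n :: nat
  assumes "\<And>k. k < n \<Longrightarrow> E k \<in> sets strip_measure" "disjoint_family_on E {..<n}"
  shows "indep_vars (\<lambda>_. borel) (\<lambda>k \<omega>. emeasure (\<pi> \<omega>) (E k)) {..<n}"
proof -
  have "\<forall>(n::nat) E. (\<forall>k<n. E k \<in> sets strip_measure) \<longrightarrow> disjoint_family_on E {..<n} \<longrightarrow>
      indep_vars (\<lambda>_. borel) (\<lambda>k \<omega>. emeasure (\<pi> \<omega>) (E k)) {..<n}"
    using prm unfolding poisson_random_measure_def by (elim conjE)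
  then show ?thesis using assms by simp
qed

lemma emeasure_strip:
  assumes "0 \<le> s" "s \<le> t" "B \<in> sets borel"
  shows "emeasure strip_measure ({s<..t} \<times> B) = ennreal (t - s) * emeasure lborel B"
proof -
  have "emeasure strip_measure ({s<..t} \<times> B) = emeasure lborel ({s<..t} \<times> B)"
    unfolding strip_measure_def using assms half_plane_sets by (intro emeasure_restrict_space) auto
  also have "\<dots> = ennreal (t - s) * emeasure lborel B"
    unfolding lborel_prod[symmetric] using assms by (subst lborel.emeasure_pair_measure_Times) auto
  finally show ?thesis .
qed

lemma slab_sets: "0 \<le> s \<Longrightarrow> B \<in> sets borel \<Longrightarrow> {s<..t} \<times> B \<in> sets strip_measure"
  by (intro strip_slab_sets) auto

text \<open>With mean \<open>m\<close> the probability of at most one point is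
  \<open>(1 + m) * exp (- m)\<close>, and \<open>exp (- m) \<ge> 1 - m\<close> bounds it below by
  \<open>1 - m^2\<close>. The square makes the bound summable over a fine partition.\<close>

lemma prob_two_points_le:
  assumes A: "A \<in> sets strip_measure" "emeasure strip_measure A < \<infinity>"
  shows "prob {\<omega> \<in> space M. \<not> emeasure (\<pi> \<omega>) A \<le> 1} \<le> (measure strip_measure A)\<^sup>2"
proof -
  let ?m = "measure strip_measure A"
  let ?e = "\<lambda>k::nat. {\<omega> \<in> space M. emeasure (\<pi> \<omega>) A = of_nat k}"
  have e: "?e k \<in> events" for k by (rule count_sets[OF \<pi>_measurable[OF A(1)]])
  have "prob (?e 0 \<union> ?e 1) = prob (?e 0) + prob (?e 1)"
    using e[of 0] e[of 1] by (intro finite_measure_Union) auto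
  also have "\<dots> = (1 + ?m) * exp (- ?m)"
    unfolding \<pi>_poisson[OF A] by (simp add: algebra_simps)
  finally have eq: "prob (?e 0 \<union> ?e 1) = (1 + ?m) * exp (- ?m)" .
  have "{\<omega> \<in> space M. \<not> emeasure (\<pi> \<omega>) A \<le> 1} \<subseteq> space M - (?e 0 \<union> ?e 1)"
    by auto
  then have "prob {\<omega> \<in> space M. \<not> emeasure (\<pi> \<omega>) A \<le> 1} \<le> prob (space M - (?e 0 \<union> ?e 1))"
    using e[of 0] e[of 1] by (intro finite_measure_mono) auto
  also have "\<dots> = 1 - (1 + ?m) * exp (- ?m)"
    using e by (subst prob_compl) (auto simp only: eq)
  also have "\<dots> \<le> ?m\<^sup>2"
  proof -
    have "(1 + ?m) * (1 - ?m) \<le> (1 + ?m) * exp (- ?m)"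
      using exp_ge_add_one_self[of "- ?m"] by (intro mult_left_mono) auto
    then show ?thesis by (simp add: algebra_simps power2_eq_square)
  qed
  finally show ?thesis .
qed

abbreviation slab :: "nat \<Rightarrow> nat \<Rightarrow> nat \<Rightarrow> (real \<times> real) set" where
  "slab n m i \<equiv> {real n * real i / Suc m<..real n * Suc i / Suc m} \<times> {- real n..real n}"

text \<open>Cutting \<open>(0, n] \<times> [- n, n]\<close> into \<open>m\<close> slabs, the probability that some slab contains two points is
  of order \<open>1 / m\<close>.\<close>

lemma AE_separated_slabs:
  fixes n :: nat
  shows "AE \<omega> in M. \<exists>m. \<forall>i<Suc m.
    emeasure (\<pi> \<omega>) (slab n m i) \<le> 1"
proof -
  let ?E = "\<lambda>m i. {\<omega> \<in> space M. \<not> emeasure (\<pi> \<omega>) (slab n m i) \<le> 1}"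
  let ?B = "\<lambda>m. \<Union>i\<in>{..<Suc m}. ?E m i"
  have S: "slab n m i \<in> sets strip_measure" for m i
    by (intro slab_sets) auto
  have E: "?E m i \<in> events" for m i
    by (rule count_sets[OF \<pi>_measurable[OF S]])
  have B: "?B m \<in> events" for m
    using E by (intro sets.finite_UN) auto
  have mS: "emeasure strip_measure (slab n m i) = ennreal (2 * (real n)\<^sup>2 / Suc m)" for m i
  proof -
    have "real n * real i / Suc m \<le> real n * Suc i / Suc m"
      by (intro divide_right_mono mult_left_mono) auto
    moreover have "real n * Suc i / Suc m - real n * real i / Suc m = real n / Suc m"
      by (simp add: diff_divide_distrib[symmetric] algebra_simps)
    ultimately have "emeasure strip_measure (slab n m i) = ennreal (real n / Suc m) * ennreal (2 * real n)"
      by (subst emeasure_strip) auto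
    also have "\<dots> = ennreal (2 * (real n)\<^sup>2 / Suc m)"
      by (subst ennreal_mult[symmetric]) (auto simp: power2_eq_square)
    finally show ?thesis .
  qed
  have le: "prob (?B m) \<le> 4 * real n ^ 4 * (1 / Suc m)" for m
  proof -
    have "prob (?B m) \<le> (\<Sum>i<Suc m. prob (?E m i))"
      using E by (intro finite_measure_subadditive_finite) auto
    also have "\<dots> \<le> (\<Sum>i<Suc m. (2 * (real n)\<^sup>2 / Suc m)\<^sup>2)"
    proof (rule sum_mono)
      fix i
      have "measure strip_measure (slab n m i) = 2 * (real n)\<^sup>2 / Suc m"
        unfolding measure_def mS by (rule enn2real_ennreal) simp
      then show "prob (?E m i) \<le> (2 * (real n)\<^sup>2 / Suc m)\<^sup>2"
        using prob_two_points_le[OF S, of i m] by (simp add: mS del: of_nat_Suc)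
    qed
    also have "\<dots> = 4 * real n ^ 4 * (1 / Suc m)"
      by (simp add: power_divide power2_eq_square power4_eq_xxxx divide_simps del: of_nat_Suc)
    finally show ?thesis .
  qed
  \<comment> \<open>The probability that every partition fails is below the bound for each single
    partition, which tends to 0.\<close>
  have "prob (\<Inter>m. ?B m) \<le> 0"
  proof (rule LIMSEQ_le_const)
    have "(\<lambda>m. 4 * real n ^ 4 * (1 / real (Suc m))) \<longlonglongrightarrow> 4 * real n ^ 4 * 0"
      by (intro tendsto_intros LIMSEQ_Suc lim_1_over_n)
    then show "(\<lambda>m. 4 * real n ^ 4 * (1 / real (Suc m))) \<longlonglongrightarrow> 0" by simp
    have "prob (\<Inter>m. ?B m) \<le> prob (?B m)" for m
      using B by (intro finite_measure_mono) auto
    then show "\<exists>N. \<forall>m\<ge>N. prob (\<Inter>m. ?B m) \<le> 4 * real n ^ 4 * (1 / real (Suc m))"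
      using le order_trans by blast
  qed
  then have "prob (\<Inter>m. ?B m) = 0"
    using measure_nonneg by (rule antisym)
  moreover have BI: "(\<Inter>m. ?B m) \<in> events"
    using B by (intro sets.countable_INT) auto
  ultimately have "AE \<omega> in M. \<omega> \<notin> (\<Inter>m. ?B m)"
    by (subst (asm) prob_eq_0) auto
  then show ?thesis
    using AE_space by eventually_elim auto
qed

text \<open>Both facts come from a partition in which every slab has mass at most 1: the box is
  covered by finitely many slabs, and a vertical segment inside the box lies in a single slab. The
  full line over \<open>t\<close> is the increasing union of such segments.\<close>

lemma AE_\<pi>_locally_finite:
  "AE \<omega> in M. \<forall>n::nat. emeasure (\<pi> \<omega>) ({0<..real n} \<times> {- real n..real n}) < \<infinity>"
  and AE_\<pi>_simple: "AE \<omega> in M. \<forall>t>0. emeasure (\<pi> \<omega>) ({t} \<times> UNIV) \<le> 1"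
proof -
  let ?P = "\<lambda>\<omega> (n::nat) m. \<forall>i<Suc m.
    emeasure (\<pi> \<omega>) (slab n m i) \<le> 1"
  have AE: "AE \<omega> in M. \<forall>n. \<exists>m. ?P \<omega> n m"
    by (intro AE_all_countable[THEN iffD2] allI AE_separated_slabs)
  have cover: "\<exists>i<Suc m. real n * i / Suc m < u \<and> u \<le> real n * Suc i / Suc m"
    if u: "0 < u" "u \<le> real n" for u m n
  proof -
    define x where "x = u * Suc m / n"
    have n: "0 < real n" using u by linarith
    have x: "0 < x" "x \<le> Suc m"
      using u n by (auto simp: x_def divide_le_eq simp del: of_nat_Suc)
    \<comment> \<open>The slabs are open on the left and closed on the right, hence the ceiling
      minus one instead of the floor.\<close>
    define i where "i = nat (\<lceil>x\<rceil> - 1)"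
    have "0 < \<lceil>x\<rceil>" using x by simp
    then have i: "real i = \<lceil>x\<rceil> - 1" by (simp add: i_def)
    have "\<lceil>x\<rceil> \<le> int (Suc m)" using x(2) by (simp add: ceiling_le_iff)
    then have "i < Suc m" using \<open>0 < \<lceil>x\<rceil>\<close> unfolding i_def by linarith
    moreover have "real i < x" "x \<le> Suc i" using i by linarith+
    then have "real n * i / Suc m < u" "u \<le> real n * Suc i / Suc m"
      using n by (auto simp: x_def field_simps simp del: of_nat_Suc)
    ultimately show ?thesis by blast
  qed
  have sets: "slab n m i \<in> sets (\<pi> \<omega>)"
    if "\<omega> \<in> space M" for n m i \<omega>
    unfolding sets_\<pi>[OF that] by (intro slab_sets) auto
  show "AE \<omega> in M. \<forall>n::nat. emeasure (\<pi> \<omega>) ({0<..real n} \<times> {- real n..real n}) < \<infinity>"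
    using AE AE_space
  proof eventually_elim
    case (elim \<omega>)
    show ?case
    proof
      fix n
      from elim(1) obtain m where m: "?P \<omega> n m" by blast
      let ?S = "slab n m"
      have "{0<..real n} \<times> {- real n..real n} \<subseteq> (\<Union>i\<in>{..<Suc m}. ?S i)"
        using cover[of _ n m] by fastforce
      then have "emeasure (\<pi> \<omega>) ({0<..real n} \<times> {- real n..real n}) \<le> emeasure (\<pi> \<omega>) (\<Union>i\<in>{..<Suc m}. ?S i)"
        using sets[OF elim(2)] by (intro emeasure_mono sets.finite_UN) auto
      also have "\<dots> \<le> (\<Sum>i<Suc m. emeasure (\<pi> \<omega>) (?S i))"
        using sets[OF elim(2)] by (intro emeasure_subadditive_finite) auto
      also have "\<dots> \<le> (\<Sum>i<Suc m. 1)"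
        using m by (intro sum_mono) auto
      also have "\<dots> < \<infinity>" by (simp add: ennreal_of_nat_eq_real_of_nat del: of_nat_Suc)
      finally show "emeasure (\<pi> \<omega>) ({0<..real n} \<times> {- real n..real n}) < \<infinity>" .
    qed
  qed
  show "AE \<omega> in M. \<forall>t>0. emeasure (\<pi> \<omega>) ({t} \<times> UNIV) \<le> 1"
    using AE AE_space
  proof eventually_elim
    case (elim \<omega>)
    show ?case
    proof (intro allI impI)
      fix t :: real assume t: "0 < t"
      obtain n0 :: nat where n0: "t \<le> real n0" using real_arch_simple by blast
      let ?L = "\<lambda>n. {t} \<times> {- real (n0 + n)..real (n0 + n)}"
      have L: "?L n \<in> sets (\<pi> \<omega>)" for n
        unfolding sets_\<pi>[OF elim(2)] using t by (intro strip_slab_sets) auto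
      have le: "emeasure (\<pi> \<omega>) (?L n) \<le> 1" for n
      proof -
        from elim(1) obtain m where m: "?P \<omega> (n0 + n) m" by blast
        obtain i where i: "i < Suc m" "real (n0 + n) * i / Suc m < t" "t \<le> real (n0 + n) * Suc i / Suc m"
          using cover[OF t, of "n0 + n" m] n0 by auto
        have "emeasure (\<pi> \<omega>) (?L n) \<le> emeasure (\<pi> \<omega>)
            (slab (n0 + n) m i)"
          using i by (intro emeasure_mono sets[OF elim(2)]) auto
        also have "\<dots> \<le> 1" using m i(1) by blast
        finally show ?thesis .
      qed
      have "\<exists>n. v \<in> {- real (n0 + n)..real (n0 + n)}" for v
      proof -
        obtain n :: nat where "\<bar>v\<bar> \<le> real n" using real_arch_simple by blast
        then have "v \<in> {- real (n0 + n)..real (n0 + n)}" by auto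
        then show ?thesis ..
      qed
      then have "(\<Union>n. {- real (n0 + n)..real (n0 + n)}) = UNIV" by blast
      then have UN: "(\<Union>n. ?L n) = {t} \<times> UNIV" by blast
      have "incseq ?L"
        unfolding incseq_def by auto
      moreover have "range ?L \<subseteq> sets (\<pi> \<omega>)" using L by blast
      ultimately have "(SUP n. emeasure (\<pi> \<omega>) (?L n)) = emeasure (\<pi> \<omega>) ({t} \<times> UNIV)"
        using SUP_emeasure_incseq[of ?L "\<pi> \<omega>"] UN by simp
      moreover have "(SUP n. emeasure (\<pi> \<omega>) (?L n)) \<le> 1" using le by (rule SUP_least)
      ultimately show "emeasure (\<pi> \<omega>) ({t} \<times> UNIV) \<le> 1" by simp
    qed
  qed
qed

text \<open>A finite family of sets is not disjoint, but the counts of its members are sums of counts of the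
  atoms it generates.\<close>

lemma indep_disjoint_regions:
  assumes fin: "finite \<A>" and \<A>: "\<And>a. a \<in> \<A> \<Longrightarrow> a \<in> sets strip_measure"
    and A: "A \<in> sets strip_measure" and disj: "\<And>a. a \<in> \<A> \<Longrightarrow> a \<inter> A = {}"
    and C: "\<And>a. a \<in> \<A> \<Longrightarrow> C a \<in> sets borel" and D: "D \<in> sets borel"
  shows "prob ({\<omega> \<in> space M. \<forall>a\<in>\<A>. emeasure (\<pi> \<omega>) a \<in> C a} \<inter> {\<omega> \<in> space M. emeasure (\<pi> \<omega>) A \<in> D}) =
    prob {\<omega> \<in> space M. \<forall>a\<in>\<A>. emeasure (\<pi> \<omega>) a \<in> C a} * prob {\<omega> \<in> space M. emeasure (\<pi> \<omega>) A \<in> D}"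
proof -
  define n where "n = card (Pow \<A> - {{}})"
  obtain f where f: "bij_betw f {..<n} (Pow \<A> - {{}})"
    using ex_bij_betw_nat_finite[of "Pow \<A> - {{}}"] fin by (auto simp: n_def atLeast0LessThan)
  \<comment> \<open>For \<open>l < n\<close> the atom of points lying in exactly the members
    \<open>f l\<close> of the family. The empty pattern is left out, since its atom meets no member;
    index \<open>n\<close> is taken by \<open>A\<close>, which is disjoint from all these
    atoms.\<close>
  define E where "E l = (if l < n then {p \<in> space strip_measure. \<forall>a\<in>\<A>. p \<in> a \<longleftrightarrow> a \<in> f l} else A)" for l
  have f_in: "f l \<subseteq> \<A>" "f l \<noteq> {}" if "l < n" for l
    using bij_betwE[OF f] that by auto
  have E_sets: "E l \<in> sets strip_measure" for l
  proof (cases "l < n")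
    case True
    have "{p \<in> space strip_measure. p \<in> a \<longleftrightarrow> a \<in> f l} \<in> sets strip_measure" if "a \<in> \<A>" for a
    proof (cases "a \<in> f l")
      case True
      then have "{p \<in> space strip_measure. p \<in> a \<longleftrightarrow> a \<in> f l} = a"
        using sets.sets_into_space[OF \<A>[OF that]] by auto
      then show ?thesis using \<A>[OF that] by simp
    next
      case False
      then have "{p \<in> space strip_measure. p \<in> a \<longleftrightarrow> a \<in> f l} = space strip_measure - a" by auto
      then show ?thesis using \<A>[OF that] by auto
    qed
    then have "{p \<in> space strip_measure. \<forall>a\<in>\<A>. p \<in> a \<longleftrightarrow> a \<in> f l} \<in> sets strip_measure"
      using fin by (intro sets.sets_Collect_finite_All)
    then show ?thesis using True by (simp add: E_def)
  qed (simp add: E_def A)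
  have E_disj: "disjoint_family_on E {..<Suc n}"
  proof -
    have "E l \<inter> E l' = {}" if l: "l < l'" "l' \<le> n" for l l'
    proof (cases "l' = n")
      case True
      with f_in[of l] l disj show ?thesis by (fastforce simp: E_def)
    next
      case False
      with l have "f l \<noteq> f l'" using inj_onD[OF bij_betw_imp_inj_on[OF f], of l l'] by auto
      then obtain a where a: "a \<in> \<A>" "a \<in> f l \<longleftrightarrow> a \<notin> f l'"
        using f_in[of l] f_in[of l'] l False by auto
      have "l < n" "l' < n" using l False by auto
      then have "E l \<subseteq> {p. p \<in> a \<longleftrightarrow> a \<in> f l}" "E l' \<subseteq> {p. p \<in> a \<longleftrightarrow> a \<in> f l'}"
        using a(1) by (auto simp: E_def)
      with a(2) show ?thesis by blast
    qed
    then show ?thesis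
      unfolding disjoint_family_on_def by (metis Int_commute lessThan_iff less_Suc_eq_le linorder_neqE_nat)
  qed
  have atoms: "emeasure (\<pi> \<omega>) a = (\<Sum>l\<in>{l\<in>{..<n}. a \<in> f l}. emeasure (\<pi> \<omega>) (E l))"
    if a: "a \<in> \<A>" and \<omega>: "\<omega> \<in> space M" for a \<omega>
  proof -
    have "(\<Union>l\<in>{l\<in>{..<n}. a \<in> f l}. E l) = a"
    proof (intro equalityI subsetI)
      fix p assume p: "p \<in> a"
      then have "{a\<in>\<A>. p \<in> a} \<in> f ` {..<n}"
        using a bij_betw_imp_surj_on[OF f] by auto
      then obtain l where "l < n" "f l = {a\<in>\<A>. p \<in> a}" by auto
      then show "p \<in> (\<Union>l\<in>{l\<in>{..<n}. a \<in> f l}. E l)"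
        using p a sets.sets_into_space[OF \<A>[OF a]] by (auto simp: E_def)
    qed (use a in \<open>auto simp: E_def split: if_splits\<close>)
    moreover have "disjoint_family_on E {l\<in>{..<n}. a \<in> f l}"
      using E_disj by (rule disjoint_family_on_mono[rotated]) auto
    moreover have "E ` {l\<in>{..<n}. a \<in> f l} \<subseteq> sets (\<pi> \<omega>)"
      using E_sets sets_\<pi>[OF \<omega>] by blast
    ultimately show ?thesis
      using sum_emeasure[of E "{l\<in>{..<n}. a \<in> f l}" "\<pi> \<omega>"] by simp
  qed
  have "indep_vars (\<lambda>_. borel) (\<lambda>k \<omega>. emeasure (\<pi> \<omega>) (E k)) {..<Suc n}"
    using E_sets E_disj by (intro \<pi>_indep)
  then have ind: "indep_var (PiM {..<n} (\<lambda>_. borel)) (\<lambda>\<omega>. restrict (\<lambda>k. emeasure (\<pi> \<omega>) (E k)) {..<n})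
      (PiM {n} (\<lambda>_. borel)) (\<lambda>\<omega>. restrict (\<lambda>k. emeasure (\<pi> \<omega>) (E k)) {n})"
    by (rule indep_var_restrict) auto
  \<comment> \<open>Constraints on overlapping members become one event in the vector of atom
    counts, so independence from the count of \<open>A\<close> follows at once.\<close>
  define U where "U = {x \<in> space (PiM {..<n} (\<lambda>_. borel :: ennreal measure)). \<forall>a\<in>\<A>. (\<Sum>l\<in>{l\<in>{..<n}. a \<in> f l}. x l) \<in> C a}"
  define W where "W = {x \<in> space (PiM {n} (\<lambda>_. borel :: ennreal measure)). x n \<in> D}"
  have U: "U \<in> sets (PiM {..<n} (\<lambda>_. borel))"
  proof -
    have "{x \<in> space (PiM {..<n} (\<lambda>_. borel :: ennreal measure)). (\<Sum>l\<in>{l\<in>{..<n}. a \<in> f l}. x l) \<in> C a}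
        \<in> sets (PiM {..<n} (\<lambda>_. borel))" if "a \<in> \<A>" for a
    proof -
      have "(\<lambda>x. \<Sum>l\<in>{l\<in>{..<n}. a \<in> f l}. x l) \<in> borel_measurable (PiM {..<n} (\<lambda>_. borel :: ennreal measure))"
        by (intro borel_measurable_sum) auto
      from measurable_sets[OF this C[OF that]] show ?thesis
        by (simp add: vimage_def Int_def conj_commute)
    qed
    then show ?thesis unfolding U_def using fin by (intro sets.sets_Collect_finite_All)
  qed
  have W: "W \<in> sets (PiM {n} (\<lambda>_. borel))"
  proof -
    have "(\<lambda>x. x n) \<in> borel_measurable (PiM {n} (\<lambda>_. borel :: ennreal measure))" by measurable
    from measurable_sets[OF this D] show ?thesis
      by (simp add: W_def vimage_def Int_def conj_commute)
  qed
  let ?X = "\<lambda>\<omega>. restrict (\<lambda>k. emeasure (\<pi> \<omega>) (E k)) {..<n}"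
  let ?Y = "\<lambda>\<omega>. restrict (\<lambda>k. emeasure (\<pi> \<omega>) (E k)) {n}"
  have X_iff: "?X \<omega> \<in> U \<longleftrightarrow> (\<forall>a\<in>\<A>. emeasure (\<pi> \<omega>) a \<in> C a)" if "\<omega> \<in> space M" for \<omega>
  proof -
    have "(\<Sum>l\<in>{l\<in>{..<n}. a \<in> f l}. ?X \<omega> l) = emeasure (\<pi> \<omega>) a" if "a \<in> \<A>" for a
      unfolding atoms[OF that \<open>\<omega> \<in> space M\<close>] by (intro sum.cong) auto
    then show ?thesis by (simp add: U_def space_PiM)
  qed
  have Y_iff: "?Y \<omega> \<in> W \<longleftrightarrow> emeasure (\<pi> \<omega>) A \<in> D" for \<omega>
    by (simp add: W_def space_PiM E_def)
  have "(\<lambda>\<omega>. (?X \<omega>, ?Y \<omega>)) -` (U \<times> W) \<inter> space M =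
      {\<omega> \<in> space M. \<forall>a\<in>\<A>. emeasure (\<pi> \<omega>) a \<in> C a} \<inter> {\<omega> \<in> space M. emeasure (\<pi> \<omega>) A \<in> D}"
    using X_iff Y_iff by blast
  moreover have "?X -` U \<inter> space M = {\<omega> \<in> space M. \<forall>a\<in>\<A>. emeasure (\<pi> \<omega>) a \<in> C a}"
    using X_iff by blast
  moreover have "?Y -` W \<inter> space M = {\<omega> \<in> space M. emeasure (\<pi> \<omega>) A \<in> D}"
    using Y_iff by blast
  ultimately show ?thesis
    using indep_varD[OF ind U W] by simp
qed

text \<open>The count takes integer values, so the integral splits over the events that it equals
  \<open>k\<close>. Independence factors out the probability of \<open>H\<close>, and what remains
  is the Poisson mean.\<close>

lemma nn_integral_indep_count:
  assumes A: "A \<in> sets strip_measure" "emeasure strip_measure A < \<infinity>" and H: "H \<in> events"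
    and ind: "\<And>k::nat. prob (H \<inter> {\<omega> \<in> space M. emeasure (\<pi> \<omega>) A = of_nat k}) =
      prob H * prob {\<omega> \<in> space M. emeasure (\<pi> \<omega>) A = of_nat k}"
    and AE_fin: "AE \<omega> in M. emeasure (\<pi> \<omega>) A < \<infinity>"
  shows "(\<integral>\<^sup>+\<omega>. indicator H \<omega> * emeasure (\<pi> \<omega>) A \<partial>M) = emeasure M H * emeasure strip_measure A"
proof -
  let ?m = "measure strip_measure A"
  let ?e = "\<lambda>k::nat. {\<omega> \<in> space M. emeasure (\<pi> \<omega>) A = of_nat k}"
  have e: "?e k \<in> events" for k by (rule count_sets[OF \<pi>_measurable[OF A(1)]])
  have "AE \<omega> in M. indicator H \<omega> * emeasure (\<pi> \<omega>) A = (\<Sum>k. of_nat k * indicator (H \<inter> ?e k) \<omega>)"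
    using AE_fin AE_space
  proof eventually_elim
    case (elim \<omega>)
    obtain e where e: "emeasure (\<pi> \<omega>) A = ennreal_of_enat e"
      using \<pi>_int[OF elim(2) A(1)] by auto
    with elim(1) obtain k where k: "emeasure (\<pi> \<omega>) A = of_nat k"
      by (cases e) auto
    have "(\<Sum>l. of_nat l * indicator (H \<inter> ?e l) \<omega>) = (\<Sum>l\<in>{k}. of_nat l * indicator (H \<inter> ?e l) \<omega> :: ennreal)"
      using k by (intro suminf_finite) (auto simp: indicator_def)
    then show ?case using k elim(2) by (auto simp: indicator_def)
  qed
  then have "(\<integral>\<^sup>+\<omega>. indicator H \<omega> * emeasure (\<pi> \<omega>) A \<partial>M) =
      (\<integral>\<^sup>+\<omega>. (\<Sum>k. of_nat k * indicator (H \<inter> ?e k) \<omega>) \<partial>M)"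
    by (rule nn_integral_cong_AE)
  also have "\<dots> = (\<Sum>k. \<integral>\<^sup>+\<omega>. of_nat k * indicator (H \<inter> ?e k) \<omega> \<partial>M)"
    using e H by (intro nn_integral_suminf) auto
  also have "\<dots> = (\<Sum>k. ennreal (prob H * (real k * (?m ^ k / fact k * exp (- ?m)))))"
  proof (intro suminf_cong)
    fix k
    have "(\<integral>\<^sup>+\<omega>. of_nat k * indicator (H \<inter> ?e k) \<omega> \<partial>M) = of_nat k * emeasure M (H \<inter> ?e k)"
      using e H by (intro nn_integral_cmult_indicator) auto
    also have "\<dots> = ennreal (real k * (prob H * prob (?e k)))"
      unfolding emeasure_eq_measure ind by (simp add: ennreal_mult ennreal_of_nat_eq_real_of_nat)
    also have "\<dots> = ennreal (prob H * (real k * (?m ^ k / fact k * exp (- ?m))))"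
      unfolding \<pi>_poisson[OF A] by (simp add: ac_simps)
    finally show "(\<integral>\<^sup>+\<omega>. of_nat k * indicator (H \<inter> ?e k) \<omega> \<partial>M) =
      ennreal (prob H * (real k * (?m ^ k / fact k * exp (- ?m))))" .
  qed
  also have "\<dots> = ennreal (prob H * ?m)"
    by (intro suminf_ennreal_eq sums_mult sums_poisson_mean) auto
  also have "\<dots> = emeasure M H * emeasure strip_measure A"
    using A(2) by (simp add: ennreal_mult emeasure_eq_measure emeasure_eq_ennreal_measure)
  finally show ?thesis .
qed

end

section \<open>The filtration of initial values and past counts, and its independence of the
  future\<close>

locale poisson_system = poisson_noise M \<pi> for M :: "'w measure" and \<pi> +
  fixes F :: "real \<Rightarrow> 'w measure" and X0 :: "'w \<Rightarrow> nat" and Y0 :: "'w \<Rightarrow> real"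
  assumes usual: "usual_hypothesis M F" and adapted: "adapted_random_measure F \<pi>"
    and initial: "initial_values M F \<pi> X0 Y0"
begin

lemmas filtration = usual[unfolded usual_hypothesis_def, THEN conjunct1]
  and F_null = usual[unfolded usual_hypothesis_def, THEN conjunct2, THEN conjunct2, THEN conjunct1]
  and right_continuous = usual[unfolded usual_hypothesis_def, THEN conjunct2, THEN conjunct2, THEN conjunct2]

lemma F_space: "0 \<le> t \<Longrightarrow> space (F t) = space M"
  and F_sets: "0 \<le> t \<Longrightarrow> sets (F t) \<subseteq> sets M"
  and F_mono: "0 \<le> s \<Longrightarrow> s \<le> t \<Longrightarrow> sets (F s) \<subseteq> sets (F t)"
  using filtration by (simp_all add: filtration_on_def)

lemma X0: "X0 \<in> measurable (F 0) (count_space UNIV)" "\<And>\<omega>. \<omega> \<in> space M \<Longrightarrow> X0 \<omega> \<in> states"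
  and Y0: "Y0 \<in> borel_measurable (F 0)" "\<And>\<omega>. \<omega> \<in> space M \<Longrightarrow> 0 \<le> Y0 \<omega>"
  using initial by (simp_all add: initial_values_def)

definition locally_finite :: "'w \<Rightarrow> bool" where
  "locally_finite \<omega> \<longleftrightarrow> (\<forall>n::nat. emeasure (\<pi> \<omega>) ({0<..real n} \<times> {- real n..real n}) < \<infinity>)"

text \<open>Changed on a null set, so that it is locally finite everywhere.\<close>

definition \<rho> :: "'w \<Rightarrow> (real \<times> real) measure" where
  "\<rho> \<omega> = (if locally_finite \<omega> then \<pi> \<omega> else null_measure strip_measure)"

lemma AE_\<rho>: "AE \<omega> in M. \<rho> \<omega> = \<pi> \<omega>"
  using AE_\<pi>_locally_finite by eventually_elim (simp add: \<rho>_def locally_finite_def)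

text \<open>The complement is a null set, and the usual hypothesis places all null sets in
  \<open>F 0\<close>. Hence changing the random measure there keeps it adapted to
  \<open>F\<close>.\<close>

lemma locally_finite_sets: "0 \<le> t \<Longrightarrow> {\<omega> \<in> space M. locally_finite \<omega>} \<in> sets (F t)"
proof -
  assume t: "0 \<le> t"
  have m: "{\<omega> \<in> space M. \<not> locally_finite \<omega>} \<in> sets M"
  proof -
    have "{\<omega> \<in> space M. \<not> emeasure (\<pi> \<omega>) ({0<..real n} \<times> {- real n..real n}) < \<infinity>} \<in> sets M" for n :: nat
    proof -
      have "{0<..real n} \<times> {- real n..real n} \<in> sets strip_measure" by (intro slab_sets) auto
      from count_sets(1)[OF \<pi>_measurable[OF this], of \<infinity>] show ?thesis
        by (simp add: not_less top_unique)
    qed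
    then have "(\<Union>n::nat. {\<omega> \<in> space M. \<not> emeasure (\<pi> \<omega>) ({0<..real n} \<times> {- real n..real n}) < \<infinity>}) \<in> sets M"
      by (intro sets.countable_UN) blast
    also have "(\<Union>n::nat. {\<omega> \<in> space M. \<not> emeasure (\<pi> \<omega>) ({0<..real n} \<times> {- real n..real n}) < \<infinity>}) =
        {\<omega> \<in> space M. \<not> locally_finite \<omega>}"
      by (auto simp: locally_finite_def)
    finally show ?thesis .
  qed
  have "AE \<omega> in M. locally_finite \<omega>"
    using AE_\<pi>_locally_finite by (simp add: locally_finite_def)
  then have "{\<omega> \<in> space M. \<not> locally_finite \<omega>} \<in> null_sets M"
    using AE_iff_null[OF m] m by (simp add: null_sets_def)
  then have "{\<omega> \<in> space M. \<not> locally_finite \<omega>} \<in> sets (F t)"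
    using F_null F_mono[of 0 t] t by auto
  then have "space (F t) - {\<omega> \<in> space M. \<not> locally_finite \<omega>} \<in> sets (F t)"
    by (rule sets.compl_sets)
  also have "space (F t) - {\<omega> \<in> space M. \<not> locally_finite \<omega>} = {\<omega> \<in> space M. locally_finite \<omega>}"
    using F_space[OF t] by auto
  finally show ?thesis .
qed

lemma sets_\<rho>: "\<omega> \<in> space M \<Longrightarrow> sets (\<rho> \<omega>) = sets strip_measure"
  by (simp add: \<rho>_def sets_\<pi>)

lemma \<rho>_int: "\<omega> \<in> space M \<Longrightarrow> A \<in> sets (\<rho> \<omega>) \<Longrightarrow> emeasure (\<rho> \<omega>) A \<in> range ennreal_of_enat"
proof -
  assume *: "\<omega> \<in> space M" "A \<in> sets (\<rho> \<omega>)"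
  have "0 \<in> range ennreal_of_enat" by (metis ennreal_of_enat_0 rangeI)
  with \<pi>_int[OF *(1), of A] * sets_\<rho>[OF *(1)] show ?thesis by (simp add: \<rho>_def)
qed

lemma \<rho>_finite:
  assumes "\<omega> \<in> space M"
  shows "emeasure (\<rho> \<omega>) ({0<..t} \<times> {- b..b}) < \<infinity>"
proof (cases "locally_finite \<omega>")
  case True
  obtain n :: nat where n: "max t b \<le> real n" using real_arch_simple by blast
  have "{0<..real n} \<times> {- real n..real n} \<in> sets (\<pi> \<omega>)"
    unfolding sets_\<pi>[OF assms] by (intro slab_sets) auto
  then have "emeasure (\<pi> \<omega>) ({0<..t} \<times> {- b..b}) \<le> emeasure (\<pi> \<omega>) ({0<..real n} \<times> {- real n..real n})"
    using n by (intro emeasure_mono) auto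
  also have "\<dots> < \<infinity>" using True by (simp add: locally_finite_def)
  finally show ?thesis using True by (simp add: \<rho>_def)
qed (simp add: \<rho>_def)

lemma \<rho>_adapted:
  assumes t: "0 \<le> t" and B: "B \<in> sets borel"
  shows "(\<lambda>\<omega>. emeasure (\<rho> \<omega>) ({0<..t} \<times> B)) \<in> borel_measurable (F t)"
proof -
  have "(\<lambda>\<omega>. emeasure (\<pi> \<omega>) ({0<..t} \<times> B)) \<in> borel_measurable (F t)"
    using adapted t B by (simp add: adapted_random_measure_def)
  then have "(\<lambda>\<omega>. if locally_finite \<omega> then emeasure (\<pi> \<omega>) ({0<..t} \<times> B) else 0) \<in> borel_measurable (F t)"
    using locally_finite_sets[OF t] F_space[OF t] by (intro measurable_If) auto
  moreover have "(\<lambda>\<omega>. if locally_finite \<omega> then emeasure (\<pi> \<omega>) ({0<..t} \<times> B) else 0) =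
      (\<lambda>\<omega>. emeasure (\<rho> \<omega>) ({0<..t} \<times> B))"
    by (auto simp: \<rho>_def)
  ultimately show ?thesis by simp
qed

definition slabs :: "real \<Rightarrow> (real \<times> real) set set" where
  "slabs s = {{0<..r} \<times> B | r B. 0 \<le> r \<and> r \<le> s \<and> B \<in> sets borel}"

text \<open>Cylinder events in the initial values and finitely many counts up to time
  \<open>s\<close>: a generator stable under intersection, on which independence of the future can
  be checked directly.\<close>

definition past :: "real \<Rightarrow> 'w set set" where
  "past s = {{\<omega> \<in> space M. (X0 \<omega>, Y0 \<omega>) \<in> C \<and> (\<forall>a\<in>\<A>. emeasure (\<rho> \<omega>) a \<in> D a)} | C \<A> D.
     C \<in> sets (count_space UNIV \<Otimes>\<^sub>M borel) \<and> finite \<A> \<and> \<A> \<subseteq> slabs s \<and> (\<forall>a\<in>\<A>. D a \<in> sets borel)}"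

definition G :: "real \<Rightarrow> 'w measure" where
  "G s = sigma (space M) (past s)"

lemma past_subset: "past s \<subseteq> Pow (space M)"
  by (auto simp: past_def)

lemma space_G: "space (G s) = space M"
  unfolding G_def using past_subset by (rule space_measure_of)

lemma sets_G: "sets (G s) = sigma_sets (space M) (past s)"
  unfolding G_def using past_subset by (rule sets_measure_of)

lemma past_F:
  assumes s: "0 \<le> s"
  shows "past s \<subseteq> sets (F s)"
proof
  fix H assume "H \<in> past s"
  then obtain C \<A> D where H: "H = {\<omega> \<in> space M. (X0 \<omega>, Y0 \<omega>) \<in> C \<and> (\<forall>a\<in>\<A>. emeasure (\<rho> \<omega>) a \<in> D a)}"
    and C: "C \<in> sets (count_space UNIV \<Otimes>\<^sub>M borel)" and \<A>: "finite \<A>" "\<A> \<subseteq> slabs s"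
    and D: "\<And>a. a \<in> \<A> \<Longrightarrow> D a \<in> sets borel"
    by (auto simp: past_def)
  have sp: "space (F s) = space M" "space (F 0) = space M" using F_space s by auto
  have "(\<lambda>\<omega>. (X0 \<omega>, Y0 \<omega>)) \<in> F 0 \<rightarrow>\<^sub>M count_space UNIV \<Otimes>\<^sub>M borel"
    using X0(1) Y0(1) by (intro measurable_Pair)
  from measurable_sets[OF this C] have "{\<omega> \<in> space M. (X0 \<omega>, Y0 \<omega>) \<in> C} \<in> sets (F 0)"
    by (simp add: vimage_def Int_def conj_commute sp)
  then have 1: "{\<omega> \<in> space M. (X0 \<omega>, Y0 \<omega>) \<in> C} \<in> sets (F s)"
    using F_mono[of 0 s] s by auto
  have "{\<omega> \<in> space (F s). emeasure (\<rho> \<omega>) a \<in> D a} \<in> sets (F s)" if a: "a \<in> \<A>" for a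
  proof -
    obtain r B where r: "a = {0<..r} \<times> B" "0 \<le> r" "r \<le> s" "B \<in> sets borel"
      using a \<A>(2) by (auto simp: slabs_def)
    have "{\<omega> \<in> space M. emeasure (\<rho> \<omega>) a \<in> D a} \<in> sets (F r)"
      using measurable_sets[OF \<rho>_adapted[OF r(2,4)] D[OF a]] F_space[OF r(2)]
      by (simp add: r(1) vimage_def Int_def conj_commute)
    then show ?thesis using F_mono[OF r(2,3)] sp by auto
  qed
  then have "{\<omega> \<in> space (F s). \<forall>a\<in>\<A>. emeasure (\<rho> \<omega>) a \<in> D a} \<in> sets (F s)"
    using \<A>(1) by (intro sets.sets_Collect_finite_All)
  with 1 have "{\<omega> \<in> space M. (X0 \<omega>, Y0 \<omega>) \<in> C} \<inter> {\<omega> \<in> space (F s). \<forall>a\<in>\<A>. emeasure (\<rho> \<omega>) a \<in> D a} \<in> sets (F s)"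
    by (rule sets.Int)
  also have "{\<omega> \<in> space M. (X0 \<omega>, Y0 \<omega>) \<in> C} \<inter> {\<omega> \<in> space (F s). \<forall>a\<in>\<A>. emeasure (\<rho> \<omega>) a \<in> D a} = H"
    unfolding H sp by auto
  finally show "H \<in> sets (F s)" .
qed

lemma G_le_F:
  assumes "0 \<le> s"
  shows "sets (G s) \<subseteq> sets (F s)"
proof -
  have "sigma_sets (space (F s)) (past s) \<subseteq> sets (F s)"
    using past_F[OF assms] by (rule sets.sigma_sets_subset)
  then show ?thesis by (simp add: sets_G F_space[OF assms])
qed

lemma G_mono: "s \<le> t \<Longrightarrow> sets (G s) \<subseteq> sets (G t)"
proof -
  assume "s \<le> t"
  then have "slabs s \<subseteq> slabs t" unfolding slabs_def by force
  then have "past s \<subseteq> past t" unfolding past_def by blast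
  then show ?thesis unfolding sets_G by (rule sigma_sets_mono')
qed

lemma Int_stable_past: "Int_stable (past s)"
proof (rule Int_stableI)
  fix H H' assume "H \<in> past s" "H' \<in> past s"
  then obtain C \<A> D C' \<A>' D' where
    H: "H = {\<omega> \<in> space M. (X0 \<omega>, Y0 \<omega>) \<in> C \<and> (\<forall>a\<in>\<A>. emeasure (\<rho> \<omega>) a \<in> D a)}"
      "C \<in> sets (count_space UNIV \<Otimes>\<^sub>M borel)" "finite \<A>" "\<A> \<subseteq> slabs s" "\<forall>a\<in>\<A>. D a \<in> sets borel"
    and H': "H' = {\<omega> \<in> space M. (X0 \<omega>, Y0 \<omega>) \<in> C' \<and> (\<forall>a\<in>\<A>'. emeasure (\<rho> \<omega>) a \<in> D' a)}"
      "C' \<in> sets (count_space UNIV \<Otimes>\<^sub>M borel)" "finite \<A>'" "\<A>' \<subseteq> slabs s" "\<forall>a\<in>\<A>'. D' a \<in> sets borel"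
    unfolding past_def by blast
  \<comment> \<open>A window that occurs in only one of the two events gets the trivial constraint
    \<open>UNIV\<close> from the other.\<close>
  let ?D = "\<lambda>a. (if a \<in> \<A> then D a else UNIV) \<inter> (if a \<in> \<A>' then D' a else UNIV)"
  have "H \<inter> H' = {\<omega> \<in> space M. (X0 \<omega>, Y0 \<omega>) \<in> C \<inter> C' \<and> (\<forall>a\<in>\<A> \<union> \<A>'. emeasure (\<rho> \<omega>) a \<in> ?D a)}"
    unfolding H(1) H'(1) by auto
  moreover have "\<forall>a\<in>\<A> \<union> \<A>'. ?D a \<in> sets borel"
    using H(5) H'(5) by auto
  moreover have "C \<inter> C' \<in> sets (count_space UNIV \<Otimes>\<^sub>M borel)" "finite (\<A> \<union> \<A>')" "\<A> \<union> \<A>' \<subseteq> slabs s"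
    using H(2-4) H'(2-4) by auto
  ultimately show "H \<inter> H' \<in> past s"
    unfolding past_def
    by (intro CollectI exI[of _ "C \<inter> C'"] exI[of _ "\<A> \<union> \<A>'"] exI[of _ ?D] conjI)
qed

text \<open>Up to a null set \<open>H\<close> is the intersection of an event \<open>ZC\<close> of
  the initial values and an event \<open>V\<close> of past counts of \<pi>. The initial values are
  independent of all counts jointly, hence of \<open>V \<inter> W\<close>, and \<open>V\<close> is
  independent of \<open>W\<close> because they concern disjoint time regions.\<close>

lemma past_indep:
  assumes s: "0 \<le> s" and A: "A \<in> sets strip_measure" "A \<subseteq> {s<..} \<times> UNIV" and H: "H \<in> past s"
    and W: "W = {\<omega> \<in> space M. emeasure (\<pi> \<omega>) A \<in> K}" "K \<in> sets borel"
  shows "prob (H \<inter> W) = prob H * prob W"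
proof -
  obtain C \<A> D where H_eq: "H = {\<omega> \<in> space M. (X0 \<omega>, Y0 \<omega>) \<in> C \<and> (\<forall>a\<in>\<A>. emeasure (\<rho> \<omega>) a \<in> D a)}"
    and C: "C \<in> sets (count_space UNIV \<Otimes>\<^sub>M borel)" and \<A>: "finite \<A>" "\<A> \<subseteq> slabs s"
    and D: "\<And>a. a \<in> \<A> \<Longrightarrow> D a \<in> sets borel"
    using H by (auto simp: past_def)
  let ?Z = "\<lambda>\<omega>. (X0 \<omega>, Y0 \<omega>)"
  define ZC where "ZC = ?Z -` C \<inter> space M"
  define V where "V = {\<omega> \<in> space M. \<forall>a\<in>\<A>. emeasure (\<pi> \<omega>) a \<in> D a}"
  let ?gen = "{(\<lambda>\<omega>. emeasure (\<pi> \<omega>) A) -` B \<inter> space M | A B. A \<in> sets strip_measure \<and> B \<in> sets borel}"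
  define \<Sigma> where "\<Sigma> = sigma (space M) ?gen"
  have gen: "?gen \<subseteq> Pow (space M)" by auto
  have sets_\<Sigma>: "sets \<Sigma> = sigma_sets (space M) ?gen" and space_\<Sigma>: "space \<Sigma> = space M"
    unfolding \<Sigma>_def using gen by (rule sets_measure_of, rule space_measure_of)
  have ind: "indep_set (sets (vimage_algebra (space M) ?Z (count_space UNIV \<Otimes>\<^sub>M borel))) (sets \<Sigma>)"
    using initial unfolding initial_values_def sets_\<Sigma> by simp
  have count: "{\<omega> \<in> space \<Sigma>. emeasure (\<pi> \<omega>) a \<in> B} \<in> sets \<Sigma>"
    if "a \<in> sets strip_measure" "B \<in> sets borel" for a B
  proof -
    have "(\<lambda>\<omega>. emeasure (\<pi> \<omega>) a) -` B \<inter> space M \<in> sets \<Sigma>"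
      unfolding sets_\<Sigma> using that by (intro sigma_sets.Basic) blast
    also have "(\<lambda>\<omega>. emeasure (\<pi> \<omega>) a) -` B \<inter> space M = {\<omega> \<in> space \<Sigma>. emeasure (\<pi> \<omega>) a \<in> B}"
      using space_\<Sigma> by auto
    finally show ?thesis .
  qed
  have \<A>_sets: "a \<in> sets strip_measure" if "a \<in> \<A>" for a
    using that \<A>(2) by (auto simp: slabs_def intro: slab_sets)
  have "{\<omega> \<in> space \<Sigma>. \<forall>a\<in>\<A>. emeasure (\<pi> \<omega>) a \<in> D a} \<in> sets \<Sigma>"
    using count \<A>_sets D \<A>(1) by (intro sets.sets_Collect_finite_All) auto
  then have V: "V \<in> sets \<Sigma>" by (simp add: V_def space_\<Sigma>)
  have W\<Sigma>: "W \<in> sets \<Sigma>" using count[OF A(1) W(2)] by (simp add: W(1) space_\<Sigma>)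
  have ZC: "ZC \<in> sets (vimage_algebra (space M) ?Z (count_space UNIV \<Otimes>\<^sub>M borel))"
    unfolding ZC_def using C by (rule in_vimage_algebra)
  have ev: "V \<in> events" "W \<in> events" "ZC \<in> events"
    using ind V W\<Sigma> ZC by (auto simp: indep_set_def indep_sets_def split: bool.splits)
  have H_ev: "H \<in> events" using H past_F[OF s] F_sets[OF s] by auto
  have VW: "prob (V \<inter> W) = prob V * prob W"
    unfolding V_def W(1)
  proof (rule indep_disjoint_regions[OF \<A>(1) \<A>_sets A(1) _ D W(2)])
    fix a assume "a \<in> \<A>"
    then show "a \<inter> A = {}" using \<A>(2) A(2) by (fastforce simp: slabs_def)
  qed
  have AE: "AE \<omega> in M. \<omega> \<in> H \<longleftrightarrow> \<omega> \<in> ZC \<inter> V"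
    using AE_\<rho> AE_space by eventually_elim (auto simp: H_eq ZC_def V_def)
  have "prob (H \<inter> W) = prob (ZC \<inter> (V \<inter> W))"
    using AE by (intro measure_eq_AE) (use H_ev ev in auto)
  also have "\<dots> = prob ZC * prob (V \<inter> W)"
    using ZC V W\<Sigma> by (intro indep_setD[OF ind]) auto
  also have "\<dots> = prob (ZC \<inter> V) * prob W"
    using indep_setD[OF ind ZC V] VW by simp
  also have "prob (ZC \<inter> V) = prob H"
    using AE by (intro measure_eq_AE) (use H_ev ev in auto)
  finally show ?thesis .
qed

text \<open>Independence passes from the intersection-stable generator \<open>past s\<close> to the
  sigma-algebra it generates.\<close>

lemma G_indep:
  assumes s: "0 \<le> s" and A: "A \<in> sets strip_measure" "A \<subseteq> {s<..} \<times> UNIV" and H: "H \<in> sets (G s)"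
  shows "prob (H \<inter> {\<omega> \<in> space M. emeasure (\<pi> \<omega>) A = k}) = prob H * prob {\<omega> \<in> space M. emeasure (\<pi> \<omega>) A = k}"
proof -
  let ?W = "{\<omega> \<in> space M. emeasure (\<pi> \<omega>) A = k}"
  have W: "?W \<in> events" by (rule count_sets[OF \<pi>_measurable[OF A(1)]])
  have "indep_set (past s) {?W}"
    unfolding indep_sets2_eq
    using past_F[OF s] F_sets[OF s] W past_indep[OF s A, of _ ?W "{k}"] by auto
  then have "indep_set (sigma_sets (space M) (past s)) (sigma_sets (space M) {?W})"
    using Int_stable_past by (intro indep_set_sigma_sets) (auto simp: Int_stable_def)
  moreover have "?W \<in> sigma_sets (space M) {?W}" by (rule sigma_sets.Basic) simp
  ultimately show ?thesis
    using H unfolding sets_G by (intro indep_setD)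
qed

lemma \<rho>_intensity:
  assumes s: "0 \<le> s" "s \<le> t" and H: "H \<in> sets (G s)" and B: "B \<in> sets borel" "B \<subseteq> {- b..b}"
  shows "(\<integral>\<^sup>+\<omega>. indicator H \<omega> * emeasure (\<rho> \<omega>) ({s<..t} \<times> B) \<partial>M) =
    emeasure M H * (ennreal (t - s) * emeasure lborel B)"
proof -
  let ?A = "{s<..t} \<times> B"
  have A: "?A \<in> sets strip_measure" using s B by (intro slab_sets)
  have "emeasure lborel B \<le> emeasure lborel {- b..b}"
    using B by (intro emeasure_mono) auto
  also have "\<dots> < \<infinity>" by (simp add: emeasure_lborel_Icc_eq)
  finally have fin: "emeasure strip_measure ?A < \<infinity>"
    using s B by (simp add: emeasure_strip ennreal_mult_less_top)
  have "AE \<omega> in M. emeasure (\<pi> \<omega>) ?A < \<infinity>"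
    using AE_\<rho> AE_space
  proof eventually_elim
    case (elim \<omega>)
    have "{0<..t} \<times> {- b..b} \<in> sets (\<pi> \<omega>)"
      unfolding sets_\<pi>[OF elim(2)] by (intro slab_sets) auto
    then have "emeasure (\<pi> \<omega>) ?A \<le> emeasure (\<pi> \<omega>) ({0<..t} \<times> {- b..b})"
      using s B by (intro emeasure_mono) auto
    also have "\<dots> < \<infinity>" using \<rho>_finite[OF elim(2)] elim(1) by simp
    finally show ?case .
  qed
  moreover have "H \<in> events" using H G_le_F[OF s(1)] F_sets[OF s(1)] by auto
  moreover have "?A \<subseteq> {s<..} \<times> UNIV" by auto
  ultimately have "(\<integral>\<^sup>+\<omega>. indicator H \<omega> * emeasure (\<pi> \<omega>) ?A \<partial>M) = emeasure M H * emeasure strip_measure ?A"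
    using G_indep[OF s(1) A _ H] by (intro nn_integral_indep_count A fin)
  moreover have "(\<integral>\<^sup>+\<omega>. indicator H \<omega> * emeasure (\<rho> \<omega>) ?A \<partial>M) = (\<integral>\<^sup>+\<omega>. indicator H \<omega> * emeasure (\<pi> \<omega>) ?A \<partial>M)"
    by (rule nn_integral_cong_AE) (use AE_\<rho> in eventually_elim, simp)
  ultimately show ?thesis using s B by (simp add: emeasure_strip)
qed

lemma past_in_G: "H \<in> past s \<Longrightarrow> H \<in> sets (G s)"
  unfolding sets_G by (rule sigma_sets.Basic)

lemma initial_G: "(\<lambda>\<omega>. (X0 \<omega>, Y0 \<omega>)) \<in> G 0 \<rightarrow>\<^sub>M count_space UNIV \<Otimes>\<^sub>M borel"
proof (rule measurableI)
  fix C :: "(nat \<times> real) set" assume C: "C \<in> sets (count_space UNIV \<Otimes>\<^sub>M borel)"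
  have "{\<omega> \<in> space M. (X0 \<omega>, Y0 \<omega>) \<in> C \<and> (\<forall>a\<in>{}. emeasure (\<rho> \<omega>) a \<in> UNIV)} \<in> past 0"
    unfolding past_def using C by blast
  then show "(\<lambda>\<omega>. (X0 \<omega>, Y0 \<omega>)) -` C \<inter> space (G 0) \<in> sets (G 0)"
    using past_in_G by (simp add: space_G vimage_def Int_def conj_commute)
qed (simp add: space_pair_measure)

lemma \<rho>_G:
  assumes t: "0 \<le> t" and B: "B \<in> sets borel"
  shows "(\<lambda>\<omega>. emeasure (\<rho> \<omega>) ({0<..t} \<times> B)) \<in> borel_measurable (G t)"
proof (rule measurableI)
  fix D :: "ennreal set" assume D: "D \<in> sets borel"
  have "{0<..t} \<times> B \<in> slabs t" using t B by (auto simp: slabs_def)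
  moreover have "UNIV \<in> sets (count_space UNIV \<Otimes>\<^sub>M borel :: (nat \<times> real) measure)"
    using sets.top[of "count_space UNIV \<Otimes>\<^sub>M borel :: (nat \<times> real) measure"] by (simp add: space_pair_measure)
  ultimately have "{\<omega> \<in> space M. (X0 \<omega>, Y0 \<omega>) \<in> UNIV \<and> (\<forall>a\<in>{{0<..t} \<times> B}. emeasure (\<rho> \<omega>) a \<in> D)} \<in> past t"
    unfolding past_def using D
    by (intro CollectI exI[of _ UNIV] exI[of _ "{{0<..t} \<times> B}"] exI[of _ "\<lambda>_. D"]) auto
  then show "(\<lambda>\<omega>. emeasure (\<rho> \<omega>) ({0<..t} \<times> B)) -` D \<inter> space (G t) \<in> sets (G t)"
    using past_in_G by (simp add: space_G vimage_def Int_def conj_commute)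
qed simp

lemma jump_noise: "jump_noise M G \<rho>"
proof
  show "0 \<le> t \<Longrightarrow> sets (G t) \<subseteq> sets M" for t
    using G_le_F F_sets by blast
qed (use space_G G_mono sets_\<rho> \<rho>_G \<rho>_finite \<rho>_intensity in auto)

end

text \<open>For each target state the essential bound holds off a null set of ages; countably many
  targets leave one common null set, off which the bounds can be summed.\<close>

lemma AE_total_rate_le:
  assumes le: "\<And>i j y n. (i, j) \<in> state_pairs \<Longrightarrow> 0 \<le> y \<Longrightarrow> lam i j y n \<le> lam_up i j y n"
    and up: "\<And>i j n. (i, j) \<in> state_pairs \<Longrightarrow>
           AE y in lborel. 0 \<le> y \<longrightarrow> ennreal (lam_up i j y n) \<le> rate_norm lam i j"
    and i: "i \<in> states"
  shows "AE y in lborel. 0 \<le> y \<longrightarrow> total_rate lam i y n \<le> rate_bound lam i"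
proof -
  have "AE y in lborel. \<forall>j. j \<in> states - {i} \<longrightarrow> 0 \<le> y \<longrightarrow> ennreal (lam_up i j y n) \<le> rate_norm lam i j"
    unfolding AE_all_countable
  proof
    fix j
    show "AE y in lborel. j \<in> states - {i} \<longrightarrow> 0 \<le> y \<longrightarrow> ennreal (lam_up i j y n) \<le> rate_norm lam i j"
      using up[of i j n] i by (cases "j \<in> states - {i}") (auto simp: state_pairs_def)
  qed
  then show ?thesis
  proof eventually_elim
    case (elim y)
    show ?case
    proof
      assume y: "0 \<le> y"
      have "ennreal (lam i j y n) \<le> rate_norm lam i j" if j: "j \<in> states - {i}" for j
      proof -
        have "ennreal (lam i j y n) \<le> ennreal (lam_up i j y n)"
          using le[of i j y n] i j y by (intro ennreal_leI) (auto simp: state_pairs_def)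
        also have "\<dots> \<le> rate_norm lam i j" using elim j y by blast
        finally show ?thesis .
      qed
      then show "total_rate lam i y n \<le> rate_bound lam i"
        unfolding total_rate_def rate_bound_def
        by (intro infsum_mono nonneg_summable_on_complete) auto
    qed
  qed
qed

theorem theorem2p4:
  fixes M :: "'w measure" and F :: "real \<Rightarrow> 'w measure"
    and \<pi> :: "'w \<Rightarrow> (real \<times> real) measure"
    and R :: "nat rel" and lam lam_up :: rates
    and X0 :: "'w \<Rightarrow> nat" and Y0 :: "'w \<Rightarrow> real"
  assumes "prob_space M" and "usual_hypothesis M F"
    and "strict_linear_order_on states R"
    and "measurable_rates lam" and "bounded_rates lam"
    and A1: "(SUP i\<in>states. rate_bound lam i) < \<infinity>"
    and A2: "\<And>i n. i \<in> states \<Longrightarrow> ((\<lambda>y. cumulative_rate lam i y n) \<longlongrightarrow> \<infinity>) at_top"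
    and "measurable_rates lam_up"
    and "\<And>i j y n. (i, j) \<in> state_pairs \<Longrightarrow> 0 \<le> y \<Longrightarrow> lam i j y n \<le> lam_up i j y n"
    and "\<And>i j n. (i, j) \<in> state_pairs \<Longrightarrow>
           AE y in lborel. 0 \<le> y \<longrightarrow> ennreal (lam_up i j y n) \<le> rate_norm lam i j"
    and "poisson_random_measure M strip_measure \<pi>" and "adapted_random_measure F \<pi>"
    and "initial_values M F \<pi> X0 Y0"
  shows "\<exists>X Y N. strong_solution M F \<pi> R lam lam_up X0 Y0 X Y N \<and>
           (\<forall>X' Y' N'. strong_solution M F \<pi> R lam lam_up X0 Y0 X' Y' N' \<longrightarrow>
              (AE \<omega> in M. \<forall>t\<ge>0. X' t \<omega> = X t \<omega> \<and> Y' t \<omega> = Y t \<omega> \<and> N' t \<omega> = N t \<omega>))"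
proof -
  define c where "c = enn2real (SUP i\<in>states. rate_bound lam i)"
  \<comment> \<open>(A1) makes the supremum finite, so nothing is lost in passing to a real
    number.\<close>
  have c: "ennreal c = (SUP i\<in>states. rate_bound lam i)"
    using A1 by (simp add: c_def)
  interpret prob_space M by fact
  interpret ps: poisson_system M \<pi> F X0 Y0
    by unfold_locales fact+
  interpret jump_noise M ps.G ps.\<rho> by (rule ps.jump_noise)
  interpret jump_rates R lam lam_up c
  proof
    show "0 \<le> c" by (simp add: c_def)
    fix i n assume i: "i \<in> states"
    have "AE y in lborel. 0 \<le> y \<longrightarrow> total_rate lam i y n \<le> rate_bound lam i"
      by (rule AE_total_rate_le[OF assms(9,10) i])
    moreover have "rate_bound lam i \<le> ennreal c" unfolding c using i by (rule SUP_upper)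
    ultimately show "AE y in lborel. 0 \<le> y \<longrightarrow> total_rate lam i y n \<le> ennreal c"
      by (auto elim!: eventually_mono intro: order_trans)
  qed fact+
  interpret driven_system R lam lam_up c M ps.G ps.\<rho> X0 Y0
  proof
    show "X0 \<in> measurable (ps.G 0) (count_space UNIV)" "Y0 \<in> borel_measurable (ps.G 0)"
      using measurable_compose[OF ps.initial_G measurable_fst] measurable_compose[OF ps.initial_G measurable_snd]
      by simp_all
    show "AE \<omega> in M. \<forall>t>0. emeasure (ps.\<rho> \<omega>) ({t} \<times> UNIV) \<le> 1"
      using ps.AE_\<pi>_simple ps.AE_\<rho> by eventually_elim simp
  qed (use ps.X0 ps.Y0 ps.\<rho>_int in auto)
  \<comment> \<open>The construction is driven by \<open>ps.\<rho>\<close> over \<open>ps.G\<close>.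
    The equations transfer to \<pi> because the two measures agree almost surely, and adaptedness
    transfers to \<open>F\<close> by its right continuity.\<close>
  have strong: "strong_solution M F \<pi> R lam lam_up X0 Y0 X Y N"
    unfolding strong_solution_def
  proof (intro conjI allI impI ballI)
    fix t :: real assume t: "0 \<le> t"
    show "X t \<in> measurable (F t) (count_space UNIV)" "Y t \<in> borel_measurable (F t)"
      "N t \<in> measurable (F t) (count_space UNIV)"
      by (rule X_adapted Y_adapted N_adapted; use ps.F_space ps.G_le_F ps.right_continuous t in blast)+
  next
    show "AE \<omega> in M. cadlag (\<lambda>t. X t \<omega>) \<and> cadlag (\<lambda>t. Y t \<omega>) \<and> cadlag (\<lambda>t. N t \<omega>) \<and>
        solves_system R lam lam_up (\<pi> \<omega>) (X0 \<omega>) (Y0 \<omega>) (\<lambda>t. X t \<omega>) (\<lambda>t. Y t \<omega>) (\<lambda>t. N t \<omega>)"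
      using AE_solution ps.AE_\<rho> by eventually_elim simp
  qed (simp_all add: X_states Y_nonneg)
  \<comment> \<open>The comparison is made path by path off one null set, so it applies to every
    competitor adapted to \<open>F\<close>, whether or not it is adapted to
    \<open>ps.G\<close>.\<close>
  have "AE \<omega> in M. \<forall>t\<ge>0. X' t \<omega> = X t \<omega> \<and> Y' t \<omega> = Y t \<omega> \<and> N' t \<omega> = N t \<omega>"
    if "strong_solution M F \<pi> R lam lam_up X0 Y0 X' Y' N'" for X' Y' N'
  proof -
    have "AE \<omega> in M. cadlag (\<lambda>t. X' t \<omega>) \<and> cadlag (\<lambda>t. Y' t \<omega>) \<and> cadlag (\<lambda>t. N' t \<omega>) \<and>
        solves_system R lam lam_up (\<pi> \<omega>) (X0 \<omega>) (Y0 \<omega>) (\<lambda>t. X' t \<omega>) (\<lambda>t. Y' t \<omega>) (\<lambda>t. N' t \<omega>)"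
      using that by (simp add: strong_solution_def)
    then show ?thesis
      using AE_solution ps.AE_\<rho> AE_space
    proof eventually_elim
      case (elim \<omega>)
      then show ?case
        using solves_system_unique[OF ps.sets_\<pi>, of \<omega> "X0 \<omega>" "Y0 \<omega>"
            "\<lambda>t. X t \<omega>" "\<lambda>t. Y t \<omega>" "\<lambda>t. N t \<omega>" "\<lambda>t. X' t \<omega>" "\<lambda>t. Y' t \<omega>" "\<lambda>t. N' t \<omega>"]
        by simp
    qed
  qed
  with strong show ?thesis by blast
qed

end
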